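(* Let $A\subseteq \{1,2,\dots, N\}$ be a set of size $\alpha N$ and let $a_1 x_1 + a_2 x_2 + \cdots +a_k x_k =0$ be an invariant equation in $k\geq 4$ variables. Then there is a large constant $C$ (independent of $N$ and $A$) such that there are at least \[\exp\bigl(-C\log^7(2/\alpha)\bigr)N^{k-1}\] solutions to the equation, that is, tuples $(x_1,\dots,x_k)\in A^k$ with $a_1x_1+\cdots+a_kx_k=0$.
   Context: A linear equation $a_1x_1+\cdots+a_kx_k=0$ with coefficients $a_i\in\mathbb{Z}$ is called invariant if $a_1+a_2+\cdots+a_k=0$. *)

theory Defs
  imports Complex_Main "HOL-Library.FuncSet"
begin

definition invariant_eq :: "nat \<Rightarrow> (nat \<Rightarrow> int) \<Rightarrow> bool" where
  "invariant_eq k a \<longleftrightarrow> (\<Sum>i<k. a i) = 0"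

definition solutions :: "nat \<Rightarrow> (nat \<Rightarrow> int) \<Rightarrow> nat set \<Rightarrow> (nat \<Rightarrow> nat) set" where
  "solutions k a A = {x \<in> {..<k} \<rightarrow>\<^sub>E A. (\<Sum>i<k. a i * int (x i)) = 0}"

end

theory Submission
  imports Defs "HOL-Analysis.Analysis"
begin

text \<open>
  Density increment in the integers along Bohr sets, after Schoen and Sisask. If \<open>A\<close> is dense on a
  Bohr set, rescaling by \<open>c\<^sub>i = \<Prod>\<^sub>j\<^sub>\<noteq>\<^sub>i a\<^sub>j\<close> turns the equation into \<open>b\<^sub>1 + \<dots> + b\<^sub>k = 0\<close> for dense
  subsets \<open>E\<^sub>i\<close> of smaller Bohr sets. Fix \<open>b\<^sub>5, \<dots>, b\<^sub>k\<close>. If there are few solutions, then the popular sums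
  of \<open>E\<^sub>1 + E\<^sub>2\<close> or their complement give a set \<open>S\<close> filling at most half of the ambient Bohr set and containing
  almost all sums of two of the sets, \<open>E\<close> and \<open>F\<close> say. By Croot--Sisask sampling the number of pairs with sum
  in \<open>S - v\<close> is almost periodic in \<open>v\<close> along a set \<open>T\<close> of relative density \<open>exp (- O(log\<^sup>4 (2/\<alpha>)))\<close>; smoothing by
  \<open>O(log (2/\<alpha>))\<close> copies of \<open>T - T\<close> leaves only the large spectrum of \<open>T\<close>, which a local form of Chang's
  theorem annihilates on a Bohr set with \<open>O(log\<^sup>4 (2/\<alpha>))\<close> further frequencies. Averaging over it, \<open>E\<close> has
  density at least \<open>3/2\<close> times its own on a translate. After \<open>O(log (2/\<alpha>))\<close> steps the rank is \<open>O(log\<^sup>5 (2/\<alpha>))\<close>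
  and the radius \<open>exp (- O(log\<^sup>2 (2/\<alpha>)))\<close>, whence the exponent \<open>7 = 5 + 2\<close>.
\<close>

section \<open>Bohr sets in the integers\<close>

text \<open>Four variables are what the argument needs: the sums \<open>b1 + b2\<close> and the
  negatives of \<open>b3 + b4 + y\<close>, with y the sum of the fixed variables, must meet often.
  If they do not, a set filling at most half of the ambient set catches nearly all sums of one pair,
  and this forces a gain by a constant factor. A gain read off from one large Fourier coefficient
  would depend on \<alpha> and cost powers of 1/\<alpha> in the number of steps. The substitution
  x_i = x + c_i b_i needs one x that is good for all i. It exists unless A is denser on a translated
  dilate of a small Bohr set, and this second source of increments yields only a factor 1 + \<eta>,
  \<eta> = 1/(100 k). Both sources are recorded with that factor, so the number of steps acquires a
  factor k. With L = log (2/\<alpha>), the density of T arises thus: O(L) smoothings require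
  sampling accuracy of order 1/L, hence O(L^2) * O(L) samples, each costing a factor O(1/\<alpha>)
  in the size of T. Working in the integers, with an interval condition inside each Bohr set, avoids
  inverting the c_i modulo anything; a cyclic group serves only for Fourier inversion.\<close>

lemma exp_le_quadratic:
  fixes y :: real
  assumes "\<bar>y\<bar> \<le> 1"
  shows "exp y \<le> 1 + y + y\<^sup>2"
proof (cases "y \<ge> 0")
  case True
  then show ?thesis using exp_bound[of y] assms by simp
next
  case False
  define z where "z = - y"
  have z: "0 < z" "z \<le> 1" using False assms by (auto simp: z_def)
  have "exp (- z) \<le> 1 / (1 + z)"
    using exp_ge_add_one_self[of z] z by (simp add: exp_minus inverse_eq_divide frac_le)
  also have "\<dots> \<le> 1 - z + z\<^sup>2"
  proof -
    have "(1 - z + z\<^sup>2) * (1 + z) = 1 + z ^ 3" by (simp add: algebra_simps power2_eq_square power3_eq_cube)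
    then show ?thesis using z by (simp add: divide_le_eq)
  qed
  finally show ?thesis by (simp add: z_def)
qed

section \<open>Characters of the integers\<close>

definition ee :: "real \<Rightarrow> int \<Rightarrow> complex" where
  "ee \<theta> x = cis (2 * pi * \<theta> * of_int x)"

lemma ee_add: "ee \<theta> (x + y) = ee \<theta> x * ee \<theta> y"
  by (simp add: ee_def cis_mult algebra_simps)

lemma ee_add_freq: "ee (\<theta> + \<phi>) x = ee \<theta> x * ee \<phi> x"
  by (simp add: ee_def cis_mult algebra_simps)

lemma ee_0 [simp]: "ee \<theta> 0 = 1" by (simp add: ee_def)
lemma ee_0_freq [simp]: "ee 0 x = 1" by (simp add: ee_def)
lemma norm_ee [simp]: "cmod (ee \<theta> x) = 1" by (simp add: ee_def)

lemma cnj_ee: "cnj (ee \<theta> x) = ee \<theta> (- x)" by (simp add: ee_def cis_cnj)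
lemma ee_minus_freq: "ee (- \<theta>) x = ee \<theta> (- x)" by (simp add: ee_def)

lemma ee_sum: "ee \<theta> (\<Sum>i\<in>I. f i) = (\<Prod>i\<in>I. ee \<theta> (f i))"
  by (induction I rule: infinite_finite_induct) (auto simp: ee_add)

lemma ee_sum_freq: "ee (\<Sum>i\<in>I. f i) x = (\<Prod>i\<in>I. ee (f i) x)"
  by (induction I rule: infinite_finite_induct) (auto simp: ee_add_freq)

lemma ee_minus_dist: "cmod (ee \<theta> (- x) - 1) = cmod (ee \<theta> x - 1)"
proof -
  have "cmod (ee \<theta> (- x) - 1) = cmod (cnj (ee \<theta> x - 1))" by (simp add: cnj_ee)
  then show ?thesis by (simp only: complex_mod_cnj)
qed

lemma ee_mult_dist:
  fixes z w :: complex
  assumes "cmod z = 1"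
  shows "cmod (z * w - 1) \<le> cmod (z - 1) + cmod (w - 1)"
proof -
  have "z * w - 1 = z * (w - 1) + (z - 1)" by (simp add: algebra_simps)
  then have "cmod (z * w - 1) \<le> cmod (z * (w - 1)) + cmod (z - 1)" by (metis norm_triangle_ineq)
  then show ?thesis using assms by (simp add: norm_mult)
qed

lemma ee_add_dist: "cmod (ee \<theta> (x + y) - 1) \<le> cmod (ee \<theta> x - 1) + cmod (ee \<theta> y - 1)"
  by (simp add: ee_add ee_mult_dist)

lemma ee_dist_le_2: "cmod (ee \<theta> x - 1) \<le> 2"
  using norm_triangle_ineq4[of "ee \<theta> x" 1] by simp

text \<open>The bound \<delta> N on the size of x acts as one more frequency: it makes the set
  finite, scales with the same radius, and accounts for the \<open>+ 1\<close> in the exponents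
  \<open>2 * card \<Theta> + 1\<close>. Frequencies are reals, not classes modulo 1, so integer
  combinations of them are ordinary sums.\<close>

definition bohr :: "nat \<Rightarrow> real set \<Rightarrow> real \<Rightarrow> int set" where
  "bohr N \<Theta> \<delta> = {x. \<bar>real_of_int x\<bar> \<le> \<delta> * real N \<and> (\<forall>\<theta>\<in>\<Theta>. cmod (ee \<theta> x - 1) \<le> \<delta>)}"

lemma finite_bohr [simp]: "finite (bohr N \<Theta> \<delta>)"
proof (rule finite_subset)
  show "bohr N \<Theta> \<delta> \<subseteq> {-\<lceil>\<delta> * real N\<rceil>..\<lceil>\<delta> * real N\<rceil>}"
    unfolding bohr_def by (auto simp: abs_le_iff le_ceiling_iff) linarith+
qed simp

lemma zero_in_bohr: "\<delta> \<ge> 0 \<Longrightarrow> 0 \<in> bohr N \<Theta> \<delta>"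
  by (auto simp: bohr_def)

lemma card_bohr_pos: "\<delta> \<ge> 0 \<Longrightarrow> card (bohr N \<Theta> \<delta>) > 0"
  using zero_in_bohr[of \<delta> N \<Theta>] by (auto simp: card_gt_0_iff)

lemma bohr_mono: "\<delta> \<le> \<delta>' \<Longrightarrow> \<Theta>' \<subseteq> \<Theta> \<Longrightarrow> bohr N \<Theta> \<delta> \<subseteq> bohr N \<Theta>' \<delta>'"
  unfolding bohr_def by (auto intro: order_trans mult_right_mono) (meson order_trans mult_right_mono of_nat_0_le_iff)

lemma bohr_minus: "x \<in> bohr N \<Theta> \<delta> \<Longrightarrow> - x \<in> bohr N \<Theta> \<delta>"
  unfolding bohr_def by (auto simp: ee_minus_dist)

lemma bohr_minus_iff [simp]: "- x \<in> bohr N \<Theta> \<delta> \<longleftrightarrow> x \<in> bohr N \<Theta> \<delta>"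
  using bohr_minus[of x] bohr_minus[of "-x"] by auto

lemma bohr_add:
  assumes "x \<in> bohr N \<Theta> \<delta>" "y \<in> bohr N \<Theta> \<delta>'"
  shows "x + y \<in> bohr N \<Theta> (\<delta> + \<delta>')"
proof -
  have "cmod (ee \<theta> (x + y) - 1) \<le> \<delta> + \<delta>'" if "\<theta> \<in> \<Theta>" for \<theta>
    using ee_add_dist[of \<theta> x y] assms that unfolding bohr_def by fastforce
  moreover have "\<bar>real_of_int (x + y)\<bar> \<le> (\<delta> + \<delta>') * real N"
    using assms unfolding bohr_def by (auto simp: algebra_simps)
  ultimately show ?thesis unfolding bohr_def by auto
qed

lemma bohr_diff: "x \<in> bohr N \<Theta> \<delta> \<Longrightarrow> y \<in> bohr N \<Theta> \<delta>' \<Longrightarrow> x - y \<in> bohr N \<Theta> (\<delta> + \<delta>')"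
  using bohr_add[of x N \<Theta> \<delta> "-y" \<delta>'] by simp

lemma bohr_sum:
  assumes "finite I" "\<And>i. i \<in> I \<Longrightarrow> f i \<in> bohr N \<Theta> \<delta>"
  shows "(\<Sum>i\<in>I. f i) \<in> bohr N \<Theta> (real (card I) * \<delta>)"
  using assms
proof (induction I rule: finite_induct)
  case empty
  then show ?case by (simp add: zero_in_bohr)
next
  case (insert i I)
  then have "f i + (\<Sum>i\<in>I. f i) \<in> bohr N \<Theta> (\<delta> + real (card I) * \<delta>)"
    by (intro bohr_add) auto
  then show ?case using insert by (simp add: algebra_simps)
qed

lemma bohr_scale_nat:
  assumes "x \<in> bohr N \<Theta> \<delta>"
  shows "int n * x \<in> bohr N \<Theta> (real n * \<delta>)"
  using bohr_sum[of "{..<n}" "\<lambda>_. x"] assms by simp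

lemma bohr_scale:
  assumes "x \<in> bohr N \<Theta> \<delta>"
  shows "c * x \<in> bohr N \<Theta> (\<bar>real_of_int c\<bar> * \<delta>)"
proof -
  have "int (nat \<bar>c\<bar>) * x \<in> bohr N \<Theta> (real (nat \<bar>c\<bar>) * \<delta>)" by (rule bohr_scale_nat[OF assms])
  then have *: "\<bar>c\<bar> * x \<in> bohr N \<Theta> (\<bar>real_of_int c\<bar> * \<delta>)" by simp
  show ?thesis
  proof (cases "c \<ge> 0")
    case True then show ?thesis using * by simp
  next
    case False
    then have "c * x = - (\<bar>c\<bar> * x)" by simp
    then show ?thesis using * bohr_minus by metis
  qed
qed

lemma floor_eq_imp_abs_diff_le:
  fixes a b :: real
  assumes "\<lfloor>a\<rfloor> = \<lfloor>b\<rfloor>"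
  shows "\<bar>a - b\<bar> \<le> 1"
  using floor_correct[of a] floor_correct[of b] unfolding assms by linarith

text \<open>Two points with the same colour, recorded to precision \<open>\<delta>/2\<close>, differ by an element of the
  Bohr set of radius \<open>\<delta>\<close>.\<close>
lemma card_bohr_scale:
  assumes "finite \<Theta>" "\<delta> > 0" "N \<ge> 1" "n \<ge> 1"
  shows "card (bohr N \<Theta> (real n * \<delta>)) \<le> (5 * n) ^ (2 * card \<Theta> + 1) * card (bohr N \<Theta> \<delta>)"
proof -
  let ?X = "bohr N \<Theta> (real n * \<delta>)" and ?I = "{- (2 * int n)..2 * int n}"
  define c where "c x = (restrict (\<lambda>\<theta>. (\<lfloor>2 * Re (ee \<theta> x - 1) / \<delta>\<rfloor>, \<lfloor>2 * Im (ee \<theta> x - 1) / \<delta>\<rfloor>)) \<Theta>,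
      \<lfloor>real_of_int x / (\<delta> * real N)\<rfloor>)" for x
  have fl: "\<lfloor>2 * y / \<delta>\<rfloor> \<in> ?I" if "\<bar>y\<bar> \<le> real n * \<delta>" for y
  proof -
    have "\<bar>2 * y / \<delta>\<bar> \<le> 2 * real n" using that assms(2) by (simp add: field_simps)
    then have "- (2 * real n) \<le> 2 * y / \<delta>" "2 * y / \<delta> < 2 * real n + 1" by linarith+
    then show ?thesis unfolding atLeastAtMost_iff le_floor_iff floor_le_iff by simp
  qed
  have "c ` ?X \<subseteq> (PiE \<Theta> (\<lambda>_. ?I \<times> ?I)) \<times> ?I"
  proof
    fix z assume "z \<in> c ` ?X"
    then obtain x where x: "x \<in> ?X" "z = c x" by auto
    have 1: "\<bar>Re (ee \<theta> x - 1)\<bar> \<le> real n * \<delta>" "\<bar>Im (ee \<theta> x - 1)\<bar> \<le> real n * \<delta>" if "\<theta> \<in> \<Theta>" for \<theta>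
      using x that abs_Re_le_cmod[of "ee \<theta> x - 1"] abs_Im_le_cmod[of "ee \<theta> x - 1"]
      unfolding bohr_def by fastforce+
    have "\<bar>real_of_int x\<bar> \<le> real n * \<delta> * real N" using x by (auto simp: bohr_def)
    then have "\<bar>real_of_int x / (\<delta> * real N)\<bar> \<le> real n"
      using assms by (simp add: field_simps abs_mult)
    then have "- (2 * real n) \<le> real_of_int x / (\<delta> * real N)"
      "real_of_int x / (\<delta> * real N) < 2 * real n + 1" by linarith+
    then have "\<lfloor>real_of_int x / (\<delta> * real N)\<rfloor> \<in> ?I"
      unfolding atLeastAtMost_iff le_floor_iff floor_le_iff by simp
    then show "z \<in> (PiE \<Theta> (\<lambda>_. ?I \<times> ?I)) \<times> ?I"
      unfolding x c_def using fl[OF 1(1)] fl[OF 1(2)]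
      by (intro SigmaI restrict_PiE_iff[THEN iffD2] ballI)
  qed
  then have "card (c ` ?X) \<le> card ((PiE \<Theta> (\<lambda>_. ?I \<times> ?I)) \<times> ?I)"
    using assms by (intro card_mono) (auto intro!: finite_PiE)
  also have "\<dots> = (4 * n + 1) ^ (2 * card \<Theta> + 1)"
  proof -
    have "card ?I = 4 * n + 1" by simp
    then show ?thesis using assms(1)
      by (simp only: card_PiE card_cartesian_product prod_constant power_add power_mult
          power2_eq_square power_one_right)
  qed
  also have "\<dots> \<le> (5 * n) ^ (2 * card \<Theta> + 1)" using assms by (intro power_mono) auto
  finally have colours: "card (c ` ?X) \<le> (5 * n) ^ (2 * card \<Theta> + 1)" .
  have cls: "card {x \<in> ?X. c x = z} \<le> card (bohr N \<Theta> \<delta>)" for z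
  proof (cases "{x \<in> ?X. c x = z} = {}")
    case False
    then obtain x0 where x0: "x0 \<in> ?X" "c x0 = z" by auto
    have "x - x0 \<in> bohr N \<Theta> \<delta>" if x: "x \<in> ?X" "c x = z" for x
    proof -
      \<comment> \<open>Half of \<delta> for each of the real and imaginary parts, because the sum
        of the two bounds the modulus.\<close>
      have eqf: "\<bar>y - y'\<bar> \<le> \<delta> / 2" if "\<lfloor>2 * y / \<delta>\<rfloor> = \<lfloor>2 * y' / \<delta>\<rfloor>" for y y'
      proof -
        have "\<bar>2 * y / \<delta> - 2 * y' / \<delta>\<bar> \<le> 1" using that by (rule floor_eq_imp_abs_diff_le)
        then have "\<bar>2 * y - 2 * y'\<bar> \<le> \<delta>" using assms(2)
          by (simp add: diff_divide_distrib[symmetric] divide_le_eq)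
        then show ?thesis by linarith
      qed
      have ceq: "c x = c x0" using x x0 by simp
      have "cmod (ee \<theta> (x - x0) - 1) \<le> \<delta>" if t: "\<theta> \<in> \<Theta>" for \<theta>
      proof -
        have "fst (c x) \<theta> = fst (c x0) \<theta>" using ceq by simp
        then have "\<lfloor>2 * Re (ee \<theta> x - 1) / \<delta>\<rfloor> = \<lfloor>2 * Re (ee \<theta> x0 - 1) / \<delta>\<rfloor>"
          "\<lfloor>2 * Im (ee \<theta> x - 1) / \<delta>\<rfloor> = \<lfloor>2 * Im (ee \<theta> x0 - 1) / \<delta>\<rfloor>"
          using t by (simp_all only: c_def fst_conv restrict_apply' prod.inject)
        then have "\<bar>Re (ee \<theta> x - 1) - Re (ee \<theta> x0 - 1)\<bar> \<le> \<delta> / 2"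
          "\<bar>Im (ee \<theta> x - 1) - Im (ee \<theta> x0 - 1)\<bar> \<le> \<delta> / 2"
          using eqf by blast+
        then have "cmod (ee \<theta> x - ee \<theta> x0) \<le> \<delta>"
          using cmod_le[of "ee \<theta> x - ee \<theta> x0"] by simp
        moreover have "ee \<theta> x = ee \<theta> (x - x0) * ee \<theta> x0" by (simp flip: ee_add)
        then have "ee \<theta> x - ee \<theta> x0 = (ee \<theta> (x - x0) - 1) * ee \<theta> x0" by (simp add: algebra_simps)
        ultimately show ?thesis by (simp add: norm_mult)
      qed
      moreover have "\<bar>real_of_int (x - x0)\<bar> \<le> \<delta> * real N"
      proof -
        have "\<lfloor>real_of_int x / (\<delta> * real N)\<rfloor> = \<lfloor>real_of_int x0 / (\<delta> * real N)\<rfloor>"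
          using ceq by (simp add: c_def)
        then have "\<bar>real_of_int x / (\<delta> * real N) - real_of_int x0 / (\<delta> * real N)\<bar> \<le> 1"
          by (rule floor_eq_imp_abs_diff_le)
        moreover have "\<delta> * real N > 0" using assms by simp
        ultimately show ?thesis
          by (simp add: diff_divide_distrib[symmetric] divide_le_eq)
      qed
      ultimately show ?thesis by (simp add: bohr_def)
    qed
    then have "(\<lambda>x. x - x0) ` {x \<in> ?X. c x = z} \<subseteq> bohr N \<Theta> \<delta>" by auto
    moreover have "inj_on (\<lambda>x. x - x0) {x \<in> ?X. c x = z}" by (auto simp: inj_on_def)
    ultimately show ?thesis by (intro card_inj_on_le[of "\<lambda>x. x - x0"]) auto
  next
    case True
    then show ?thesis by (simp only: card.empty)
  qed
  have "card ?X = (\<Sum>z\<in>c ` ?X. card {x \<in> ?X. c x = z})"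
    using sum.image_gen[of ?X "\<lambda>_. 1::nat" c] by simp
  also have "\<dots> \<le> (\<Sum>z\<in>c ` ?X. card (bohr N \<Theta> \<delta>))" by (intro sum_mono cls)
  also have "\<dots> = card (c ` ?X) * card (bohr N \<Theta> \<delta>)" by simp
  also have "\<dots> \<le> (5 * n) ^ (2 * card \<Theta> + 1) * card (bohr N \<Theta> \<delta>)"
    using colours by (intro mult_right_mono) auto
  finally show ?thesis .
qed

text \<open>Radius 2 puts no condition on the frequencies, since two points of the unit circle are
  at distance at most 2; shrinking by the factor n loses only the number of colours.\<close>

lemma card_bohr_lower:
  assumes "finite \<Theta>" "N \<ge> 1" "n \<ge> 1"
  shows "N \<le> (5 * n) ^ (2 * card \<Theta> + 1) * card (bohr N \<Theta> (2 / real n))"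
proof -
  have "{1..int N} \<subseteq> bohr N \<Theta> 2"
    unfolding bohr_def using ee_dist_le_2 by (auto simp: abs_le_iff)
  then have "card {1..int N} \<le> card (bohr N \<Theta> 2)" by (intro card_mono) auto
  then show ?thesis using card_bohr_scale[of \<Theta> "2 / real n" N n] assms by simp
qed

text \<open>Substitute for closure under addition, after Bourgain: a summand from a Bohr set whose
  radius is within the margin added to \<delta> pushes few points out. Only outward growth is
  controlled, as the sets are always compared with their enlargements.\<close>

definition bohr_reg :: "nat \<Rightarrow> real set \<Rightarrow> real \<Rightarrow> real \<Rightarrow> bool" where
  "bohr_reg N \<Theta> \<eta> \<delta> \<longleftrightarrow>
     real (card (bohr N \<Theta> (\<delta> + \<eta> * \<delta> / (22 * (2 * real (card \<Theta>) + 1)))))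
       \<le> (1 + \<eta>) * real (card (bohr N \<Theta> \<delta>))"

text \<open>If every radius between \<delta>/2 and \<delta> failed, each step of length \<sigma>
  would multiply the size by more than 1 + \<eta>. Over the d p steps that fit, the size would grow
  by more than 10^d, against the doubling bound (5 * 2)^d.\<close>

lemma exists_bohr_reg:
  assumes fin: "finite \<Theta>" and "\<delta> > 0" "N \<ge> 1" "0 < \<eta>" "\<eta> \<le> 1"
  shows "\<exists>\<delta>'. \<delta> / 2 \<le> \<delta>' \<and> \<delta>' \<le> \<delta> \<and> bohr_reg N \<Theta> \<eta> \<delta>'"
proof (rule ccontr)
  assume no: "\<not> ?thesis"
  define d where "d = 2 * card \<Theta> + 1"
  \<comment> \<open>(1 + \<eta>)^p > 10 by Bernoulli's inequality, while p \<eta> \<le> 11 keeps d p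
    steps within length \<delta>/2; this is the origin of 22 = 2 * 11.\<close>
  define p where "p = nat \<lceil>10 / \<eta>\<rceil>"
  define K where "K = d * p"
  define \<sigma> where "\<sigma> = \<eta> * \<delta> / (22 * real d)"
  define b where "b i = real (card (bohr N \<Theta> (\<delta> / 2 + real i * \<sigma>)))" for i
  have rd: "2 * real (card \<Theta>) + 1 = real d" by (simp add: d_def)
  have d: "d \<ge> 1" by (simp add: d_def)
  have \<sigma>: "\<sigma> > 0" using assms d by (simp add: \<sigma>_def)
  have p1: "real p \<ge> 10 / \<eta>" unfolding p_def by linarith
  have "10 / \<eta> \<ge> 10" using assms by (simp add: field_simps)
  then have "real p \<le> 11 / \<eta>" "p \<ge> 1"
  proof -
    have "real p \<le> 10 / \<eta> + 1" unfolding p_def using \<open>10 / \<eta> \<ge> 10\<close> by linarith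
    also have "\<dots> \<le> 11 / \<eta>" using assms by (simp add: field_simps)
    finally show "real p \<le> 11 / \<eta>" .
    show "p \<ge> 1" using p1 \<open>10 / \<eta> \<ge> 10\<close> by linarith
  qed
  have "real p * \<eta> \<le> 11" using \<open>real p \<le> 11 / \<eta>\<close> assms by (simp add: field_simps)
  then have K\<sigma>: "real K * \<sigma> \<le> \<delta> / 2"
    using d assms by (simp add: K_def \<sigma>_def field_simps)
  have step: "b (Suc i) > (1 + \<eta>) * b i" if "i < K" for i
  proof -
    let ?r = "\<delta> / 2 + real i * \<sigma>"
    have "real i * \<sigma> \<le> real K * \<sigma>" using that \<sigma> by (intro mult_right_mono) auto
    then have "real i * \<sigma> \<le> \<delta> / 2" "0 \<le> real i * \<sigma>" using K\<sigma> \<sigma> by (linarith, simp)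
    then have r: "\<delta> / 2 \<le> ?r" "?r \<le> \<delta>" by linarith+
    then have "\<not> bohr_reg N \<Theta> \<eta> ?r" using no by blast
    then have "(1 + \<eta>) * b i < real (card (bohr N \<Theta> (?r + \<eta> * ?r / (22 * real d))))"
      unfolding bohr_reg_def rd b_def by (simp only: not_le)
    also have "\<dots> \<le> b (Suc i)"
    proof -
      have "\<eta> * ?r / (22 * real d) \<le> \<sigma>"
        using divide_right_mono[OF mult_left_mono[OF r(2), of \<eta>], of "22 * real d"] assms
        by (simp add: \<sigma>_def)
      then have "?r + \<eta> * ?r / (22 * real d) \<le> \<delta> / 2 + real (Suc i) * \<sigma>" by (simp add: algebra_simps)
      then show ?thesis unfolding b_def by (intro of_nat_mono card_mono finite_bohr bohr_mono) auto
    qed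
    finally show ?thesis .
  qed
  have ge: "b i \<ge> (1 + \<eta>) ^ i * b 0" if "i \<le> K" for i
    using that
  proof (induction i)
    case (Suc i)
    have "(1 + \<eta>) ^ Suc i * b 0 = (1 + \<eta>) * ((1 + \<eta>) ^ i * b 0)" by simp
    also have "\<dots> \<le> (1 + \<eta>) * b i" using Suc assms by (intro mult_left_mono) auto
    also have "\<dots> \<le> b (Suc i)" using step[of i] Suc by simp
    finally show ?case .
  qed simp
  have b0: "b 0 > 0" using card_bohr_pos[of "\<delta>/2" N \<Theta>] assms by (simp add: b_def)
  have "1 + real p * \<eta> \<le> (1 + \<eta>) ^ p" using assms by (intro Bernoulli_inequality) auto
  moreover have "real p * \<eta> \<ge> 10" using p1 assms by (simp add: field_simps)
  ultimately have "(1 + \<eta>) ^ p > 10" by linarith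
  then have "((1 + \<eta>) ^ p) ^ d > 10 ^ d" using d by (intro power_strict_mono) auto
  then have "(1 + \<eta>) ^ K > 10 ^ d" by (simp add: K_def power_mult[symmetric] mult.commute)
  then have "10 ^ d * b 0 < (1 + \<eta>) ^ K * b 0" using b0 by simp
  also have "\<dots> \<le> b K" using ge by simp
  also have "\<dots> \<le> real (card (bohr N \<Theta> \<delta>))"
    unfolding b_def using K\<sigma> by (intro of_nat_mono card_mono finite_bohr bohr_mono) auto
  also have "\<dots> \<le> 10 ^ d * b 0"
  proof -
    have "card (bohr N \<Theta> (real 2 * (\<delta> / 2))) \<le> (5 * 2) ^ d * card (bohr N \<Theta> (\<delta> / 2))"
      unfolding d_def by (rule card_bohr_scale) (use assms in auto)
    then have "real (card (bohr N \<Theta> \<delta>)) \<le> real (10 ^ d * card (bohr N \<Theta> (\<delta> / 2)))"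
      by (intro of_nat_mono) simp
    then show ?thesis by (simp add: b_def)
  qed
  finally show False by simp
qed

section \<open>Croot--Sisask almost periodicity\<close>

text \<open>The linear term drops out because g has mean zero; the quadratic one is absorbed into
  the exponential.\<close>

lemma sum_exp_le:
  fixes g :: "'a \<Rightarrow> real"
  assumes "\<And>f. f \<in> F \<Longrightarrow> \<bar>g f\<bar> \<le> 1" "(\<Sum>f\<in>F. g f) = 0" "\<bar>r\<bar> \<le> 1"
  shows "(\<Sum>f\<in>F. exp (r * g f)) \<le> real (card F) * exp (r\<^sup>2)"
proof -
  have "exp (r * g f) \<le> 1 + r * g f + r\<^sup>2" if "f \<in> F" for f
  proof -
    have "\<bar>r * g f\<bar> \<le> 1 * 1" unfolding abs_mult using assms that by (intro mult_mono) auto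
    then have "exp (r * g f) \<le> 1 + r * g f + (r * g f)\<^sup>2" by (intro exp_le_quadratic) simp
    moreover have "(r * g f)\<^sup>2 \<le> r\<^sup>2 * 1"
      unfolding power_mult_distrib using assms(1)[OF that]
      by (intro mult_left_mono) (auto simp: abs_square_le_1)
    ultimately show ?thesis by simp
  qed
  then have "(\<Sum>f\<in>F. exp (r * g f)) \<le> (\<Sum>f\<in>F. 1 + r * g f + r\<^sup>2)" by (rule sum_mono)
  also have "\<dots> = real (card F) * (1 + r\<^sup>2)"
    by (simp add: sum.distrib sum_distrib_left[symmetric] assms(2) algebra_simps)
  also have "\<dots> \<le> real (card F) * exp (r\<^sup>2)" by (intro mult_left_mono) auto
  finally show ?thesis .
qed

text \<open>Chernoff's bound with probabilities written as counts: a sample of size m is an element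
  of \<open>{..<m} \<rightarrow>\<^sub>E F\<close>, and independence is the product formula for sums
  over that set.\<close>

lemma card_tail_le:
  fixes g :: "'a \<Rightarrow> real"
  assumes "finite F" "\<And>f. f \<in> F \<Longrightarrow> \<bar>g f\<bar> \<le> 1" "(\<Sum>f\<in>F. g f) = 0" "0 < \<epsilon>" "\<epsilon> \<le> 1"
  shows "real (card {b \<in> {..<m} \<rightarrow>\<^sub>E F. (\<Sum>j<m. g (b j)) > \<epsilon> * real m})
    \<le> exp (- (\<epsilon>\<^sup>2 * real m / 4)) * real (card F) ^ m"
proof -
  let ?G = "{..<m} \<rightarrow>\<^sub>E F" let ?P = "{b \<in> ?G. (\<Sum>j<m. g (b j)) > \<epsilon> * real m}"
  \<comment> \<open>The value that minimises r^2 m - r \<epsilon> m, with minimum -\<epsilon>^2 m /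
    4.\<close>
  define r where "r = \<epsilon> / 2"
  have fin: "finite ?G" using assms(1) by (intro finite_PiE) auto
  have "real (card ?P) * exp (r * (\<epsilon> * real m)) = (\<Sum>b\<in>?P. exp (r * (\<epsilon> * real m)))" by simp
  also have "\<dots> \<le> (\<Sum>b\<in>?P. exp (r * (\<Sum>j<m. g (b j))))"
    using assms by (intro sum_mono) (auto simp: r_def)
  also have "\<dots> \<le> (\<Sum>b\<in>?G. exp (r * (\<Sum>j<m. g (b j))))"
    using fin by (intro sum_mono2) auto
  also have "\<dots> = (\<Sum>b\<in>?G. \<Prod>j<m. exp (r * g (b j)))"
    by (simp add: sum_distrib_left exp_sum)
  also have "\<dots> = (\<Prod>j<m. \<Sum>f\<in>F. exp (r * g f))"
    using assms(1) by (subst prod_sum_PiE) auto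
  also have "\<dots> = (\<Sum>f\<in>F. exp (r * g f)) ^ m" by simp
  also have "\<dots> \<le> (real (card F) * exp (r\<^sup>2)) ^ m"
    using assms by (intro power_mono sum_exp_le sum_nonneg) (auto simp: r_def)
  also have "\<dots> = real (card F) ^ m * exp (real m * r\<^sup>2)"
    by (simp add: power_mult_distrib exp_of_nat_mult)
  finally have "real (card ?P) \<le> real (card F) ^ m * (exp (real m * r\<^sup>2) / exp (r * (\<epsilon> * real m)))"
    by (simp add: pos_le_divide_eq)
  also have "exp (real m * r\<^sup>2) / exp (r * (\<epsilon> * real m)) = exp (- (\<epsilon>\<^sup>2 * real m / 4))"
    unfolding exp_diff[symmetric] by (simp add: r_def power2_eq_square field_simps)
  finally show ?thesis by (simp add: mult.commute)
qed

lemma card_abs_tail_le: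
  fixes g :: "'a \<Rightarrow> real"
  assumes "finite F" "\<And>f. f \<in> F \<Longrightarrow> \<bar>g f\<bar> \<le> 1" "(\<Sum>f\<in>F. g f) = 0" "0 < \<epsilon>" "\<epsilon> \<le> 1"
  shows "real (card {b \<in> {..<m} \<rightarrow>\<^sub>E F. \<bar>\<Sum>j<m. g (b j)\<bar> > \<epsilon> * real m})
    \<le> 2 * exp (- (\<epsilon>\<^sup>2 * real m / 4)) * real (card F) ^ m"
proof -
  let ?G = "{..<m} \<rightarrow>\<^sub>E F"
  let ?P = "{b \<in> ?G. (\<Sum>j<m. g (b j)) > \<epsilon> * real m}"
  let ?Q = "{b \<in> ?G. (\<Sum>j<m. - g (b j)) > \<epsilon> * real m}"
  have fin: "finite ?G" using assms(1) by (intro finite_PiE) auto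
  have "{b \<in> ?G. \<bar>\<Sum>j<m. g (b j)\<bar> > \<epsilon> * real m} \<subseteq> ?P \<union> ?Q"
  proof
    fix b assume "b \<in> {b \<in> ?G. \<bar>\<Sum>j<m. g (b j)\<bar> > \<epsilon> * real m}"
    then have b: "b \<in> ?G" "\<epsilon> * real m < \<bar>\<Sum>j<m. g (b j)\<bar>" by blast+
    then have "\<epsilon> * real m < (\<Sum>j<m. g (b j)) \<or> \<epsilon> * real m < - (\<Sum>j<m. g (b j))"
      by (metis abs_if)
    then show "b \<in> ?P \<union> ?Q" using b(1) unfolding sum_negf by blast
  qed
  then have "card {b \<in> ?G. \<bar>\<Sum>j<m. g (b j)\<bar> > \<epsilon> * real m} \<le> card (?P \<union> ?Q)"
    by (rule card_mono[rotated]) (simp add: fin)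
  also have "\<dots> \<le> card ?P + card ?Q" by (rule card_Un_le)
  finally have "card {b \<in> ?G. \<bar>\<Sum>j<m. g (b j)\<bar> > \<epsilon> * real m} \<le> card ?P + card ?Q" .
  then have "real (card {b \<in> ?G. \<bar>\<Sum>j<m. g (b j)\<bar> > \<epsilon> * real m}) \<le> real (card ?P) + real (card ?Q)"
    by linarith
  moreover have "real (card ?P) \<le> exp (- (\<epsilon>\<^sup>2 * real m / 4)) * real (card F) ^ m"
    by (rule card_tail_le) (use assms in auto)
  moreover have "real (card ?Q) \<le> exp (- (\<epsilon>\<^sup>2 * real m / 4)) * real (card F) ^ m"
    by (rule card_tail_le[where g = "\<lambda>x. - g x"]) (use assms in \<open>auto simp: sum_negf\<close>)
  ultimately show ?thesis by linarith
qed

text \<open>As a function of v this is the convolution of the indicators of -E, -F and S; it is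
  real-valued so that averaging and Fourier expansion apply directly.\<close>

definition cnt :: "int set \<Rightarrow> int set \<Rightarrow> int set \<Rightarrow> int \<Rightarrow> real" where
  "cnt E F S v = (\<Sum>e\<in>E. \<Sum>f\<in>F. if e + f + v \<in> S then 1 else 0)"

text \<open>Two approximations to the density of S - x on F are shifts, by s 0 and s 1, of one
  function \<psi>. They are evaluated at e + v + s 0 - s 1 and at e + v, where both read off the
  same value of \<psi>. Off the exceptional sets the error is 2 \<epsilon> for each e, and each
  exceptional set costs another \<epsilon> |E|.\<close>

lemma cnt_diff_le:
  fixes S :: "int set" and X :: "int set" and \<epsilon> K :: real
  assumes fin: "finite E" "finite F" "finite S" and ne: "F \<noteq> {}"
    and bad: "\<And>j. j \<in> {0,1} \<Longrightarrow> finite (B j) \<and> card (B j) \<le> \<epsilon> * card E"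
    and ok: "\<And>j x. j \<in> {0,1} \<Longrightarrow> x \<notin> B j \<Longrightarrow>
        \<bar>(\<Sum>f\<in>F. if x + f \<in> S then 1 else 0) / card F - \<psi> (x - s j)\<bar> \<le> \<epsilon>"
    and \<epsilon>: "\<epsilon> \<ge> 0"
  shows "\<bar>cnt E F S (v + s 0 - s 1) - cnt E F S v\<bar> \<le> 4 * \<epsilon> * card E * card F"
proof -
  define \<phi> :: "int \<Rightarrow> real" where "\<phi> x = (\<Sum>f\<in>F. if x + f \<in> S then 1 else 0) / card F" for x
  have cF: "card F > 0" using fin ne by (simp add: card_gt_0_iff)
  have cnt: "cnt E F S v = card F * (\<Sum>e\<in>E. \<phi> (e + v))" for v
  proof -
    have "cnt E F S v = (\<Sum>e\<in>E. card F * \<phi> (e + v))"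
      unfolding cnt_def using cF by (intro sum.cong refl) (simp add: \<phi>_def algebra_simps)
    then show ?thesis by (simp add: sum_distrib_left)
  qed
  have \<phi>01: "0 \<le> \<phi> x" "\<phi> x \<le> 1" for x
  proof -
    have "(\<Sum>f\<in>F. if x + f \<in> S then 1 else 0) \<le> (\<Sum>f\<in>F. 1::real)" by (intro sum_mono) auto
    then show "\<phi> x \<le> 1" using cF by (simp add: \<phi>_def)
    show "0 \<le> \<phi> x" by (auto simp: \<phi>_def intro!: divide_nonneg_nonneg sum_nonneg)
  qed
  let ?a = "\<lambda>e. e + (v + s 0 - s 1)" let ?b = "\<lambda>e. e + v"
  let ?E0 = "{e \<in> E. ?a e \<in> B 0}" let ?E1 = "{e \<in> E. ?b e \<in> B 1}"
  have cE0: "card ?E0 \<le> card (B 0)" using bad[of 0]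
    by (intro card_inj_on_le[where f = ?a]) (auto simp: inj_on_def)
  have cE1: "card ?E1 \<le> card (B 1)" using bad[of 1]
    by (intro card_inj_on_le[where f = ?b]) (auto simp: inj_on_def)
  have pt: "\<bar>\<phi> (?a e) - \<phi> (?b e)\<bar> \<le> 2 * \<epsilon> + indicator ?E0 e + indicator ?E1 e" if "e \<in> E" for e
  proof (cases "e \<in> ?E0 \<union> ?E1")
    case True
    have "\<bar>\<phi> (?a e) - \<phi> (?b e)\<bar> \<le> 1" using \<phi>01[of "?a e"] \<phi>01[of "?b e"] by linarith
    moreover have "(1::real) \<le> indicator ?E0 e + indicator ?E1 e" using True by (auto simp: indicator_def)
    ultimately show ?thesis using \<epsilon> by linarith
  next
    case False
    then have "\<bar>\<phi> (?a e) - \<psi> (?a e - s 0)\<bar> \<le> \<epsilon>" "\<bar>\<phi> (?b e) - \<psi> (?b e - s 1)\<bar> \<le> \<epsilon>"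
      using that ok[of 0 "?a e"] ok[of 1 "?b e"] by (auto simp: \<phi>_def)
    moreover have "?a e - s 0 = ?b e - s 1" by simp
    ultimately have "\<bar>\<phi> (?a e) - \<phi> (?b e)\<bar> \<le> 2 * \<epsilon>" by (smt (verit))
    then show ?thesis by (smt (verit) indicator_pos_le)
  qed
  have ic: "(\<Sum>e\<in>E. indicator {e \<in> E. P e} e :: real) = card {e \<in> E. P e}" for P
  proof -
    have "E \<inter> {e \<in> E. P e} = {e \<in> E. P e}" by blast
    moreover have "(\<Sum>e\<in>E. indicator {e \<in> E. P e} e :: real) = (\<Sum>e\<in>E. if e \<in> {e \<in> E. P e} then 1 else 0)"
      by (rule sum.cong) (auto simp: indicator_def)
    ultimately show ?thesis using fin(1) by (simp only: sum.If_cases Collect_mem_eq) simp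
  qed
  have "cnt E F S (v + s 0 - s 1) - cnt E F S v = card F * (\<Sum>e\<in>E. \<phi> (?a e) - \<phi> (?b e))"
    unfolding cnt by (simp add: sum_subtractf algebra_simps)
  then have "\<bar>cnt E F S (v + s 0 - s 1) - cnt E F S v\<bar> = card F * \<bar>\<Sum>e\<in>E. \<phi> (?a e) - \<phi> (?b e)\<bar>"
    by (simp add: abs_mult)
  also have "\<dots> \<le> card F * (\<Sum>e\<in>E. 2 * \<epsilon> + indicator ?E0 e + indicator ?E1 e)"
    using pt by (intro mult_left_mono order_trans[OF sum_abs] sum_mono) auto
  also have "(\<Sum>e\<in>E. 2 * \<epsilon> + indicator ?E0 e + indicator ?E1 e) = 2 * \<epsilon> * card E + card ?E0 + card ?E1"
    by (simp add: sum.distrib ic)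
  also have "\<dots> \<le> 2 * \<epsilon> * card E + \<epsilon> * card E + \<epsilon> * card E"
    using cE0 cE1 bad[of 0] bad[of 1] by (intro add_mono) (auto intro: order_trans[OF of_nat_mono])
  finally have "\<bar>cnt E F S (v + s 0 - s 1) - cnt E F S v\<bar>
      \<le> card F * (2 * \<epsilon> * card E + \<epsilon> * card E + \<epsilon> * card E)" by (simp add: mult_left_mono)
  then show ?thesis by (simp add: algebra_simps)
qed

text \<open>Instead of an \<open>L\<^sup>p\<close> norm, exponential moments control the number of points at which a random
  sample of \<open>F\<close> fails to approximate the density of \<open>S - x\<close> on \<open>F\<close>.\<close>
theorem croot_sisask:
  fixes E F S V :: "int set" and K \<epsilon> :: real and m :: nat
  assumes fin: "finite E" "finite F" "finite S" "finite V"
    and ne: "E \<noteq> {}" "F \<noteq> {}" "V \<noteq> {}"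
    and K: "K \<ge> 1" and \<epsilon>: "0 < \<epsilon>" "\<epsilon> \<le> 1"
    and FV: "card ((\<lambda>(x, y). x + y) ` (F \<times> V)) \<le> K * card F"
    and SF: "card ((\<lambda>(x, y). x - y) ` (S \<times> F)) \<le> K * card E"
    and m: "m \<ge> 4 / \<epsilon>\<^sup>2 * ln (4 * K / \<epsilon>)"
  shows "\<exists>T\<subseteq>V. card V \<le> 2 * K ^ m * card T \<and>
    (\<forall>v. \<forall>t\<in>T. \<forall>t'\<in>T. \<bar>cnt E F S (v + t - t') - cnt E F S v\<bar> \<le> 4 * \<epsilon> * card E * card F)"
proof -
  let ?X = "(\<lambda>(x, y). x - y) ` (S \<times> F)" and ?Y = "(\<lambda>(x, y). x + y) ` (F \<times> V)"
  let ?G = "{..<m} \<rightarrow>\<^sub>E F" and ?H = "{..<m} \<rightarrow>\<^sub>E ?Y"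
  have finX: "finite ?X" and finY: "finite ?Y" using fin by auto
  have finG: "finite ?G" and finH: "finite ?H" using fin finY by (auto intro!: finite_PiE)
  have cF: "card F > 0" and cE: "card E > 0" using fin ne by (auto simp: card_gt_0_iff)
  have "4 * K / \<epsilon> \<ge> 4" using K \<epsilon> by (simp add: pos_le_divide_eq)
  then have "ln (4 * K / \<epsilon>) > 0" by simp
  then have "0 < 4 / \<epsilon>\<^sup>2 * ln (4 * K / \<epsilon>)" using \<epsilon> by simp
  then have m0: "m > 0" using m by (metis less_le_trans of_nat_0_less_iff)
  define ind :: "int \<Rightarrow> real" where "ind x = (if x \<in> S then 1 else 0)" for x
  define \<phi> where "\<phi> x = (\<Sum>f\<in>F. ind (x + f)) / card F" for x
  define \<phi>s where "\<phi>s b x = (\<Sum>j<m. ind (x + b j)) / m" for b x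
  \<comment> \<open>Only points of S - F are tested: elsewhere no x + f lies in S, so density and
    sample density both vanish. This is how the bound on the size of S - F enters.\<close>
  define bad where "bad b = {x \<in> ?X. \<bar>\<phi>s b x - \<phi> x\<bar> > \<epsilon>}" for b :: "nat \<Rightarrow> int"
  have \<phi>01: "0 \<le> \<phi> x" "\<phi> x \<le> 1" for x
  proof -
    have "(\<Sum>f\<in>F. ind (x + f)) \<le> (\<Sum>f\<in>F. 1)" by (intro sum_mono) (auto simp: ind_def)
    then show "\<phi> x \<le> 1" using cF by (simp add: \<phi>_def)
    show "0 \<le> \<phi> x" by (auto simp: \<phi>_def ind_def intro!: divide_nonneg_nonneg sum_nonneg)
  qed
  \<comment> \<open>The lower bound on m makes a sample fail at a given x with probability at most
    \<epsilon>/(2 K). Over at most K |E| points of S - F this leaves \<epsilon> |E| / 2 bad points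
    on average.\<close>
  have tail: "card {b \<in> ?G. \<bar>\<phi>s b x - \<phi> x\<bar> > \<epsilon>} \<le> \<epsilon> / (2 * K) * card F ^ m" for x
  proof -
    have "\<bar>\<Sum>j<m. ind (x + b j) - \<phi> x\<bar> > \<epsilon> * m \<longleftrightarrow> \<bar>\<phi>s b x - \<phi> x\<bar> > \<epsilon>" for b
    proof -
      have "(\<Sum>j<m. ind (x + b j) - \<phi> x) = m * (\<phi>s b x - \<phi> x)"
        using m0 by (simp add: sum_subtractf \<phi>s_def algebra_simps)
      then have "\<bar>\<Sum>j<m. ind (x + b j) - \<phi> x\<bar> = m * \<bar>\<phi>s b x - \<phi> x\<bar>" by (simp add: abs_mult)
      then show ?thesis using m0 by (simp add: mult.commute)
    qed
    then have "{b \<in> ?G. \<bar>\<phi>s b x - \<phi> x\<bar> > \<epsilon>} = {b \<in> ?G. \<bar>\<Sum>j<m. ind (x + b j) - \<phi> x\<bar> > \<epsilon> * m}"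
      by auto
    also have "real (card \<dots>) \<le> 2 * exp (- (\<epsilon>\<^sup>2 * m / 4)) * card F ^ m"
    proof (unfold of_nat_power, rule card_abs_tail_le[OF fin(2) _ _ \<epsilon>])
      show "\<bar>ind (x + f) - \<phi> x\<bar> \<le> 1" if "f \<in> F" for f
        using \<phi>01[of x] by (auto simp: ind_def)
      show "(\<Sum>f\<in>F. ind (x + f) - \<phi> x) = 0"
        using cF by (simp add: sum_subtractf \<phi>_def)
    qed
    also have "\<dots> \<le> \<epsilon> / (2 * K) * card F ^ m"
    proof (intro mult_right_mono)
      have "ln (4 * K / \<epsilon>) \<le> \<epsilon>\<^sup>2 * m / 4" using m \<epsilon> by (simp add: field_simps)
      then have "exp (- (\<epsilon>\<^sup>2 * m / 4)) \<le> exp (- ln (4 * K / \<epsilon>))" by simp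
      also have "\<dots> = \<epsilon> / (4 * K)" using K \<epsilon> by (simp add: exp_minus)
      finally show "2 * exp (- (\<epsilon>\<^sup>2 * m / 4)) \<le> \<epsilon> / (2 * K)" by simp
    qed auto
    finally show ?thesis by simp
  qed
  have tot: "(\<Sum>b\<in>?G. real (card (bad b))) \<le> \<epsilon> / 2 * card E * card F ^ m"
  proof -
    have "(\<Sum>b\<in>?G. real (card (bad b))) = (\<Sum>b\<in>?G. \<Sum>x\<in>?X. if \<bar>\<phi>s b x - \<phi> x\<bar> > \<epsilon> then 1 else 0)"
      using finX by (intro sum.cong refl) (simp add: bad_def sum.If_cases Int_def)
    also have "\<dots> = (\<Sum>x\<in>?X. \<Sum>b\<in>?G. if \<bar>\<phi>s b x - \<phi> x\<bar> > \<epsilon> then 1 else 0)" by (rule sum.swap)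
    also have "\<dots> = (\<Sum>x\<in>?X. real (card {b \<in> ?G. \<bar>\<phi>s b x - \<phi> x\<bar> > \<epsilon>}))"
      using finG by (intro sum.cong refl) (simp add: sum.If_cases Int_def)
    also have "\<dots> \<le> (\<Sum>x\<in>?X. \<epsilon> / (2 * K) * card F ^ m)" using tail by (intro sum_mono) auto
    also have "\<dots> = card ?X * (\<epsilon> / (2 * K) * card F ^ m)" by simp
    also have "\<dots> \<le> K * card E * (\<epsilon> / (2 * K) * card F ^ m)"
      using SF \<epsilon> K by (intro mult_right_mono) auto
    also have "\<dots> = \<epsilon> / 2 * card E * card F ^ m" using K by simp
    finally show ?thesis .
  qed
  \<comment> \<open>Twice the average is allowed, so by Markov's inequality at least half of all
    samples are good.\<close>
  define Good where "Good = {b \<in> ?G. card (bad b) \<le> \<epsilon> * card E}"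
  have cG: "card ?G = card F ^ m" by (simp add: card_PiE)
  have finGood: "finite Good" using finG by (auto simp: Good_def)
  have good: "card F ^ m \<le> 2 * real (card Good)"
  proof -
    have "(card ?G - real (card Good)) * (\<epsilon> * card E) = (\<Sum>b\<in>?G - Good. \<epsilon> * card E)"
      using finG finGood by (subst sum_constant, subst card_Diff_subset)
        (auto simp: Good_def of_nat_diff card_mono)
    also have "\<dots> \<le> (\<Sum>b\<in>?G - Good. real (card (bad b)))"
    proof (rule sum_mono)
      fix b assume "b \<in> ?G - Good"
      then have "\<not> real (card (bad b)) \<le> \<epsilon> * card E" unfolding Good_def by blast
      then show "\<epsilon> * card E \<le> real (card (bad b))" by linarith
    qed
    also have "\<dots> \<le> (\<Sum>b\<in>?G. real (card (bad b)))" using finG by (intro sum_mono2) auto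
    also have "\<dots> \<le> (card F ^ m / 2) * (\<epsilon> * card E)" using tot by (simp add: algebra_simps)
    finally have "card ?G - real (card Good) \<le> card F ^ m / 2" using \<epsilon> cE by simp
    then show ?thesis unfolding cG by simp
  qed
  \<comment> \<open>Pigeonhole: adding t from V to all coordinates sends a good sample into (F +
    V)^m, which has at most (K |F|)^m elements. Hence some c arises from good samples by many
    different shifts t, and these form T.\<close>
  define TT where "TT c = {t \<in> V. (\<lambda>j\<in>{..<m}. c j - t) \<in> Good}" for c
  have "real (card V) * card Good = (\<Sum>t\<in>V. \<Sum>b\<in>Good. 1)" by simp
  also have "\<dots> \<le> (\<Sum>t\<in>V. \<Sum>c\<in>?H. if (\<lambda>j\<in>{..<m}. c j - t) \<in> Good then 1 else 0)"
  proof (intro sum_mono)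
    fix t assume t: "t \<in> V"
    let ?H' = "{c \<in> ?H. (\<lambda>j\<in>{..<m}. c j - t) \<in> Good}"
    have "card Good \<le> card ?H'"
    proof (rule card_inj_on_le[where f = "\<lambda>b. \<lambda>j\<in>{..<m}. b j + t"])
      show "inj_on (\<lambda>b. \<lambda>j\<in>{..<m}. b j + t) Good"
      proof (rule inj_onI)
        fix b b' assume b: "b \<in> Good" "b' \<in> Good"
          and e: "(\<lambda>j\<in>{..<m}. b j + t) = (\<lambda>j\<in>{..<m}. b' j + t)"
        have "b j = b' j" if "j < m" for j using fun_cong[OF e, of j] that by simp
        then show "b = b'" using b by (intro PiE_ext[of b "{..<m}" "\<lambda>_. F" b']) (auto simp: Good_def)
      qed
      show "(\<lambda>b. \<lambda>j\<in>{..<m}. b j + t) ` Good \<subseteq> ?H'"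
      proof
        fix c assume "c \<in> (\<lambda>b. \<lambda>j\<in>{..<m}. b j + t) ` Good"
        then obtain b where b: "b \<in> Good" "c = (\<lambda>j\<in>{..<m}. b j + t)" by auto
        have bG: "b \<in> ?G" using b by (simp add: Good_def)
        have "(\<lambda>j\<in>{..<m}. c j - t) = b"
        proof
          fix j
          show "(\<lambda>j\<in>{..<m}. c j - t) j = b j"
            using b(2) PiE_arb[OF bG, of j] by (cases "j < m") simp_all
        qed
        moreover have "c \<in> ?H" unfolding b(2) restrict_PiE_iff
        proof
          fix j assume "j \<in> {..<m}"
          then have "b j \<in> F" using PiE_mem[OF bG] by blast
          then show "b j + t \<in> ?Y" using t by (intro image_eqI[of _ _ "(b j, t)"]) simp_all
        qed
        ultimately show "c \<in> ?H'" using b(1) by simp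
      qed
    qed (use finH in auto)
    then show "(\<Sum>b\<in>Good. 1::real) \<le> (\<Sum>c\<in>?H. if (\<lambda>j\<in>{..<m}. c j - t) \<in> Good then 1 else 0)"
      using finH by (simp add: sum.If_cases Int_def)
  qed
  also have "\<dots> = (\<Sum>c\<in>?H. \<Sum>t\<in>V. if (\<lambda>j\<in>{..<m}. c j - t) \<in> Good then 1 else 0)" by (rule sum.swap)
  also have "\<dots> = (\<Sum>c\<in>?H. real (card (TT c)))"
    using fin by (intro sum.cong refl) (simp add: sum.If_cases Int_def TT_def)
  finally have dbl: "real (card V) * card Good \<le> (\<Sum>c\<in>?H. real (card (TT c)))" .
  have "\<exists>c\<in>?H. card V * card Good \<le> (K * card F) ^ m * card (TT c)"
  proof (rule ccontr)
    assume "\<not> ?thesis"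
    then have lt: "(K * card F) ^ m * card (TT c) < real (card V) * card Good" if "c \<in> ?H" for c
      using that by (auto simp: not_le)
    have KF: "0 < (K * card F) ^ m" using K cF by simp
    show False
    proof (cases "?H = {}")
      case True
      then show False using ne by (auto simp: PiE_eq_empty_iff)
    next
      case False
      have "(K * card F) ^ m * (\<Sum>c\<in>?H. real (card (TT c))) < (\<Sum>c\<in>?H. real (card V) * card Good)"
        unfolding sum_distrib_left using False finH lt by (intro sum_strict_mono) auto
      also have "\<dots> = real (card ?Y ^ m) * (real (card V) * card Good)" by (simp add: card_PiE)
      also have "\<dots> \<le> (K * card F) ^ m * (real (card V) * card Good)"
        using FV by (intro mult_right_mono) (auto intro!: power_mono)
      finally show False using dbl KF by simp
    qed
  qed
  then obtain c where c: "card V * card Good \<le> (K * card F) ^ m * card (TT c)" by auto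
  have Tsize: "card V \<le> 2 * K ^ m * card (TT c)"
  proof -
    have "real (card V) * card F ^ m \<le> real (card V) * (2 * card Good)" using good by (intro mult_left_mono) auto
    also have "\<dots> \<le> 2 * ((K * card F) ^ m * card (TT c))" using c by simp
    also have "\<dots> = (2 * K ^ m * card (TT c)) * card F ^ m" by (simp add: power_mult_distrib)
    finally show ?thesis using cF by simp
  qed
  have period: "\<bar>cnt E F S (v + t - t') - cnt E F S v\<bar> \<le> 4 * \<epsilon> * card E * card F"
    if t: "t \<in> TT c" "t' \<in> TT c" for v t t'
  proof -
    \<comment> \<open>The samples c - t and c - t' are both good, and their sample densities are
      shifts of the single function belonging to c.\<close>
    define s where "s j = (if j = (0::nat) then t else t')" for j
    have sT: "s j \<in> TT c" for j using t by (simp add: s_def)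
    define b where "b j = (\<lambda>i\<in>{..<m}. c i - s j)" for j
    have bG: "b j \<in> Good" for j using sT[of j] by (simp add: TT_def b_def)
    define \<psi> where "\<psi> y = (\<Sum>i<m. ind (y + c i)) / m" for y
    have \<psi>: "\<phi>s (b j) x = \<psi> (x - s j)" for j x
      by (simp add: \<phi>s_def \<psi>_def b_def algebra_simps)
    have "\<bar>cnt E F S (v + s 0 - s 1) - cnt E F S v\<bar> \<le> 4 * \<epsilon> * card E * card F"
    proof (rule cnt_diff_le[where B = "\<lambda>j. bad (b j)" and \<psi> = \<psi>])
      show "finite (bad (b j)) \<and> real (card (bad (b j))) \<le> \<epsilon> * card E" for j
        using bG[of j] finX by (auto simp: Good_def bad_def)
      show "\<bar>(\<Sum>f\<in>F. if x + f \<in> S then 1 else 0) / card F - \<psi> (x - s j)\<bar> \<le> \<epsilon>"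
        if x: "x \<notin> bad (b j)" for j x
      proof (cases "x \<in> ?X")
        case True
        then have "\<bar>\<phi>s (b j) x - \<phi> x\<bar> \<le> \<epsilon>" using x by (auto simp: bad_def)
        then show ?thesis unfolding \<psi> by (simp add: \<phi>_def ind_def abs_minus_commute)
      next
        case False
        have no: "x + f \<notin> S" if "f \<in> F" for f
        proof
          assume "x + f \<in> S"
          then have "(x + f) - f \<in> ?X" using that by (intro image_eqI[of _ _ "(x + f, f)"]) auto
          then show False using False by simp
        qed
        have "b j \<in> ?G" using bG by (simp add: Good_def)
        then have "x + b j i \<notin> S" if "i < m" for i using no[of "b j i"] that by (auto simp: PiE_mem)
        then have "\<phi>s (b j) x = 0" by (simp add: \<phi>s_def ind_def)
        then show ?thesis using no \<epsilon> unfolding \<psi> by simp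
      qed
    qed (use fin ne \<epsilon> in auto)
    then show ?thesis by (simp add: s_def)
  qed
  show ?thesis using Tsize period by (intro exI[of _ "TT c"]) (auto simp: TT_def)
qed

section \<open>A local form of Chang's theorem\<close>

text \<open>Fourier transform of the uniform measure on X, with value 0 for empty X because division
  by 0 yields 0.\<close>

definition avg :: "int set \<Rightarrow> real \<Rightarrow> complex" where
  "avg X \<theta> = (\<Sum>x\<in>X. ee \<theta> x) / of_nat (card X)"

lemma norm_avg_le: "cmod (avg X \<theta>) \<le> 1"
proof (cases "card X = 0")
  case False
  have "cmod (\<Sum>x\<in>X. ee \<theta> x) \<le> (\<Sum>x\<in>X. 1)" by (rule order_trans[OF norm_sum]) simp
  then show ?thesis using False by (simp add: avg_def norm_divide)
qed (simp add: avg_def)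

text \<open>A translation argument standing in for the inequality \<open>1\<^sub>V \<le> |V\<^sup>+| \<beta>\<close> pointwise, where
  \<open>\<beta>\<close> is the convolution of the uniform measure on \<open>V\<^sup>+\<close> with \<open>L\<close> copies of that on \<open>W\<close>.\<close>
lemma sum_le_smoothed:
  fixes \<Phi> :: "int \<Rightarrow> real"
  assumes fin: "finite V" "finite W" "finite V'" "W \<noteq> {}"
    and nn: "\<And>x. \<Phi> x \<ge> 0"
    and sub: "\<And>x y. x \<in> V \<Longrightarrow> y \<in> {..<L} \<rightarrow>\<^sub>E W \<Longrightarrow> x - (\<Sum>j<L. y j) \<in> V'"
  shows "real (card W) ^ L * (\<Sum>x\<in>V. \<Phi> x)
    \<le> (\<Sum>y\<in>{..<L::nat} \<rightarrow>\<^sub>E W. \<Sum>z\<in>V'. \<Phi> (z + (\<Sum>j<L. y j)))"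
proof -
  let ?Y = "{..<L} \<rightarrow>\<^sub>E W"
  have "(\<Sum>x\<in>V. \<Phi> x) \<le> (\<Sum>z\<in>V'. \<Phi> (z + (\<Sum>j<L. y j)))" if y: "y \<in> ?Y" for y
  proof -
    let ?s = "\<Sum>j<L. y j"
    have "(\<Sum>x\<in>V. \<Phi> x) = (\<Sum>z\<in>(\<lambda>x. x - ?s) ` V. \<Phi> (z + ?s))"
      by (subst sum.reindex) (auto simp: inj_on_def)
    also have "\<dots> \<le> (\<Sum>z\<in>V'. \<Phi> (z + ?s))"
      using fin nn sub[OF _ y] by (intro sum_mono2) auto
    finally show ?thesis .
  qed
  then have "(\<Sum>y\<in>?Y. \<Sum>x\<in>V. \<Phi> x) \<le> (\<Sum>y\<in>?Y. \<Sum>z\<in>V'. \<Phi> (z + (\<Sum>j<L. y j)))"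
    by (rule sum_mono)
  then show ?thesis by (simp add: card_PiE)
qed

text \<open>On the Fourier side the smoothing becomes an L-th power, so a frequency at which W has
  average at most 1/2 is damped by 2^(-L).\<close>

lemma sum_smoothed_ee:
  assumes "finite W"
  shows "(\<Sum>y\<in>{..<L::nat} \<rightarrow>\<^sub>E W. \<Sum>z\<in>V'. ee \<xi> (z + (\<Sum>j<L. y j)))
    = (\<Sum>z\<in>V'. ee \<xi> z) * (\<Sum>w\<in>W. ee \<xi> w) ^ L"
proof -
  have "(\<Sum>y\<in>{..<L} \<rightarrow>\<^sub>E W. \<Sum>z\<in>V'. ee \<xi> (z + (\<Sum>j<L. y j)))
    = (\<Sum>y\<in>{..<L} \<rightarrow>\<^sub>E W. (\<Sum>z\<in>V'. ee \<xi> z) * (\<Prod>j<L. ee \<xi> (y j)))"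
    by (simp add: ee_add ee_sum sum_distrib_right)
  also have "\<dots> = (\<Sum>z\<in>V'. ee \<xi> z) * (\<Prod>j<L. \<Sum>w\<in>W. ee \<xi> w)"
    using assms by (subst prod_sum_PiE) (auto simp: sum_distrib_left)
  finally show ?thesis by simp
qed

section \<open>Dissociated sets of frequencies and Riesz products\<close>

definition signs :: "real set \<Rightarrow> (real \<Rightarrow> int) set" where
  "signs \<Lambda> = \<Lambda> \<rightarrow>\<^sub>E {-1, 0, 1}"

text \<open>Local form of dissociativity: instead of being nonzero, a nontrivial combination with
  coefficients -1, 0, 1 must avoid the large spectrum of W. Frequencies that W barely distinguishes
  from 0 thus count as 0.\<close>

definition dissociated :: "int set \<Rightarrow> real set \<Rightarrow> bool" where
  "dissociated W \<Lambda> \<longleftrightarrow>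
    (\<forall>g\<in>signs \<Lambda>. (\<exists>q\<in>\<Lambda>. g q \<noteq> 0) \<longrightarrow> cmod (avg W (\<Sum>q\<in>\<Lambda>. of_int (g q) * q)) \<le> 1 / 2)"

lemma finite_signs: "finite \<Lambda> \<Longrightarrow> finite (signs \<Lambda>)"
  unfolding signs_def by (intro finite_PiE) auto

text \<open>A combination over the smaller set extends by zero coefficients to the larger
  one.\<close>

lemma dissociated_subset:
  assumes "dissociated W \<Lambda>" "\<Lambda>' \<subseteq> \<Lambda>" "finite \<Lambda>"
  shows "dissociated W \<Lambda>'"
  unfolding dissociated_def
proof (intro ballI impI)
  fix g assume g: "g \<in> signs \<Lambda>'" "\<exists>q\<in>\<Lambda>'. g q \<noteq> 0"
  define h where "h = (\<lambda>x\<in>\<Lambda>. if x \<in> \<Lambda>' then g x else 0)"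
  have "h \<in> signs \<Lambda>" using g(1) by (auto simp: h_def signs_def PiE_def Pi_def)
  moreover have "\<exists>q\<in>\<Lambda>. h q \<noteq> 0" using g(2) assms(2) by (auto simp: h_def)
  moreover have "(\<Sum>q\<in>\<Lambda>. of_int (h q) * q) = (\<Sum>q\<in>\<Lambda>'. of_int (g q) * q)"
    using assms(2,3) by (intro sum.mono_neutral_cong_right) (auto simp: h_def)
  ultimately show "cmod (avg W (\<Sum>q\<in>\<Lambda>'. of_int (g q) * q)) \<le> 1 / 2"
    using assms(1) unfolding dissociated_def by metis
qed

text \<open>As \<open>exp (s y) \<le> 1 + s\<^sup>2 + s y\<close> for small \<open>s y\<close>, the product on the left dominates the
  exponential moment of \<open>\<Sum>q\<in>\<Lambda>. Re (\<omega> q * ee q x)\<close>, as in the proof of Rudin's inequality.\<close>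
lemma riesz_product_bound:
  fixes \<Lambda> :: "real set" and \<omega> :: "real \<Rightarrow> complex"
  assumes fin: "finite V" "finite W" "finite V'" "W \<noteq> {}" "finite \<Lambda>"
    and sub: "\<And>x y. x \<in> V \<Longrightarrow> y \<in> {..<L} \<rightarrow>\<^sub>E W \<Longrightarrow> x - (\<Sum>j<L::nat. y j) \<in> V'"
    and dis: "dissociated W \<Lambda>"
    and L: "3 ^ card \<Lambda> \<le> (2::real) ^ L"
    and \<omega>: "\<And>q. cmod (\<omega> q) = 1"
    and s: "0 \<le> s" "s \<le> 1"
  shows "(\<Sum>x\<in>V. \<Prod>q\<in>\<Lambda>. 1 + s\<^sup>2 + s * Re (\<omega> q * ee q x)) \<le> 2 * (1 + s\<^sup>2) ^ card \<Lambda> * card V'"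
proof -
  define \<Phi> where "\<Phi> x = (\<Prod>q\<in>\<Lambda>. 1 + s\<^sup>2 + s * Re (\<omega> q * ee q x))" for x
  \<comment> \<open>Fourier coefficients of a single factor, from Re z = (z + cnj z) / 2; the index
    \<epsilon> belongs to the frequency \<epsilon> q.\<close>
  define c :: "real \<Rightarrow> int \<Rightarrow> complex"
    where "c q \<epsilon> = (if \<epsilon> = 0 then 1 + s\<^sup>2 else if \<epsilon> = 1 then s / 2 * \<omega> q else s / 2 * cnj (\<omega> q))" for q \<epsilon>
  define \<xi> where "\<xi> g = (\<Sum>q\<in>\<Lambda>. of_int (g q) * q)" for g :: "real \<Rightarrow> int"
  let ?Y = "{..<L} \<rightarrow>\<^sub>E W" and ?G = "signs \<Lambda>"
  let ?C = "\<lambda>g. \<Prod>q\<in>\<Lambda>. c q (g q)"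
  have finG: "finite ?G" using fin by (simp add: finite_signs)
  have cW: "card W > 0" using fin by (simp add: card_gt_0_iff)
  have nn: "\<Phi> x \<ge> 0" for x
  proof -
    have "0 \<le> 1 + s\<^sup>2 + s * Re (\<omega> q * ee q x)" for q
    proof -
      have "\<bar>Re (\<omega> q * ee q x)\<bar> \<le> 1"
        using abs_Re_le_cmod[of "\<omega> q * ee q x"] \<omega>[of q] by (simp add: norm_mult)
      then have "s * \<bar>Re (\<omega> q * ee q x)\<bar> \<le> 1 * 1" using s by (intro mult_mono) auto
      then have "\<bar>s * Re (\<omega> q * ee q x)\<bar> \<le> 1" using s by (simp add: abs_mult)
      moreover have "s\<^sup>2 \<ge> 0" by simp
      ultimately show ?thesis by linarith
    qed
    then show ?thesis unfolding \<Phi>_def by (intro prod_nonneg) auto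
  qed
  have expand: "of_real (\<Phi> x) = (\<Sum>g\<in>?G. ?C g * ee (\<xi> g) x)" for x
  proof -
    have fac: "of_real (1 + s\<^sup>2 + s * Re (\<omega> q * ee q x))
        = (\<Sum>\<epsilon>\<in>{-1, 0, 1}. c q \<epsilon> * ee (of_int \<epsilon> * q) x)" for q
    proof -
      have "of_real (Re (\<omega> q * ee q x)) = (\<omega> q * ee q x + cnj (\<omega> q * ee q x)) / 2"
        by (simp add: complex_eq_iff)
      note r = this
      show ?thesis unfolding of_real_add of_real_mult of_real_power r
        by (simp add: c_def ee_minus_freq cnj_ee field_simps)
    qed
    have "of_real (\<Phi> x) = (\<Prod>q\<in>\<Lambda>. \<Sum>\<epsilon>\<in>{-1, 0, 1}. c q \<epsilon> * ee (of_int \<epsilon> * q) x)"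
      unfolding \<Phi>_def of_real_prod fac ..
    also have "\<dots> = (\<Sum>g\<in>?G. \<Prod>q\<in>\<Lambda>. c q (g q) * ee (of_int (g q) * q) x)"
      unfolding signs_def using fin by (subst prod_sum_PiE) auto
    also have "\<dots> = (\<Sum>g\<in>?G. ?C g * ee (\<xi> g) x)"
      unfolding \<xi>_def ee_sum_freq prod.distrib ..
    finally show ?thesis .
  qed
  have "real (card W) ^ L * (\<Sum>x\<in>V. \<Phi> x) \<le> (\<Sum>y\<in>?Y. \<Sum>z\<in>V'. \<Phi> (z + (\<Sum>j<L. y j)))"
    by (rule sum_le_smoothed) (use fin nn sub in auto)
  also have "\<dots> = cmod (of_real (\<Sum>y\<in>?Y. \<Sum>z\<in>V'. \<Phi> (z + (\<Sum>j<L. y j))))"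
    using nn by (simp only: norm_of_real) (simp add: sum_nonneg)
  also have "of_real (\<Sum>y\<in>?Y. \<Sum>z\<in>V'. \<Phi> (z + (\<Sum>j<L. y j)))
      = (\<Sum>y\<in>?Y. \<Sum>z\<in>V'. \<Sum>g\<in>?G. ?C g * ee (\<xi> g) (z + (\<Sum>j<L. y j)))"
    by (simp only: of_real_sum expand)
  also have "\<dots> = (\<Sum>g\<in>?G. ?C g * (\<Sum>y\<in>?Y. \<Sum>z\<in>V'. ee (\<xi> g) (z + (\<Sum>j<L. y j))))"
  proof -
    have "(\<Sum>y\<in>?Y. \<Sum>z\<in>V'. \<Sum>g\<in>?G. ?C g * ee (\<xi> g) (z + (\<Sum>j<L. y j)))
        = (\<Sum>y\<in>?Y. \<Sum>g\<in>?G. \<Sum>z\<in>V'. ?C g * ee (\<xi> g) (z + (\<Sum>j<L. y j)))"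
      by (intro sum.cong refl) (rule sum.swap)
    also have "\<dots> = (\<Sum>g\<in>?G. \<Sum>y\<in>?Y. \<Sum>z\<in>V'. ?C g * ee (\<xi> g) (z + (\<Sum>j<L. y j)))"
      by (rule sum.swap)
    finally show ?thesis unfolding sum_distrib_left .
  qed
  also have "\<dots> = (\<Sum>g\<in>?G. ?C g * ((\<Sum>z\<in>V'. ee (\<xi> g) z) * (\<Sum>w\<in>W. ee (\<xi> g) w) ^ L))"
    using fin by (simp add: sum_smoothed_ee)
  also have "cmod \<dots> \<le> (\<Sum>g\<in>?G. cmod (?C g) * (card V' * (card W * cmod (avg W (\<xi> g))) ^ L))"
  proof (intro order_trans[OF norm_sum] sum_mono)
    fix g
    have "cmod (\<Sum>z\<in>V'. ee (\<xi> g) z) \<le> card V'" by (rule order_trans[OF norm_sum]) simp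
    moreover have "cmod (\<Sum>w\<in>W. ee (\<xi> g) w) = card W * cmod (avg W (\<xi> g))"
      using cW by (simp add: avg_def norm_divide)
    ultimately show "cmod (?C g * ((\<Sum>z\<in>V'. ee (\<xi> g) z) * (\<Sum>w\<in>W. ee (\<xi> g) w) ^ L))
        \<le> cmod (?C g) * (card V' * (card W * cmod (avg W (\<xi> g))) ^ L)"
      by (simp add: norm_mult norm_power mult_left_mono mult_right_mono)
  qed
  also have "\<dots> = card V' * real (card W) ^ L * (\<Sum>g\<in>?G. cmod (?C g) * cmod (avg W (\<xi> g)) ^ L)"
    by (simp add: power_mult_distrib sum_distrib_left algebra_simps)
  finally have main: "(\<Sum>x\<in>V. \<Phi> x) \<le> card V' * (\<Sum>g\<in>?G. cmod (?C g) * cmod (avg W (\<xi> g)) ^ L)"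
    using cW by (simp add: mult.assoc mult.left_commute[of _ "real (card W) ^ L"])
  \<comment> \<open>The zero combination is the main term, at most (1 + s^2)^|\<Lambda>|. All
    combinations together have coefficient sum at most 3^|\<Lambda>|, as 1 + s^2 + s/2 + s/2 \<le>
    3, and dissociativity damps each nonzero one by 2^(-L), which leaves at most 1.\<close>
  define g0 where "g0 = (\<lambda>x\<in>\<Lambda>. 0::int)"
  have g0: "g0 \<in> ?G" by (auto simp: g0_def signs_def)
  have cb: "cmod (c q \<epsilon>) \<le> (if \<epsilon> = 0 then 1 + s\<^sup>2 else s / 2)" for q \<epsilon>
  proof -
    have "cmod (1 + (of_real s)\<^sup>2) = 1 + s\<^sup>2"
      using norm_of_real[of "1 + s\<^sup>2", where 'a = complex] by (simp del: norm_of_real)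
    then show ?thesis using s \<omega> by (simp add: c_def norm_mult)
  qed
  have "(\<Sum>g\<in>?G. cmod (?C g) * cmod (avg W (\<xi> g)) ^ L)
      = cmod (?C g0) * cmod (avg W (\<xi> g0)) ^ L + (\<Sum>g\<in>?G - {g0}. cmod (?C g) * cmod (avg W (\<xi> g)) ^ L)"
    using finG g0 by (rule sum.remove)
  also have "\<dots> \<le> (1 + s\<^sup>2) ^ card \<Lambda> + (1 + s\<^sup>2) ^ card \<Lambda>"
  proof (rule add_mono)
    have "cmod (?C g0) \<le> (\<Prod>q\<in>\<Lambda>. 1 + s\<^sup>2)"
      unfolding prod_norm[symmetric] using cb[of _ 0] by (intro prod_mono) (auto simp: g0_def)
    moreover have "cmod (avg W (\<xi> g0)) ^ L \<le> 1" using norm_avg_le by (intro power_le_one) auto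
    ultimately have "cmod (?C g0) * cmod (avg W (\<xi> g0)) ^ L \<le> (1 + s\<^sup>2) ^ card \<Lambda> * 1"
      by (intro mult_mono) auto
    then show "cmod (?C g0) * cmod (avg W (\<xi> g0)) ^ L \<le> (1 + s\<^sup>2) ^ card \<Lambda>" by simp
  next
    have "cmod (?C g) * cmod (avg W (\<xi> g)) ^ L \<le> cmod (?C g) * (1 / 2) ^ L" if g: "g \<in> ?G - {g0}" for g
    proof -
      have "\<exists>q\<in>\<Lambda>. g q \<noteq> 0"
      proof (rule ccontr)
        assume "\<not> ?thesis"
        then have "g = g0" using g by (intro PiE_ext[of g \<Lambda> "\<lambda>_. {-1,0,1}" g0]) (auto simp: g0_def signs_def)
        then show False using g by simp
      qed
      then have "cmod (avg W (\<xi> g)) \<le> 1 / 2" using dis g unfolding dissociated_def \<xi>_def by auto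
      then show ?thesis by (intro mult_left_mono power_mono) auto
    qed
    then have "(\<Sum>g\<in>?G - {g0}. cmod (?C g) * cmod (avg W (\<xi> g)) ^ L)
        \<le> (\<Sum>g\<in>?G - {g0}. cmod (?C g) * (1 / 2) ^ L)" by (rule sum_mono)
    also have "\<dots> \<le> (\<Sum>g\<in>?G. cmod (?C g) * (1 / 2) ^ L)" using finG by (intro sum_mono2) auto
    also have "\<dots> = (\<Sum>g\<in>?G. \<Prod>q\<in>\<Lambda>. cmod (c q (g q))) * (1 / 2) ^ L"
      by (simp add: sum_distrib_right prod_norm)
    also have "(\<Sum>g\<in>?G. \<Prod>q\<in>\<Lambda>. cmod (c q (g q))) = (\<Prod>q\<in>\<Lambda>. \<Sum>\<epsilon>\<in>{-1, 0, 1}. cmod (c q \<epsilon>))"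
      unfolding signs_def using fin by (subst prod_sum_PiE) auto
    also have "\<dots> \<le> (\<Prod>q\<in>\<Lambda>. 3)"
    proof (intro prod_mono conjI sum_nonneg)
      fix q
      have "s\<^sup>2 \<le> 1" using s by (simp add: power_le_one)
      then show "(\<Sum>\<epsilon>\<in>{-1, 0, 1}. cmod (c q \<epsilon>)) \<le> 3"
        using cb[of q 0] cb[of q 1] cb[of q "-1"] s by simp
    qed auto
    also have "\<dots> * (1 / 2) ^ L \<le> 1" using L by (simp add: power_divide)
    also have "1 \<le> (1 + s\<^sup>2) ^ card \<Lambda>" by (simp add: one_le_power)
    finally show "(\<Sum>g\<in>?G - {g0}. cmod (?C g) * cmod (avg W (\<xi> g)) ^ L) \<le> (1 + s\<^sup>2) ^ card \<Lambda>"
      by (simp add: mult_right_mono)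
  qed
  finally have "(\<Sum>g\<in>?G. cmod (?C g) * cmod (avg W (\<xi> g)) ^ L) \<le> 2 * (1 + s\<^sup>2) ^ card \<Lambda>" by simp
  then have "card V' * (\<Sum>g\<in>?G. cmod (?C g) * cmod (avg W (\<xi> g)) ^ L) \<le> card V' * (2 * (1 + s\<^sup>2) ^ card \<Lambda>)"
    by (intro mult_left_mono) auto
  then show ?thesis using main unfolding \<Phi>_def by (simp add: algebra_simps)
qed

text \<open>The phases \<omega> turn the averages over T into their moduli, so X has mean at least
  m/2 on T, and the sum of exp (X/4) over T is at least exp (m/8) |T|. Riesz products with s = 1/4
  bound it by 4 \<tau> exp (m/16) |T|, because (1 + 1/16)^m \<le> exp (m/16). Comparing gives m/16
  \<le> ln (4 \<tau>).\<close>

theorem dissociated_card_le: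
  fixes \<Lambda> :: "real set" and \<tau> :: real
  assumes fin: "finite V" "finite W" "finite V'" "W \<noteq> {}" "finite \<Lambda>"
    and sub: "\<And>x y. x \<in> V \<Longrightarrow> y \<in> {..<L} \<rightarrow>\<^sub>E W \<Longrightarrow> x - (\<Sum>j<L::nat. y j) \<in> V'"
    and dis: "dissociated W \<Lambda>"
    and L: "3 ^ card \<Lambda> \<le> (2::real) ^ L"
    and T: "T \<subseteq> V" "T \<noteq> {}" "card V \<le> \<tau> * card T"
    and V': "card V' \<le> 2 * card V"
    and spec: "\<And>q. q \<in> \<Lambda> \<Longrightarrow> cmod (avg T q) > 1 / 2"
  shows "card \<Lambda> \<le> 16 * ln (4 * \<tau>)"
proof -
  define m where "m = card \<Lambda>"
  define \<omega> where "\<omega> q = (if avg T q = 0 then 1 else cnj (avg T q) / cmod (avg T q))" for q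
  define X where "X x = (\<Sum>q\<in>\<Lambda>. Re (\<omega> q * ee q x))" for x
  have \<omega>1: "cmod (\<omega> q) = 1" for q by (simp add: \<omega>_def norm_divide)
  have finT: "finite T" using T fin finite_subset by blast
  have cT: "card T > 0" using finT T by (simp add: card_gt_0_iff)
  have cV: "card V > 0" using T fin by (auto simp: card_gt_0_iff)
  have \<tau>: "\<tau> > 0" using T(3) cT cV by (metis less_le_trans of_nat_0_less_iff zero_less_mult_pos2)
  have \<omega>avg: "Re (\<omega> q * avg T q) = cmod (avg T q)" for q
  proof (cases "avg T q = 0")
    case False
    have "\<omega> q * avg T q = of_real ((cmod (avg T q))\<^sup>2) / cmod (avg T q)"
      using False by (simp add: \<omega>_def complex_norm_square mult.commute del: of_real_power)
    then show ?thesis using False by (simp add: power2_eq_square)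
  qed simp
  have "(\<Sum>x\<in>T. X x) = (\<Sum>q\<in>\<Lambda>. \<Sum>x\<in>T. Re (\<omega> q * ee q x))"
    unfolding X_def by (rule sum.swap)
  also have "\<dots> = (\<Sum>q\<in>\<Lambda>. card T * Re (\<omega> q * avg T q))"
  proof (rule sum.cong[OF refl])
    fix q
    have "(\<Sum>x\<in>T. Re (\<omega> q * ee q x)) = Re (\<omega> q * (\<Sum>x\<in>T. ee q x))"
      unfolding sum_distrib_left Re_sum ..
    also have "(\<Sum>x\<in>T. ee q x) = of_real (card T) * avg T q" using cT by (simp add: avg_def)
    finally show "(\<Sum>x\<in>T. Re (\<omega> q * ee q x)) = card T * Re (\<omega> q * avg T q)"
      by (simp add: algebra_simps)
  qed
  also have "\<dots> \<ge> (\<Sum>q\<in>\<Lambda>. card T * (1 / 2))"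
    using spec less_imp_le unfolding \<omega>avg by (intro sum_mono mult_left_mono) auto
  finally have X: "(\<Sum>x\<in>T. X x) \<ge> m / 2 * card T" by (simp add: m_def)
  have "exp (m / 8) * card T \<le> (\<Sum>x\<in>T. exp (1 / 4 * X x))"
  proof -
    \<comment> \<open>Jensen's inequality through the tangent of exp at m/8.\<close>
    have "exp (1 / 4 * X x) \<ge> exp (m / 8) * (1 + (1 / 4 * X x - m / 8))" for x
    proof -
      have "exp (m / 8) * (1 + (1 / 4 * X x - m / 8)) \<le> exp (m / 8) * exp (1 / 4 * X x - m / 8)"
        by (intro mult_left_mono exp_ge_add_one_self) auto
      then show ?thesis by (simp add: exp_add[symmetric])
    qed
    then have "(\<Sum>x\<in>T. exp (1 / 4 * X x)) \<ge> (\<Sum>x\<in>T. exp (m / 8) * (1 + (1 / 4 * X x - m / 8)))"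
      by (rule sum_mono)
    moreover have "(\<Sum>x\<in>T. exp (m / 8) * (1 + (1 / 4 * X x - m / 8)))
        = exp (m / 8) * (card T + ((\<Sum>x\<in>T. X x) / 4 - m / 8 * card T))"
      by (simp add: sum_distrib_left[symmetric] sum.distrib sum_subtractf sum_divide_distrib)
    moreover have "exp (m / 8) * card T \<le> exp (m / 8) * (card T + ((\<Sum>x\<in>T. X x) / 4 - m / 8 * card T))"
      using X by (intro mult_left_mono) auto
    ultimately show ?thesis by linarith
  qed
  also have "\<dots> \<le> (\<Sum>x\<in>T. \<Prod>q\<in>\<Lambda>. 1 + (1 / 4)\<^sup>2 + 1 / 4 * Re (\<omega> q * ee q x))"
  proof (rule sum_mono)
    fix x
    have "exp (1 / 4 * X x) = (\<Prod>q\<in>\<Lambda>. exp (1 / 4 * Re (\<omega> q * ee q x)))"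
      using fin by (simp add: X_def sum_divide_distrib exp_sum)
    also have "\<dots> \<le> (\<Prod>q\<in>\<Lambda>. 1 + (1 / 4)\<^sup>2 + 1 / 4 * Re (\<omega> q * ee q x))"
    proof (intro prod_mono conjI exp_ge_zero)
      fix q
      have b: "\<bar>Re (\<omega> q * ee q x)\<bar> \<le> 1"
        using abs_Re_le_cmod[of "\<omega> q * ee q x"] \<omega>1[of q] by (simp add: norm_mult)
      then have "exp (1 / 4 * Re (\<omega> q * ee q x))
          \<le> 1 + 1 / 4 * Re (\<omega> q * ee q x) + (1 / 4 * Re (\<omega> q * ee q x))\<^sup>2"
        by (intro exp_le_quadratic) auto
      moreover have "(1 / 4 * Re (\<omega> q * ee q x))\<^sup>2 \<le> (1 / 4)\<^sup>2"
        using b by (intro abs_le_square_iff[THEN iffD1]) auto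
      ultimately show "exp (1 / 4 * Re (\<omega> q * ee q x)) \<le> 1 + (1 / 4)\<^sup>2 + 1 / 4 * Re (\<omega> q * ee q x)"
        by linarith
    qed
    finally show "exp (1 / 4 * X x) \<le> (\<Prod>q\<in>\<Lambda>. 1 + (1 / 4)\<^sup>2 + 1 / 4 * Re (\<omega> q * ee q x))" .
  qed
  also have "\<dots> \<le> (\<Sum>x\<in>V. \<Prod>q\<in>\<Lambda>. 1 + (1 / 4)\<^sup>2 + 1 / 4 * Re (\<omega> q * ee q x))"
  proof (rule sum_mono2[OF fin(1) T(1)], rule prod_nonneg)
    fix x q
    have "\<bar>Re (\<omega> q * ee q x)\<bar> \<le> 1"
      using abs_Re_le_cmod[of "\<omega> q * ee q x"] \<omega>1[of q] by (simp add: norm_mult)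
    moreover have "0 \<le> 1 + (1 / 4)\<^sup>2 + 1 / 4 * y" if "\<bar>y\<bar> \<le> 1" for y :: real
      using that by (simp add: power2_eq_square)
    ultimately show "0 \<le> 1 + (1 / 4)\<^sup>2 + 1 / 4 * Re (\<omega> q * ee q x)" by blast
  qed
  also have "\<dots> \<le> 2 * (1 + (1 / 4)\<^sup>2) ^ card \<Lambda> * card V'"
    by (rule riesz_product_bound) (use fin sub dis L \<omega>1 in auto)
  also have "\<dots> \<le> 2 * exp (m / 16) * (2 * (\<tau> * card T))"
  proof (rule mult_mono)
    have "(1 + (1 / 4 :: real)\<^sup>2) ^ card \<Lambda> \<le> exp ((1 / 4)\<^sup>2) ^ card \<Lambda>"
      by (intro power_mono exp_ge_add_one_self) (simp add: power2_eq_square)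
    also have "\<dots> = exp (m / 16)" by (simp add: exp_of_nat_mult[symmetric] m_def power2_eq_square)
    finally show "2 * (1 + (1 / 4)\<^sup>2) ^ card \<Lambda> \<le> 2 * exp (m / 16)" by simp
    show "real (card V') \<le> 2 * (\<tau> * card T)" using V' T(3) by linarith
  qed auto
  finally have "exp (m / 8) * card T \<le> (4 * \<tau> * exp (m / 16)) * card T" by (simp add: algebra_simps)
  then have "exp (m / 8) \<le> 4 * \<tau> * exp (m / 16)" using cT by (simp only: mult_le_cancel_right)
  then have "exp (m / 8) / exp (m / 16) \<le> 4 * \<tau>" by (simp add: pos_divide_le_eq)
  then have "exp (m / 16) \<le> 4 * \<tau>" by (simp add: exp_diff[symmetric])
  then have "m / 16 \<le> ln (4 * \<tau>)" using \<tau> by (subst ln_ge_iff) auto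
  then show ?thesis by (simp add: m_def)
qed

section \<open>Smoothing\<close>

lemma sum_ee_orthogonal:
  assumes "M \<ge> 1"
  shows "(\<Sum>r<M. ee (real r / real M) n) = (if int M dvd n then of_nat M else 0)"
proof -
  define z where "z = ee (1 / real M) n"
  have pw: "ee (real r / real M) n = z ^ r" for r
  proof -
    have "z ^ r = cis (real r * (2 * pi * (1 / real M) * of_int n))"
      unfolding z_def ee_def by (rule Complex.DeMoivre)
    also have "real r * (2 * pi * (1 / real M) * of_int n) = 2 * pi * (real r / real M) * of_int n" by simp
    finally show ?thesis by (simp only: ee_def)
  qed
  have zM: "z ^ M = 1"
  proof -
    have "ee (real M / real M) n = 1" using assms by (simp add: ee_def cis_multiple_2pi)
    then show ?thesis using pw by metis
  qed
  show ?thesis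
  proof (cases "int M dvd n")
    case True
    then obtain q where "n = int M * q" by (elim dvdE)
    then have "z = 1" using assms cis_multiple_2pi[of "real_of_int q"]
      by (simp add: z_def ee_def mult.assoc)
    then show ?thesis using True by (simp add: pw)
  next
    case False
    have "z \<noteq> 1"
    proof
      assume "z = 1"
      then have "exp (\<i> * of_real (2 * pi * (1 / real M) * of_int n)) = 1"
        by (simp add: z_def ee_def cis_conv_exp)
      then obtain q :: int where "2 * pi * (1 / real M) * of_int n = of_int (2 * q) * pi"
        unfolding exp_eq_1 by auto
      then have "real_of_int n = real_of_int (q * int M)" using assms by (simp add: field_simps)
      then have "n = q * int M" by (simp only: of_int_eq_iff)
      then show False using False by simp
    qed
    then show ?thesis using False zM by (simp add: pw geometric_sum)
  qed
qed

lemma parseval_mod: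
  assumes "M \<ge> 1" "finite X" "\<And>x y. x \<in> X \<Longrightarrow> y \<in> X \<Longrightarrow> int M dvd x - y \<Longrightarrow> x = y"
  shows "(\<Sum>r<M. (cmod (\<Sum>x\<in>X. ee (real r / real M) x))\<^sup>2) = real M * card X"
proof -
  have "complex_of_real (\<Sum>r<M. (cmod (\<Sum>x\<in>X. ee (real r / real M) x))\<^sup>2)
      = (\<Sum>r<M. (\<Sum>x\<in>X. ee (real r / real M) x) * cnj (\<Sum>y\<in>X. ee (real r / real M) y))"
    unfolding of_real_sum complex_norm_square ..
  also have "\<dots> = (\<Sum>r<M. \<Sum>x\<in>X. \<Sum>y\<in>X. ee (real r / real M) (x - y))"
    by (simp add: sum_product cnj_ee ee_add[symmetric])
  also have "\<dots> = (\<Sum>x\<in>X. \<Sum>y\<in>X. \<Sum>r<M. ee (real r / real M) (x - y))"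
    by (subst sum.swap, subst (2) sum.swap) (rule refl)
  also have "\<dots> = (\<Sum>x\<in>X. \<Sum>y\<in>X. if y = x then of_nat M else 0)"
    using assms by (intro sum.cong refl) (auto simp: sum_ee_orthogonal)
  also have "\<dots> = of_nat M * of_nat (card X)" using assms(2) by simp
  finally have "complex_of_real (\<Sum>r<M. (cmod (\<Sum>x\<in>X. ee (real r / real M) x))\<^sup>2)
      = complex_of_real (real M * card X)" by simp
  then show ?thesis by (simp only: of_real_eq_iff)
qed

text \<open>Averaging over T - T serves two ends: its elements t - t' are the almost periods that
  sampling supplies, and its Fourier multiplier is |avg T|^2, so l rounds damp a frequency outside
  the large spectrum by 4^(-l).\<close>

definition smooth :: "int set \<Rightarrow> (int \<Rightarrow> real) \<Rightarrow> int \<Rightarrow> real" where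
  "smooth T h v = (\<Sum>t\<in>T. \<Sum>t'\<in>T. h (v + t - t')) / (real (card T))\<^sup>2"

text \<open>Two functions at two points, so that both a shift of one function and the comparison of
  a function with a constant are covered.\<close>

lemma smooth_diff_le:
  assumes "finite T" "T \<noteq> {}" "\<And>t t'. t \<in> T \<Longrightarrow> t' \<in> T \<Longrightarrow> \<bar>h (v + t - t') - h' (w + t - t')\<bar> \<le> \<kappa>"
  shows "\<bar>smooth T h v - smooth T h' w\<bar> \<le> \<kappa>"
proof -
  have c: "real (card T) > 0" using assms by (simp add: card_gt_0_iff)
  have "smooth T h v - smooth T h' w = (\<Sum>t\<in>T. \<Sum>t'\<in>T. h (v + t - t') - h' (w + t - t')) / (real (card T))\<^sup>2"
    by (simp add: smooth_def sum_subtractf diff_divide_distrib)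
  moreover have "\<bar>\<Sum>t\<in>T. \<Sum>t'\<in>T. h (v + t - t') - h' (w + t - t')\<bar> \<le> (\<Sum>t\<in>T. \<Sum>t'\<in>T. \<kappa>)"
    by (rule order_trans[OF sum_abs], rule sum_mono, rule order_trans[OF sum_abs], rule sum_mono)
      (rule assms(3))
  ultimately show ?thesis using c by (simp add: abs_mult divide_le_eq power2_eq_square mult_ac)
qed

lemma smooth_const: "finite T \<Longrightarrow> T \<noteq> {} \<Longrightarrow> smooth T (\<lambda>_. a) v = a"
  by (simp add: smooth_def power2_eq_square)

lemma funpow_smooth_dist:
  assumes T: "finite T" "T \<noteq> {}"
    and per: "\<And>v t t'. t \<in> T \<Longrightarrow> t' \<in> T \<Longrightarrow> \<bar>h (v + t - t') - h v\<bar> \<le> \<kappa>"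
  shows "\<bar>(smooth T ^^ l) h v - h v\<bar> \<le> real l * \<kappa>"
proof -
  \<comment> \<open>The induction carries along that smoothing preserves almost periodicity with the
    same \<kappa>; therefore each round adds only \<kappa> to the distance.\<close>
  have "(\<forall>v t t'. t \<in> T \<longrightarrow> t' \<in> T \<longrightarrow> \<bar>(smooth T ^^ l) h (v + t - t') - (smooth T ^^ l) h v\<bar> \<le> \<kappa>) \<and>
    (\<forall>v. \<bar>(smooth T ^^ l) h v - h v\<bar> \<le> real l * \<kappa>)"
  proof (induction l)
    case 0
    then show ?case using per by simp
  next
    case (Suc l)
    let ?g = "(smooth T ^^ l) h"
    have g: "\<bar>?g (v + t - t') - ?g v\<bar> \<le> \<kappa>" if "t \<in> T" "t' \<in> T" for v t t' using Suc that by blast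
    have "\<bar>smooth T ?g (v + t - t') - smooth T ?g v\<bar> \<le> \<kappa>" if t: "t \<in> T" "t' \<in> T" for v t t'
    proof (rule smooth_diff_le[OF T])
      fix s s' assume "s \<in> T" "s' \<in> T"
      show "\<bar>?g (v + t - t' + s - s') - ?g (v + s - s')\<bar> \<le> \<kappa>"
        using g[OF t, of "v + s - s'"] by (simp add: algebra_simps)
    qed
    moreover have "\<bar>smooth T ?g v - h v\<bar> \<le> real (Suc l) * \<kappa>" for v
    proof -
      have "\<bar>smooth T ?g v - smooth T (\<lambda>_. ?g v) v\<bar> \<le> \<kappa>"
        by (rule smooth_diff_le[OF T]) (rule g)
      then have "\<bar>smooth T ?g v - ?g v\<bar> \<le> \<kappa>" using T by (simp add: smooth_const)
      moreover have "\<bar>?g v - h v\<bar> \<le> real l * \<kappa>" using Suc by blast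
      ultimately show ?thesis by (simp add: algebra_simps)
    qed
    ultimately show ?case by simp
  qed
  then show ?thesis by blast
qed

text \<open>An expansion taken from a finite cyclic group is valid only on a window of integers. One
  round of smoothing looks 2 R further to each side, so the window required of h grows by 2 R per
  round.\<close>

lemma funpow_smooth_spectral:
  fixes c :: "'i \<Rightarrow> complex" and \<theta> :: "'i \<Rightarrow> real"
  assumes T: "finite T" "T \<noteq> {}" and R: "\<And>t. t \<in> T \<Longrightarrow> \<bar>t\<bar> \<le> R"
    and h: "\<And>v. \<bar>v\<bar> \<le> A + 2 * R * int l \<Longrightarrow> of_real (h v) = (\<Sum>r\<in>I. c r * ee (\<theta> r) v)"
    and v: "\<bar>v\<bar> \<le> A"
  shows "of_real ((smooth T ^^ l) h v) = (\<Sum>r\<in>I. c r * of_real (cmod (avg T (\<theta> r)) ^ (2 * l)) * ee (\<theta> r) v)"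
  using h v
proof (induction l arbitrary: A v)
  case 0
  then show ?case by simp
next
  case (Suc l)
  let ?g = "(smooth T ^^ l) h"
  let ?c = "\<lambda>r. c r * of_real (cmod (avg T (\<theta> r)) ^ (2 * l))"
  have cT: "card T \<noteq> 0" using T by simp
  have IH: "of_real (?g w) = (\<Sum>r\<in>I. ?c r * ee (\<theta> r) w)" if "\<bar>w\<bar> \<le> A + 2 * R" for w
    by (rule Suc.IH[of "A + 2 * R"]) (use Suc.prems that in \<open>auto simp: algebra_simps\<close>)
  have *: "(\<Sum>t\<in>T. \<Sum>t'\<in>T. ee a (v + t - t')) = of_nat (card T) ^ 2 * of_real (cmod (avg T a) ^ 2) * ee a v" for a
  proof -
    have "(\<Sum>t\<in>T. \<Sum>t'\<in>T. ee a (v + t - t')) = (\<Sum>t\<in>T. \<Sum>t'\<in>T. ee a v * (ee a t * cnj (ee a t')))"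
      by (simp add: cnj_ee ee_add[symmetric] algebra_simps)
    also have "\<dots> = ee a v * ((\<Sum>t\<in>T. ee a t) * cnj (\<Sum>t\<in>T. ee a t))"
      by (simp only: cnj_sum sum_product) (simp only: sum_distrib_left)
    also have "(\<Sum>t\<in>T. ee a t) = of_nat (card T) * avg T a" using cT by (simp add: avg_def)
    finally show ?thesis unfolding complex_norm_square by (simp add: power2_eq_square mult_ac)
  qed
  have "complex_of_real ((smooth T ^^ Suc l) h v) = (\<Sum>t\<in>T. \<Sum>t'\<in>T. of_real (?g (v + t - t'))) / of_nat (card T) ^ 2"
    by (simp add: smooth_def)
  also have "(\<Sum>t\<in>T. \<Sum>t'\<in>T. of_real (?g (v + t - t'))) = (\<Sum>t\<in>T. \<Sum>t'\<in>T. \<Sum>r\<in>I. ?c r * ee (\<theta> r) (v + t - t'))"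
  proof (intro sum.cong refl IH)
    fix t t' assume "t \<in> T" "t' \<in> T"
    then show "\<bar>v + t - t'\<bar> \<le> A + 2 * R" using R[of t] R[of t'] Suc.prems(2) by linarith
  qed
  also have "\<dots> = (\<Sum>r\<in>I. ?c r * (\<Sum>t\<in>T. \<Sum>t'\<in>T. ee (\<theta> r) (v + t - t')))"
    unfolding sum_distrib_left by (subst sum.swap[of _ I], subst sum.swap[of _ I]) (rule refl)
  also have "\<dots> / of_nat (card T) ^ 2 = (\<Sum>r\<in>I. ?c r * of_real (cmod (avg T (\<theta> r)) ^ 2) * ee (\<theta> r) v)"
    unfolding * using cT by (simp add: sum_divide_distrib mult_ac)
  also have "\<dots> = (\<Sum>r\<in>I. c r * of_real (cmod (avg T (\<theta> r)) ^ (2 * Suc l)) * ee (\<theta> r) v)"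
    by (simp add: power_add[symmetric] mult.assoc)
  finally show ?case .
qed

text \<open>Passing to the l-fold smoothing costs l \<epsilon> at v and again at 0. In the smoothed
  function, a frequency where T has average at most 1/2 contributes at most 2 * 4^(-l) times its
  coefficient, any other at most \<kappa> times it, as v nearly annihilates it. Cauchy--Schwarz and
  Parseval bound the sum of the coefficients by |F| sqrt (|E| |S|).\<close>

theorem cnt_smoothing:
  fixes E F S T B :: "int set" and \<kappa> \<epsilon> :: real
  assumes fin: "finite E" "finite F" "finite S" "finite T" "finite B" and T: "T \<noteq> {}"
    and per: "\<And>v t t'. t \<in> T \<Longrightarrow> t' \<in> T \<Longrightarrow> \<bar>cnt E F S (v + t - t') - cnt E F S v\<bar> \<le> \<epsilon>"
    and spec: "\<And>v \<theta>. v \<in> B \<Longrightarrow> cmod (avg T \<theta>) > 1 / 2 \<Longrightarrow> cmod (ee \<theta> v - 1) \<le> \<kappa>"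
    and \<kappa>: "\<kappa> \<ge> 0" and v: "v \<in> B"
  shows "\<bar>cnt E F S v - cnt E F S 0\<bar>
    \<le> 2 * real l * \<epsilon> + (2 * (1 / 4) ^ l + \<kappa>) * (card F * sqrt (card E * card S))"
proof -
  define R where "R = (\<Sum>x\<in>E \<union> F \<union> S \<union> T \<union> B. \<bar>x\<bar>)"
  have R: "\<bar>x\<bar> \<le> R" if "x \<in> E \<union> F \<union> S \<union> T \<union> B" for x
    unfolding R_def using that fin by (intro member_le_sum) auto
  have R0: "R \<ge> 0" unfolding R_def by (intro sum_nonneg) auto
  define A0 where "A0 = R + 2 * R * int l"
  have A0: "A0 \<ge> 0" using R0 by (simp add: A0_def)
  \<comment> \<open>Larger than every |e + f + w - s| with |w| \<le> A0, so that divisibility by M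
    means vanishing; A0 leaves room for l rounds of shifts starting within R.\<close>
  define M where "M = nat (3 * R + A0 + 1)"
  have M: "int M = 3 * R + A0 + 1" using R0 A0 by (simp add: M_def)
  have M1: "M \<ge> 1" using M R0 A0 by linarith
  define fr where "fr r = real r / real M" for r :: nat
  define ft where "ft X r = (\<Sum>x\<in>X. ee (fr r) x)" for X :: "int set" and r
  define c where "c r = ft E r * ft F r * cnj (ft S r) / of_nat M" for r
  have small: "x = y" if "int M dvd x - y" "\<bar>x - y\<bar> < int M" for x y
    using dvd_imp_le_int[of "x - y" "int M"] that by auto
  have rep: "of_real (cnt E F S w) = (\<Sum>r<M. c r * ee (fr r) w)" if w: "\<bar>w\<bar> \<le> A0" for w
  proof -
    have "(\<Sum>r<M. ft E r * ft F r * cnj (ft S r) * ee (fr r) w)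
        = (\<Sum>r<M. \<Sum>e\<in>E. \<Sum>f\<in>F. \<Sum>s\<in>S. ee (fr r) (e + f + w - s))"
    proof (intro sum.cong refl)
      fix r
      have "ft E r * ft F r * cnj (ft S r) * ee (fr r) w
          = (\<Sum>e\<in>E. \<Sum>f\<in>F. \<Sum>s\<in>S. ee (fr r) e * ee (fr r) f * ee (fr r) (- s) * ee (fr r) w)"
      proof -
        have "ft E r * ft F r * cnj (ft S r) * ee (fr r) w
            = (\<Sum>e\<in>E. ee (fr r) e * (\<Sum>f\<in>F. ee (fr r) f * (\<Sum>s\<in>S. ee (fr r) (- s) * ee (fr r) w)))"
          by (simp only: ft_def cnj_sum cnj_ee mult.assoc sum_distrib_right)
        then show ?thesis by (simp only: sum_distrib_left mult.assoc)
      qed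
      also have "\<dots> = (\<Sum>e\<in>E. \<Sum>f\<in>F. \<Sum>s\<in>S. ee (fr r) (e + f + w - s))"
        by (intro sum.cong refl) (simp add: ee_add[symmetric] algebra_simps)
      finally show "ft E r * ft F r * cnj (ft S r) * ee (fr r) w
          = (\<Sum>e\<in>E. \<Sum>f\<in>F. \<Sum>s\<in>S. ee (fr r) (e + f + w - s))" .
    qed
    also have "\<dots> = (\<Sum>e\<in>E. \<Sum>f\<in>F. \<Sum>s\<in>S. \<Sum>r<M. ee (fr r) (e + f + w - s))"
      by (subst sum.swap, intro sum.cong refl, subst sum.swap, intro sum.cong refl, rule sum.swap)
    also have "\<dots> = (\<Sum>e\<in>E. \<Sum>f\<in>F. \<Sum>s\<in>S. if s = e + f + w then of_nat M else 0)"
    proof (intro sum.cong refl)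
      fix e f s assume "e \<in> E" "f \<in> F" "s \<in> S"
      then have "\<bar>e\<bar> \<le> R" "\<bar>f\<bar> \<le> R" "\<bar>s\<bar> \<le> R" by (auto intro: R)
      then have "\<bar>(e + f + w) - s\<bar> < int M" using w unfolding M by linarith
      then have "int M dvd e + f + w - s \<longleftrightarrow> s = e + f + w" using small[of "e + f + w" s] by auto
      then show "(\<Sum>r<M. ee (fr r) (e + f + w - s)) = (if s = e + f + w then of_nat M else 0)"
        unfolding fr_def sum_ee_orthogonal[OF M1] by simp
    qed
    also have "\<dots> = of_nat M * of_real (cnt E F S w)"
      using fin by (simp add: cnt_def sum_distrib_left if_distrib of_real_sum cong: if_cong)
    finally show ?thesis using M1
      by (simp add: c_def sum_divide_distrib[symmetric] field_simps)
  qed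
  let ?H = "(smooth T ^^ l) (cnt E F S)"
  have H: "of_real (?H w) = (\<Sum>r<M. c r * of_real (cmod (avg T (fr r)) ^ (2 * l)) * ee (fr r) w)"
    if "\<bar>w\<bar> \<le> R" for w
    by (rule funpow_smooth_spectral[where R = R and A = R]) (use fin T R rep that in \<open>auto simp: A0_def\<close>)
  have "cmod (c r * of_real (cmod (avg T (fr r)) ^ (2 * l)) * (ee (fr r) v - 1)) \<le> cmod (c r) * (2 * (1 / 4) ^ l + \<kappa>)" for r
  proof -
    have "cmod (avg T (fr r)) ^ (2 * l) * cmod (ee (fr r) v - 1) \<le> 2 * (1 / 4) ^ l + \<kappa>"
    proof (cases "cmod (avg T (fr r)) > 1 / 2")
      case True
      have "cmod (avg T (fr r)) ^ (2 * l) * cmod (ee (fr r) v - 1) \<le> 1 * \<kappa>"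
        using spec[OF v True] norm_avg_le by (intro mult_mono power_le_one) auto
      moreover have "0 \<le> 2 * (1 / 4 :: real) ^ l" by simp
      ultimately show ?thesis by linarith
    next
      case False
      have "cmod (avg T (fr r)) ^ (2 * l) * cmod (ee (fr r) v - 1) \<le> (1 / 2) ^ (2 * l) * 2"
        using False ee_dist_le_2 by (intro mult_mono power_mono) auto
      also have "\<dots> = 2 * (1 / 4) ^ l" by (simp add: power_mult power2_eq_square)
      finally show ?thesis using \<kappa> by linarith
    qed
    then have "cmod (c r) * (cmod (avg T (fr r)) ^ (2 * l) * cmod (ee (fr r) v - 1)) \<le> cmod (c r) * (2 * (1 / 4) ^ l + \<kappa>)"
      by (rule mult_left_mono) simp
    then show ?thesis by (simp add: norm_mult norm_power mult.assoc)
  qed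
  then have "cmod (\<Sum>r<M. c r * of_real (cmod (avg T (fr r)) ^ (2 * l)) * (ee (fr r) v - 1))
      \<le> (\<Sum>r<M. cmod (c r) * (2 * (1 / 4) ^ l + \<kappa>))"
    by (intro order_trans[OF norm_sum] sum_mono)
  moreover have "(\<Sum>r<M. c r * of_real (cmod (avg T (fr r)) ^ (2 * l)) * (ee (fr r) v - 1))
      = of_real (?H v - ?H 0)"
    unfolding of_real_diff using H[of v] H[of 0] R v R0 by (simp add: sum_subtractf algebra_simps)
  ultimately have HH: "\<bar>?H v - ?H 0\<bar> \<le> (\<Sum>r<M. cmod (c r)) * (2 * (1 / 4) ^ l + \<kappa>)"
    by (simp only: norm_of_real sum_distrib_right)
  have "(\<Sum>r<M. cmod (c r)) \<le> card F * sqrt (card E * card S)"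
  proof -
    have p: "(\<Sum>r<M. (cmod (ft X r))\<^sup>2) = real M * card X" if "finite X" "\<And>x. x \<in> X \<Longrightarrow> \<bar>x\<bar> \<le> R" for X
      unfolding ft_def fr_def
    proof (rule parseval_mod[OF M1 that(1)])
      fix x y assume "x \<in> X" "y \<in> X" "int M dvd x - y"
      then show "x = y" using that(2)[of x] that(2)[of y] A0 M by (intro small) auto
    qed
    have *: "cmod (ft F r) \<le> card F" for r unfolding ft_def by (rule order_trans[OF norm_sum]) simp
    have "cmod (c r) \<le> card F / M * (\<bar>cmod (ft E r)\<bar> * \<bar>cmod (ft S r)\<bar>)" for r
    proof -
      have "cmod (ft F r) * (cmod (ft E r) * cmod (ft S r)) \<le> card F * (cmod (ft E r) * cmod (ft S r))"
        using * by (intro mult_right_mono) auto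
      then have "cmod (ft F r) * (cmod (ft E r) * cmod (ft S r)) / M \<le> card F * (cmod (ft E r) * cmod (ft S r)) / M"
        by (intro divide_right_mono) auto
      then show ?thesis unfolding c_def by (simp add: norm_mult norm_divide mult_ac)
    qed
    then have "(\<Sum>r<M. cmod (c r)) \<le> (\<Sum>r<M. card F / M * (\<bar>cmod (ft E r)\<bar> * \<bar>cmod (ft S r)\<bar>))"
      by (rule sum_mono)
    also have "\<dots> = card F / M * (\<Sum>r<M. \<bar>cmod (ft E r)\<bar> * \<bar>cmod (ft S r)\<bar>)" by (simp only: sum_distrib_left)
    also have "\<dots> \<le> card F / M * (sqrt (real M * card E) * sqrt (real M * card S))"
      using L2_set_mult_ineq[of "\<lambda>r. cmod (ft E r)" "\<lambda>r. cmod (ft S r)" "{..<M}"] fin R p[of E] p[of S]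
      by (intro mult_left_mono) (auto simp: L2_set_def)
    also have "\<dots> = card F * sqrt (card E * card S)"
    proof -
      have "sqrt (real M * card E) * sqrt (real M * card S)
          = (sqrt (real M) * sqrt (real M)) * (sqrt (card E) * sqrt (card S))"
        unfolding real_sqrt_mult by (simp only: mult_ac)
      then show ?thesis using M1 by (simp only:) (simp add: real_sqrt_mult)
    qed
    finally show ?thesis .
  qed
  then have "(\<Sum>r<M. cmod (c r)) * (2 * (1 / 4) ^ l + \<kappa>) \<le> (card F * sqrt (card E * card S)) * (2 * (1 / 4) ^ l + \<kappa>)"
    using \<kappa> by (intro mult_right_mono) auto
  moreover have "\<bar>?H w - cnt E F S w\<bar> \<le> real l * \<epsilon>" for w
    by (rule funpow_smooth_dist[OF fin(4) T]) (rule per)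
  note this[of v] this[of 0]
  ultimately show ?thesis using HH by (simp only: mult.commute[of "2 * (1 / 4) ^ l + \<kappa>"])
qed

section \<open>Density increment on a Bohr set\<close>

text \<open>A shift by v within the margin moves at most a proportion \<eta> of the regular set out
  and as much in, so the Fourier sum at \<xi> changes by at most 2 \<eta> times the size of the set.
  The shift also multiplies this sum by \<open>ee \<xi> v\<close>; as the sum is large, the factor
  is close to 1.\<close>

lemma bohr_annihilates:
  assumes reg: "bohr_reg N \<Theta> \<eta> \<rho>" and "\<rho> \<ge> 0" "\<eta> \<ge> 0"
    and big: "cmod (avg (bohr N \<Theta> \<rho>) \<xi>) > 1 / 2"
    and v: "v \<in> bohr N \<Theta> (\<eta> * \<rho> / (22 * (2 * real (card \<Theta>) + 1)))"
  shows "cmod (ee \<xi> v - 1) \<le> 4 * \<eta>"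
proof -
  let ?W = "bohr N \<Theta> \<rho>" and ?W' = "bohr N \<Theta> (\<rho> + \<eta> * \<rho> / (22 * (2 * real (card \<Theta>) + 1)))"
  let ?V = "(\<lambda>x. x + v) ` ?W"
  have cW: "card ?W > 0" using assms by (simp add: card_bohr_pos)
  have VW': "?V \<subseteq> ?W'" using bohr_add[OF _ v] by auto
  have WW': "?W \<subseteq> ?W'" using assms by (intro bohr_mono) auto
  have cV: "card ?V = card ?W" by (rule card_image) (auto simp: inj_on_def)
  have "real (card (?W' - ?W)) = real (card ?W') - real (card ?W)"
    using WW' by (simp add: card_Diff_subset of_nat_diff card_mono)
  then have "real (card (?W' - ?W)) \<le> \<eta> * card ?W"
    using reg by (simp add: bohr_reg_def algebra_simps)
  moreover have "card (?V - ?W) \<le> card (?W' - ?W)" using VW' by (intro card_mono) auto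
  ultimately have d1: "real (card (?V - ?W)) \<le> \<eta> * card ?W" by linarith
  have "card (?W - ?V) = card (?V - ?W)"
    using card_Int_Diff[of ?W ?V] card_Int_Diff[of ?V ?W] cV by (simp add: Int_commute)
  then have d2: "real (card (?W - ?V)) \<le> \<eta> * card ?W" using d1 by simp
  have "(\<Sum>x\<in>?V. ee \<xi> x) = (\<Sum>x\<in>?W. ee \<xi> v * ee \<xi> x)"
    by (subst sum.reindex) (auto simp: inj_on_def ee_add mult.commute)
  then have "(ee \<xi> v - 1) * (\<Sum>x\<in>?W. ee \<xi> x) = (\<Sum>x\<in>?V. ee \<xi> x) - (\<Sum>x\<in>?W. ee \<xi> x)"
    by (simp only: left_diff_distrib mult_1_left) (simp only: sum_distrib_left)
  also have "\<dots> = (\<Sum>x\<in>?V - ?W. ee \<xi> x) - (\<Sum>x\<in>?W - ?V. ee \<xi> x)"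
    using sum.Int_Diff[of ?V "ee \<xi>" ?W] sum.Int_Diff[of ?W "ee \<xi>" ?V] by (simp add: Int_commute)
  also have "cmod \<dots> \<le> real (card (?V - ?W)) + real (card (?W - ?V))"
  proof (rule order_trans[OF norm_triangle_ineq4 add_mono])
    show "cmod (\<Sum>x\<in>X. ee \<xi> x) \<le> real (card X)" for X by (rule order_trans[OF norm_sum]) simp
    then show "cmod (\<Sum>x\<in>?W - ?V. ee \<xi> x) \<le> real (card (?W - ?V))" .
  qed
  also have "\<dots> \<le> 2 * \<eta> * card ?W" using d1 d2 by simp
  finally have "cmod (ee \<xi> v - 1) * cmod (\<Sum>x\<in>?W. ee \<xi> x) \<le> 2 * \<eta> * card ?W"
    by (simp only: norm_mult)
  moreover have "cmod (\<Sum>x\<in>?W. ee \<xi> x) = card ?W * cmod (avg ?W \<xi>)"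
    using cW by (simp add: avg_def norm_divide)
  ultimately have "(cmod (ee \<xi> v - 1) * cmod (avg ?W \<xi>)) * card ?W \<le> (2 * \<eta>) * card ?W"
    by (simp add: mult_ac)
  then have "cmod (ee \<xi> v - 1) * cmod (avg ?W \<xi>) \<le> 2 * \<eta>" using cW by simp
  moreover have "cmod (ee \<xi> v - 1) * (1 / 2) \<le> cmod (ee \<xi> v - 1) * cmod (avg ?W \<xi>)"
    using big by (intro mult_left_mono) auto
  ultimately show ?thesis by simp
qed

text \<open>\<Gamma> need not be finite; the uniform bound m makes it possible to maximise the
  cardinality.\<close>

lemma exists_maximal_dissociated:
  assumes bound: "\<And>\<Lambda>. finite \<Lambda> \<Longrightarrow> \<Lambda> \<subseteq> \<Gamma> \<Longrightarrow> dissociated W \<Lambda> \<Longrightarrow> card \<Lambda> \<le> m"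
  shows "\<exists>\<Lambda>. finite \<Lambda> \<and> \<Lambda> \<subseteq> \<Gamma> \<and> dissociated W \<Lambda> \<and> card \<Lambda> \<le> m \<and>
    (\<forall>\<theta>\<in>\<Gamma> - \<Lambda>. \<not> dissociated W (insert \<theta> \<Lambda>))"
proof -
  let ?P = "\<lambda>\<Lambda>. finite \<Lambda> \<and> \<Lambda> \<subseteq> \<Gamma> \<and> dissociated W \<Lambda>"
  have "?P {}" by (simp add: dissociated_def)
  moreover have "\<forall>\<Lambda>. ?P \<Lambda> \<longrightarrow> card \<Lambda> < Suc m" using bound by (simp add: less_Suc_eq_le)
  ultimately obtain \<Lambda> where \<Lambda>: "?P \<Lambda>" "\<And>\<Lambda>'. ?P \<Lambda>' \<Longrightarrow> card \<Lambda>' \<le> card \<Lambda>"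
    using ex_has_greatest_nat[of ?P "{}" card "Suc m"] by blast
  have "\<not> dissociated W (insert \<theta> \<Lambda>)" if "\<theta> \<in> \<Gamma> - \<Lambda>" for \<theta>
    using \<Lambda>(1) \<Lambda>(2)[of "insert \<theta> \<Lambda>"] that by auto
  then show ?thesis using \<Lambda>(1) bound by blast
qed

text \<open>The relation that appears must involve \<theta>, for \<Lambda> alone admits none. Up to
  sign, \<theta> is therefore a frequency in the large spectrum of W minus a combination of
  \<Lambda>.\<close>

lemma not_dissociated_insertE:
  assumes "dissociated W \<Lambda>" "finite \<Lambda>" "\<theta> \<notin> \<Lambda>" "\<not> dissociated W (insert \<theta> \<Lambda>)"
  obtains \<sigma> g where "\<sigma> = 1 \<or> \<sigma> = - 1" "\<forall>q\<in>\<Lambda>. g q \<in> {-1, 0, 1}"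
    "cmod (avg W (of_int \<sigma> * \<theta> + (\<Sum>q\<in>\<Lambda>. of_int (g q) * q))) > 1 / 2"
proof -
  obtain g where g: "g \<in> signs (insert \<theta> \<Lambda>)" "\<exists>q\<in>insert \<theta> \<Lambda>. g q \<noteq> 0"
    "cmod (avg W (\<Sum>q\<in>insert \<theta> \<Lambda>. of_int (g q) * q)) > 1 / 2"
    using assms(4) unfolding dissociated_def by (auto simp: not_le)
  have mem: "g q \<in> {-1, 0, 1}" if "q \<in> insert \<theta> \<Lambda>" for q
    using g(1) that unfolding signs_def by (rule PiE_mem)
  have big: "cmod (avg W (of_int (g \<theta>) * \<theta> + (\<Sum>q\<in>\<Lambda>. of_int (g q) * q))) > 1 / 2"
    using g(3) assms(2,3) by simp
  have "g \<theta> \<noteq> 0"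
  proof
    assume 0: "g \<theta> = 0"
    have "restrict g \<Lambda> \<in> signs \<Lambda>" using mem unfolding signs_def by (auto simp: restrict_PiE_iff)
    moreover have "\<exists>q\<in>\<Lambda>. restrict g \<Lambda> q \<noteq> 0" using g(2) 0 by auto
    ultimately have "cmod (avg W (\<Sum>q\<in>\<Lambda>. of_int (restrict g \<Lambda> q) * q)) \<le> 1 / 2"
      using assms(1) unfolding dissociated_def by blast
    then show False using big 0 by simp
  qed
  then have "g \<theta> = 1 \<or> g \<theta> = - 1" using mem[of \<theta>] by auto
  then show thesis using that[of "g \<theta>" g] mem big by blast
qed

lemma ee_int_freq_dist_le:
  assumes "g \<in> {-1, 0, 1}"
  shows "cmod (ee (of_int g * q) v - 1) \<le> cmod (ee q v - 1)"
  using assms by (auto simp: ee_minus_freq ee_minus_dist)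

lemma ee_sum_freq_dist_le:
  assumes "finite \<Lambda>" "\<And>q. q \<in> \<Lambda> \<Longrightarrow> g q \<in> {-1, 0, 1}"
  shows "cmod (ee (\<Sum>q\<in>\<Lambda>. of_int (g q) * q) v - 1) \<le> (\<Sum>q\<in>\<Lambda>. cmod (ee q v - 1))"
  using assms
proof (induction \<Lambda> rule: finite_induct)
  case (insert q \<Lambda>)
  have "cmod (ee (of_int (g q) * q + (\<Sum>q\<in>\<Lambda>. of_int (g q) * q)) v - 1)
      \<le> cmod (ee (of_int (g q) * q) v - 1) + cmod (ee (\<Sum>q\<in>\<Lambda>. of_int (g q) * q) v - 1)"
    unfolding ee_add_freq by (rule ee_mult_dist) simp
  also have "\<dots> \<le> cmod (ee q v - 1) + (\<Sum>q\<in>\<Lambda>. cmod (ee q v - 1))"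
    using insert by (intro add_mono ee_int_freq_dist_le) auto
  finally show ?case using insert by simp
qed simp

text \<open>\<Lambda> is a maximal dissociated subset of the large spectrum of T. For any other
  \<theta> there, \<open>\<sigma> * \<theta> + s\<close> lies in the large spectrum of W for a sign
  \<sigma> and a combination s of \<Lambda>. Regularity of W makes v annihilate this frequency up to
  \<kappa>/2, and the conditions at \<Lambda> make it annihilate s up to \<kappa>/2.\<close>

theorem local_chang:
  fixes \<Theta> :: "real set" and \<tau> \<delta> \<delta>' \<kappa> D :: real and m :: nat
  defines "D \<equiv> 2 * real (card \<Theta>) + 1"
  assumes N: "N \<ge> 1" and fin: "finite \<Theta>" and \<delta>: "0 < \<delta>" "\<delta> \<le> 2" and reg: "bohr_reg N \<Theta> 1 \<delta>"
    and T: "T \<subseteq> bohr N \<Theta> \<delta>" "T \<noteq> {}" "card (bohr N \<Theta> \<delta>) \<le> \<tau> * card T"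
    and m: "m \<ge> 16 * ln (4 * \<tau>)" and \<kappa>: "0 < \<kappa>" "\<kappa> \<le> 1"
    and \<delta>': "\<delta>' \<le> \<kappa> * \<delta> / (15488 * D\<^sup>2 * (m + 1))"
  shows "\<exists>\<Lambda>. finite \<Lambda> \<and> card \<Lambda> \<le> m \<and>
    (\<forall>v\<in>bohr N (\<Theta> \<union> \<Lambda>) \<delta>'. \<forall>\<theta>. cmod (avg T \<theta>) > 1 / 2 \<longrightarrow> cmod (ee \<theta> v - 1) \<le> \<kappa>)"
proof -
  \<comment> \<open>Gives 3^(m+1) \<le> 4^(m+1) = 2^L. The size bound is applied to a subset with
    exactly m + 1 elements, so L can be fixed before \<Lambda> is known.\<close>
  define L where "L = 2 * (m + 1)"
  have D: "D \<ge> 1" by (simp add: D_def)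
  \<comment> \<open>Sums of L elements of W then have radius at most
    \<open>\<delta> / (22 * D)\<close>, the regularity margin of the ambient Bohr set.\<close>
  define \<rho>0 where "\<rho>0 = \<delta> / (22 * D * L)"
  have \<rho>0: "\<rho>0 > 0" using \<delta> D by (simp add: \<rho>0_def L_def)
  have \<eta>: "0 < \<kappa> / 8" "\<kappa> / 8 \<le> 1" using \<kappa> by auto
  obtain \<rho> where \<rho>: "\<rho>0 / 2 \<le> \<rho>" "\<rho> \<le> \<rho>0" "bohr_reg N \<Theta> (\<kappa> / 8) \<rho>"
    using exists_bohr_reg[OF fin \<rho>0 N \<eta>] by auto
  define W where "W = bohr N \<Theta> \<rho>"
  let ?V = "bohr N \<Theta> \<delta>" and ?V' = "bohr N \<Theta> (\<delta> + 1 * \<delta> / (22 * (2 * real (card \<Theta>) + 1)))"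
  define \<Gamma> where "\<Gamma> = {\<theta>. cmod (avg T \<theta>) > 1 / 2}"
  have W0: "W \<noteq> {}" using \<rho> \<rho>0 zero_in_bohr[of \<rho>] unfolding W_def by fastforce
  have L\<rho>: "L * \<rho> \<le> \<delta> / (22 * D)"
  proof -
    have "L * \<rho> \<le> L * \<rho>0" using \<rho> by (intro mult_left_mono) auto
    also have "\<dots> = \<delta> / (22 * D)" by (simp add: \<rho>0_def L_def)
    finally show ?thesis .
  qed
  have sub: "x - (\<Sum>j<L. y j) \<in> ?V'" if "x \<in> ?V" "y \<in> {..<L} \<rightarrow>\<^sub>E W" for x y
  proof -
    have "(\<Sum>j<L. y j) \<in> bohr N \<Theta> (real (card {..<L}) * \<rho>)"
      using that(2) unfolding W_def by (intro bohr_sum) (auto dest: PiE_mem)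
    then have "x - (\<Sum>j<L. y j) \<in> bohr N \<Theta> (\<delta> + real (card {..<L}) * \<rho>)" using that(1) by (intro bohr_diff)
    moreover have "bohr N \<Theta> (\<delta> + real (card {..<L}) * \<rho>) \<subseteq> ?V'"
      using L\<rho> by (intro bohr_mono) (auto simp: D_def)
    ultimately show ?thesis by blast
  qed
  have V': "card ?V' \<le> 2 * card ?V"
  proof -
    have "real (card ?V') \<le> real (2 * card ?V)" using reg unfolding bohr_reg_def by simp
    then show ?thesis by (simp only: of_nat_le_iff)
  qed
  have bound: "card \<Lambda> \<le> m" if \<Lambda>: "finite \<Lambda>" "\<Lambda> \<subseteq> \<Gamma>" "dissociated W \<Lambda>" for \<Lambda>
  proof (rule ccontr)
    assume "\<not> card \<Lambda> \<le> m"
    then have "m + 1 \<le> card \<Lambda>" by simp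
    then obtain \<Lambda>' where \<Lambda>': "\<Lambda>' \<subseteq> \<Lambda>" "card \<Lambda>' = m + 1" by (meson obtain_subset_with_card_n)
    have fin': "finite \<Lambda>'" using \<Lambda>' \<Lambda>(1) finite_subset by blast
    have "(3::real) ^ card \<Lambda>' \<le> 4 ^ (m + 1)" unfolding \<Lambda>'(2) by (rule power_mono) auto
    also have "\<dots> = 2 ^ L" unfolding L_def power_mult by simp
    finally have "card \<Lambda>' \<le> 16 * ln (4 * \<tau>)"
      using \<Lambda>' \<Lambda> fin' T V' sub W0 \<Gamma>_def
      by (intro dissociated_card_le[where V = ?V and V' = ?V' and W = W and T = T and L = L])
        (auto simp: W_def intro: dissociated_subset)
    then show False using m \<Lambda>'(2) by simp
  qed
  obtain \<Lambda> where \<Lambda>: "finite \<Lambda>" "\<Lambda> \<subseteq> \<Gamma>" "dissociated W \<Lambda>" "card \<Lambda> \<le> m"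
    and max: "\<And>\<theta>. \<theta> \<in> \<Gamma> - \<Lambda> \<Longrightarrow> \<not> dissociated W (insert \<theta> \<Lambda>)"
    using exists_maximal_dissociated[of \<Gamma> W m] bound by blast
  have "cmod (ee \<theta> v - 1) \<le> \<kappa>" if v: "v \<in> bohr N (\<Theta> \<union> \<Lambda>) \<delta>'" and \<theta>: "cmod (avg T \<theta>) > 1 / 2" for v \<theta>
  proof -
    have \<delta>'m: "\<delta>' * real (m + 1) \<le> \<kappa> / 2"
    proof -
      have "\<delta>' * real (m + 1) \<le> \<kappa> * \<delta> / (15488 * D\<^sup>2 * (m + 1)) * (m + 1)"
        using \<delta>' by (intro mult_right_mono) auto
      also have "\<dots> = \<kappa> * (\<delta> / (15488 * D\<^sup>2))" by simp
      also have "\<dots> \<le> \<kappa> * (1 / 2)"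
      proof (intro mult_left_mono)
        have "D\<^sup>2 \<ge> 1" using D by (simp add: one_le_power)
        then have "\<delta> * 2 \<le> 15488 * D\<^sup>2" using \<delta> by linarith
        then show "\<delta> / (15488 * D\<^sup>2) \<le> 1 / 2" using D by (simp add: divide_le_eq)
      qed (use \<kappa> in auto)
      finally show ?thesis by simp
    qed
    have vq: "cmod (ee q v - 1) \<le> \<delta>'" if "q \<in> \<Lambda>" for q using v that by (auto simp: bohr_def)
    have \<delta>'0: "0 \<le> \<delta>'"
    proof -
      have "0 \<le> \<delta>' * real N" using v by (auto simp: bohr_def intro: order_trans[OF abs_ge_zero])
      then show ?thesis using N by (simp add: zero_le_mult_iff)
    qed
    have \<delta>'\<kappa>: "\<delta>' \<le> \<kappa> / 2" 
    proof -
      have "\<delta>' * 1 \<le> \<delta>' * real (m + 1)" using \<delta>'0 by (intro mult_left_mono) auto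
      then show ?thesis using \<delta>'m by linarith
    qed
    show ?thesis
    proof (cases "\<theta> \<in> \<Lambda>")
      case True
      then show ?thesis using vq[of \<theta>] \<delta>'\<kappa> \<kappa> by linarith
    next
      case False
      then have nd: "\<not> dissociated W (insert \<theta> \<Lambda>)" using max \<theta> by (auto simp: \<Gamma>_def)
      obtain \<sigma> g where g: "\<sigma> = 1 \<or> \<sigma> = - 1" "\<forall>q\<in>\<Lambda>. g q \<in> {-1, 0, 1}"
        "cmod (avg W (of_int \<sigma> * \<theta> + (\<Sum>q\<in>\<Lambda>. of_int (g q) * q))) > 1 / 2"
        by (rule not_dissociated_insertE[OF \<Lambda>(3,1) False nd])
      define s where "s = (\<Sum>q\<in>\<Lambda>. of_int (g q) * q)"
      have "\<delta>' \<le> \<kappa> / 8 * \<rho> / (22 * (2 * real (card \<Theta>) + 1))"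
      proof -
        \<comment> \<open>15488 = 8 * 2 * 2 * 22^2: \<kappa>/8 is the regularity parameter of W, one
          factor 2 is lost in \<rho> \<ge> \<rho>0/2, one sits in L, and 22 D occurs in the margins
          of both Bohr sets.\<close>
        have "\<delta>' \<le> \<kappa> * \<delta> / (15488 * D\<^sup>2 * (m + 1))" by (rule \<delta>')
        also have "\<dots> = \<kappa> / 8 * (\<rho>0 / 2) / (22 * D)"
          by (simp add: \<rho>0_def L_def power2_eq_square)
        also have "\<dots> \<le> \<kappa> / 8 * \<rho> / (22 * D)"
          using \<rho> \<kappa> D by (intro divide_right_mono mult_left_mono) auto
        finally show ?thesis by (simp add: D_def)
      qed
      then have v': "v \<in> bohr N \<Theta> (\<kappa> / 8 * \<rho> / (22 * (2 * real (card \<Theta>) + 1)))"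
        using v bohr_mono[of \<delta>' _ \<Theta> "\<Theta> \<union> \<Lambda>" N] by blast
      have "cmod (ee (of_int \<sigma> * \<theta> + s) v - 1) \<le> 4 * (\<kappa> / 8)"
        using \<rho>(3) _ _ g(3)[folded s_def, unfolded W_def] v'
        by (rule bohr_annihilates) (use \<rho> \<rho>0 \<kappa> in auto)
      moreover have "cmod (ee s v - 1) \<le> \<kappa> / 2"
      proof -
        have "cmod (ee s v - 1) \<le> (\<Sum>q\<in>\<Lambda>. cmod (ee q v - 1))"
          unfolding s_def using \<Lambda>(1) bspec[OF g(2)] by (rule ee_sum_freq_dist_le)
        also have "\<dots> \<le> (\<Sum>q\<in>\<Lambda>. \<delta>')" using vq by (rule sum_mono)
        also have "\<dots> = \<delta>' * card \<Lambda>" by simp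
        also have "\<dots> \<le> \<delta>' * real (m + 1)" using \<Lambda>(4) \<delta>'0 by (intro mult_left_mono) auto
        finally show ?thesis using \<delta>'m by linarith
      qed
      moreover have "cmod (ee (of_int \<sigma> * \<theta>) v - 1) = cmod (ee \<theta> v - 1)"
        using g(1) by (auto simp: ee_minus_freq ee_minus_dist)
      moreover have "cmod (ee (of_int \<sigma> * \<theta>) v - 1)
          \<le> cmod (ee (of_int \<sigma> * \<theta> + s) v - 1) + cmod (ee s v - 1)"
      proof -
        have "ee (of_int \<sigma> * \<theta>) v = ee (of_int \<sigma> * \<theta> + s) v * ee s (- v)"
          by (simp add: ee_add_freq ee_add[symmetric] mult.assoc)
        then show ?thesis
          using ee_mult_dist[of "ee (of_int \<sigma> * \<theta> + s) v" "ee s (- v)"] by (simp add: ee_minus_dist)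
      qed
      ultimately show ?thesis by linarith
    qed
  qed
  then show ?thesis using \<Lambda>(1,4) by blast
qed

text \<open>For fixed f and s, each v in B accounts for at most one e, namely s - f - v. Symmetry of
  B turns -v into x, so the pair (f, s) contributes the part of E inside a translate of B.\<close>

lemma sum_cnt:
  assumes "finite E" "finite F" "finite S" "finite B" and sym: "\<And>x. - x \<in> B \<longleftrightarrow> x \<in> B"
  shows "(\<Sum>v\<in>B. cnt E F S v) = (\<Sum>f\<in>F. \<Sum>s\<in>S. real (card {x \<in> B. (s - f) + x \<in> E}))"
proof -
  have one: "(\<Sum>v\<in>B. \<Sum>e\<in>E. if e + f + v \<in> S then 1 else 0)
      = (\<Sum>s\<in>S. real (card {x \<in> B. (s - f) + x \<in> E}))" for f
  proof -
    have "(\<Sum>v\<in>B. \<Sum>e\<in>E. if e + f + v \<in> S then 1 else 0)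
        = (\<Sum>v\<in>B. \<Sum>e\<in>E. \<Sum>s\<in>S. if s = e + f + v then 1 else (0::real))"
      using assms by (intro sum.cong refl) simp
    also have "\<dots> = (\<Sum>v\<in>B. \<Sum>s\<in>S. \<Sum>e\<in>E. if e = s - f - v then 1 else 0)"
    proof (rule sum.cong[OF refl])
      fix v
      have "(\<Sum>e\<in>E. \<Sum>s\<in>S. if s = e + f + v then 1 else (0::real))
          = (\<Sum>s\<in>S. \<Sum>e\<in>E. if s = e + f + v then 1 else 0)" by (rule sum.swap)
      also have "\<dots> = (\<Sum>s\<in>S. \<Sum>e\<in>E. if e = s - f - v then 1 else 0)"
        by (rule sum.cong[OF refl], rule sum.cong[OF refl]) (simp add: algebra_simps eq_commute)
      finally show "(\<Sum>e\<in>E. \<Sum>s\<in>S. if s = e + f + v then 1 else (0::real))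
          = (\<Sum>s\<in>S. \<Sum>e\<in>E. if e = s - f - v then 1 else 0)" .
    qed
    also have "\<dots> = (\<Sum>v\<in>B. \<Sum>s\<in>S. if s - f - v \<in> E then 1 else 0)"
      using assms by (intro sum.cong refl) simp
    also have "\<dots> = (\<Sum>s\<in>S. \<Sum>v\<in>B. if s - f - v \<in> E then 1 else 0)" by (rule sum.swap)
    also have "\<dots> = (\<Sum>s\<in>S. real (card {v \<in> B. s - f - v \<in> E}))"
      using assms by (intro sum.cong refl) (simp add: sum.If_cases Int_def)
    also have "\<dots> = (\<Sum>s\<in>S. real (card {x \<in> B. (s - f) + x \<in> E}))"
    proof (intro sum.cong refl)
      fix s
      have "bij_betw uminus {v \<in> B. s - f - v \<in> E} {x \<in> B. (s - f) + x \<in> E}"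
        by (rule bij_betwI[of _ _ _ uminus]) (auto simp: sym)
      then show "real (card {v \<in> B. s - f - v \<in> E}) = real (card {x \<in> B. (s - f) + x \<in> E})"
        by (simp add: bij_betw_same_card)
    qed
    finally show ?thesis .
  qed
  have "(\<Sum>v\<in>B. cnt E F S v) = (\<Sum>v\<in>B. \<Sum>f\<in>F. \<Sum>e\<in>E. if e + f + v \<in> S then 1 else 0)"
    unfolding cnt_def by (rule sum.cong[OF refl], rule sum.swap)
  also have "\<dots> = (\<Sum>f\<in>F. \<Sum>v\<in>B. \<Sum>e\<in>E. if e + f + v \<in> S then 1 else 0)" by (rule sum.swap)
  finally show ?thesis unfolding one .
qed

text \<open>\<open>cnt\<close> stays close to its value at 0 on the whole new Bohr set, so by
  \<open>sum_cnt\<close> some translate by s - f carries at least the average share of E. The factor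
  |S| is kept on the right: the gain is about the size of the set in which E is dense divided by
  |S|.\<close>

theorem bohr_density_increment:
  fixes \<Theta> :: "real set" and K \<delta> \<delta>' D :: real and l m m0 :: nat
  defines "D \<equiv> 2 * real (card \<Theta>) + 1"
  assumes N: "N \<ge> 1" and finT: "finite \<Theta>" and \<delta>: "0 < \<delta>" "\<delta> \<le> 2" and reg: "bohr_reg N \<Theta> 1 \<delta>"
    and fin: "finite E" "finite F" "finite S" and ne: "E \<noteq> {}" "F \<noteq> {}" and K: "K \<ge> 1"
    and FV: "card ((\<lambda>(x, y). x + y) ` (F \<times> bohr N \<Theta> \<delta>)) \<le> K * card F"
    and SF: "card ((\<lambda>(x, y). x - y) ` (S \<times> F)) \<le> K * card E"
    and big: "cnt E F S 0 \<ge> 99 / 100 * card E * card F"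
    and l: "l \<ge> 1" "200 * K \<le> 4 ^ l"
    and m: "m \<ge> 4 * (400 * real l)\<^sup>2 * ln (1600 * K * l)"
    and m0: "m0 \<ge> 16 * ln (8 * K ^ m)"
    and \<delta>': "0 < \<delta>'" "\<delta>' \<le> \<delta> / (1548800 * D\<^sup>2 * K * (m0 + 1))"
  shows "\<exists>\<Lambda>. finite \<Lambda> \<and> card \<Lambda> \<le> m0 \<and> (\<forall>r. 0 < r \<longrightarrow> r \<le> \<delta>' \<longrightarrow>
    (\<exists>u. 95 / 100 * card E * card (bohr N (\<Theta> \<union> \<Lambda>) r)
      \<le> card S * real (card {x \<in> bohr N (\<Theta> \<union> \<Lambda>) r. u + x \<in> E})))"
proof -
  \<comment> \<open>The error budget is 4/100, lowering 99/100 to 95/100: 2 l * 4 \<epsilon> = 2/100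
    comes from smoothing, and 1/100 each from 2 K 4^(-l) and from \<kappa> K with \<kappa> = 1/(100
    K).\<close>
  define \<epsilon> where "\<epsilon> = 1 / (400 * real l)"
  define V where "V = bohr N \<Theta> \<delta>"
  have \<epsilon>: "0 < \<epsilon>" "\<epsilon> \<le> 1" using l by (auto simp: \<epsilon>_def)
  have cE: "card E > 0" and cF: "card F > 0" using fin ne by (auto simp: card_gt_0_iff)
  have V0: "V \<noteq> {}" using zero_in_bohr[of \<delta> N \<Theta>] \<delta> unfolding V_def by auto
  have "4 / \<epsilon>\<^sup>2 * ln (4 * K / \<epsilon>) = 4 * (400 * real l)\<^sup>2 * ln (1600 * K * l)"
    using l by (simp add: \<epsilon>_def power_divide mult_ac)
  then have m': "m \<ge> 4 / \<epsilon>\<^sup>2 * ln (4 * K / \<epsilon>)" using m by simp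
  obtain T where T: "T \<subseteq> V" "card V \<le> 2 * K ^ m * card T"
    and per: "\<And>v t t'. t \<in> T \<Longrightarrow> t' \<in> T \<Longrightarrow>
      \<bar>cnt E F S (v + t - t') - cnt E F S v\<bar> \<le> 4 * \<epsilon> * card E * card F"
    using croot_sisask[OF fin _ ne V0 K \<epsilon> FV[folded V_def] SF m'] unfolding V_def by auto
  have cV: "card V > 0" using V0 by (simp add: card_gt_0_iff V_def)
  then have "real (card V) > 0" by simp
  then have "card T \<noteq> 0" using T(2) by (intro notI) simp
  then have T0: "T \<noteq> {}" and finTT: "finite T" by (auto intro: card_ge_0_finite)
  define \<kappa> where "\<kappa> = 1 / (100 * K)"
  have \<kappa>: "0 < \<kappa>" "\<kappa> \<le> 1" using K by (auto simp: \<kappa>_def)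
  have m0': "16 * ln (4 * (2 * K ^ m)) \<le> m0" using m0 by simp
  have "\<delta> / (1548800 * D\<^sup>2 * K * (m0 + 1)) = \<kappa> * \<delta> / (15488 * D\<^sup>2 * (m0 + 1))"
    using K by (simp add: \<kappa>_def)
  then have \<delta>'': "\<delta>' \<le> \<kappa> * \<delta> / (15488 * (2 * real (card \<Theta>) + 1)\<^sup>2 * (m0 + 1))"
    using \<delta>' by (simp only: D_def)
  obtain \<Lambda> where \<Lambda>: "finite \<Lambda>" "card \<Lambda> \<le> m0"
    and ann: "\<And>v \<theta>. v \<in> bohr N (\<Theta> \<union> \<Lambda>) \<delta>' \<Longrightarrow> cmod (avg T \<theta>) > 1 / 2 \<Longrightarrow> cmod (ee \<theta> v - 1) \<le> \<kappa>"
    using local_chang[OF N finT \<delta> reg T(1)[unfolded V_def] T0 T(2)[unfolded V_def] m0' \<kappa> \<delta>''] by blast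
  have "\<exists>u. 95 / 100 * card E * card (bohr N (\<Theta> \<union> \<Lambda>) r)
      \<le> card S * real (card {x \<in> bohr N (\<Theta> \<union> \<Lambda>) r. u + x \<in> E})" if r: "0 < r" "r \<le> \<delta>'" for r
  proof -
    define B where "B = bohr N (\<Theta> \<union> \<Lambda>) r"
    have B\<delta>': "B \<subseteq> bohr N (\<Theta> \<union> \<Lambda>) \<delta>'" unfolding B_def using r by (intro bohr_mono) auto
    have finB: "finite B" by (simp add: B_def)
    have cB: "card B > 0" unfolding B_def using r by (simp add: card_bohr_pos)
    \<comment> \<open>Converts the term sqrt (|E| |S|) of the Fourier bound into K |E|; the
      parameters l and \<kappa> are chosen to beat this K.\<close>
    have "card S \<le> K * card E"
    proof -
      obtain f where f: "f \<in> F" using ne by auto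
      have "card S \<le> card ((\<lambda>(x, y). x - y) ` (S \<times> F))"
        using f fin by (intro card_inj_on_le[of "\<lambda>s. s - f"]) (auto simp: inj_on_def)
      then show ?thesis using SF by linarith
    qed
    then have "real (card E) * card S \<le> card E * (K * card E)" by (intro mult_left_mono) auto
    also have "\<dots> \<le> (K * card E)\<^sup>2"
      using mult_right_mono[OF K, of "real (card E)"] K
      unfolding power2_eq_square by (intro mult_right_mono) auto
    finally have "sqrt (real (card E) * card S) \<le> K * card E"
      using K by (intro real_le_lsqrt) auto
    then have "card F * sqrt (real (card E) * card S) \<le> card F * (K * card E)"
      by (rule mult_left_mono) simp
    then have sq: "card F * sqrt (card E * card S) \<le> K * card E * card F" by (simp add: mult_ac)
    have small: "\<bar>cnt E F S v - cnt E F S 0\<bar> \<le> 4 / 100 * card E * card F" if v: "v \<in> B" for v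
    proof -
      have "\<bar>cnt E F S v - cnt E F S 0\<bar>
          \<le> 2 * real l * (4 * \<epsilon> * card E * card F) + (2 * (1 / 4) ^ l + \<kappa>) * (card F * sqrt (card E * card S))"
        by (rule cnt_smoothing[where T = T and B = B]) (use fin finTT finB T0 per ann B\<delta>' \<kappa> v in auto)
      also have "\<dots> \<le> 2 * real l * (4 * \<epsilon> * card E * card F) + (2 * (1 / 4) ^ l + \<kappa>) * (K * card E * card F)"
        using sq \<kappa> by (intro add_left_mono mult_left_mono) auto
      also have "\<dots> = (8 * (l * \<epsilon>) + (2 * K * (1 / 4) ^ l + \<kappa> * K)) * card E * card F"
        by (simp add: algebra_simps)
      also have "\<dots> \<le> 4 / 100 * card E * card F"
      proof (intro mult_right_mono)
        have "2 * K * (1 / 4) ^ l \<le> 1 / 100" using l(2) by (simp add: power_divide divide_le_eq)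
        moreover have "\<kappa> * K = 1 / 100" using K by (simp add: \<kappa>_def)
        moreover have "l * \<epsilon> = 1 / 400" using l by (simp add: \<epsilon>_def)
        ultimately show "8 * (l * \<epsilon>) + (2 * K * (1 / 4) ^ l + \<kappa> * K) \<le> 4 / 100" by simp
      qed auto
      finally show ?thesis .
    qed
    have "cnt E F S v \<ge> 95 / 100 * card E * card F" if "v \<in> B" for v
      using small[OF that] big unfolding mult.assoc by linarith
    then have "(\<Sum>v\<in>B. 95 / 100 * card E * card F) \<le> (\<Sum>v\<in>B. cnt E F S v)" by (rule sum_mono)
    also have "\<dots> = (\<Sum>f\<in>F. \<Sum>s\<in>S. real (card {x \<in> B. (s - f) + x \<in> E}))"
      by (rule sum_cnt) (use fin finB in \<open>auto simp: B_def\<close>)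
    finally have tot: "card B * (95 / 100 * card E * card F) \<le> (\<Sum>f\<in>F. \<Sum>s\<in>S. real (card {x \<in> B. (s - f) + x \<in> E}))"
      by simp
    show ?thesis
    proof (rule ccontr)
      assume "\<not> ?thesis"
      then have lt: "card S * real (card {x \<in> B. u + x \<in> E}) < 95 / 100 * card E * card B" for u
        unfolding B_def by (auto simp: not_le)
      have "card S * (\<Sum>f\<in>F. \<Sum>s\<in>S. real (card {x \<in> B. (s - f) + x \<in> E}))
          = (\<Sum>f\<in>F. \<Sum>s\<in>S. card S * real (card {x \<in> B. (s - f) + x \<in> E}))"
        by (simp only: sum_distrib_left)
      also have "\<dots> \<le> (\<Sum>f\<in>F. \<Sum>s\<in>S. 95 / 100 * card E * card B)"
        using lt by (intro sum_mono less_imp_le)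
      also have "\<dots> = card S * (card B * (95 / 100 * card E * card F))" by simp
      finally have le: "card S * (\<Sum>f\<in>F. \<Sum>s\<in>S. real (card {x \<in> B. (s - f) + x \<in> E}))
          \<le> card S * (card B * (95 / 100 * card E * card F))" .
      have S0: "S \<noteq> {}" using tot cB cE cF by (intro notI) (simp add: mult_le_0_iff)
      then have cS: "card S > 0" using fin by (simp add: card_gt_0_iff)
      have "card S * (\<Sum>f\<in>F. \<Sum>s\<in>S. real (card {x \<in> B. (s - f) + x \<in> E}))
          < card S * (card B * (95 / 100 * card E * card F))"
      proof -
        have "(\<Sum>f\<in>F. \<Sum>s\<in>S. card S * real (card {x \<in> B. (s - f) + x \<in> E}))
            < (\<Sum>f\<in>F. \<Sum>s\<in>S. 95 / 100 * card E * card B)"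
          using lt fin ne S0 by (intro sum_strict_mono) auto
        then show ?thesis by (simp add: sum_distrib_left mult_ac)
      qed
      then show False using tot cS by (simp add: mult_le_cancel_left_pos)
    qed
  qed
  then show ?thesis using \<Lambda> by blast
qed

section \<open>Popular sums\<close>

text \<open>Integer variables are needed because the iteration replaces A by affine preimages, which
  may contain negative numbers.\<close>

definition int_solutions :: "nat \<Rightarrow> (nat \<Rightarrow> int) \<Rightarrow> int set \<Rightarrow> (nat \<Rightarrow> int) set" where
  "int_solutions k a A = {x \<in> {..<k} \<rightarrow>\<^sub>E A. (\<Sum>i<k. a i * x i) = 0}"

text \<open>For each i the density of A on x + c_i C_i averages to at least (1 - \<eta>) \<alpha>
  over x in B', so for some x the k densities sum to at least k (1 - \<eta>) \<alpha>. As none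
  exceeds (1 + \<eta>) \<alpha>, each is at least (1 - 2 \<eta> k + \<eta>) \<alpha>, which is why
  \<eta> has order 1/k.\<close>

lemma choose_translate:
  fixes A B B' :: "int set" and C :: "nat \<Rightarrow> int set" and c :: "nat \<Rightarrow> int" and \<alpha> \<eta> :: real
  assumes fin: "finite A" "finite B'" "\<And>i. i < k \<Longrightarrow> finite (C i) \<and> C i \<noteq> {}"
    and B': "B' \<noteq> {}" "card B' \<le> (1 + \<eta>) * card B"
    and sub: "\<And>i a b. i < k \<Longrightarrow> a \<in> A \<inter> B \<Longrightarrow> b \<in> C i \<Longrightarrow> a - c i * b \<in> B'"
    and dens: "\<alpha> * card B \<le> card (A \<inter> B)" and \<alpha>: "\<alpha> > 0"
    and \<eta>: "0 < \<eta>" "\<eta> * (100 * real k) \<le> 1" and k: "k \<ge> 1"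
    and noinc: "\<And>i x. i < k \<Longrightarrow> card {b \<in> C i. x + c i * b \<in> A} \<le> (1 + \<eta>) * \<alpha> * card (C i)"
  shows "\<exists>x. \<forall>i<k. card {b \<in> C i. x + c i * b \<in> A} \<ge> 97 / 100 * \<alpha> * card (C i)"
proof -
  define f where "f i x = real (card {b \<in> C i. x + c i * b \<in> A}) / card (C i)" for i x
  have cC: "card (C i) > 0" if "i < k" for i using fin(3)[OF that] by (simp add: card_gt_0_iff)
  have f_le: "f i x \<le> (1 + \<eta>) * \<alpha>" if "i < k" for i x
    using noinc[OF that, of x] cC[OF that] by (simp add: f_def divide_le_eq)
  have avg: "(\<Sum>x\<in>B'. f i x) \<ge> (1 - \<eta>) * \<alpha> * card B'" if i: "i < k" for i
  proof -
    have finC: "finite (C i)" using fin(3)[OF i] by simp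
    have "real (card (A \<inter> B)) * card (C i) = (\<Sum>b\<in>C i. \<Sum>a\<in>A \<inter> B. 1)" by simp
    also have "\<dots> \<le> (\<Sum>b\<in>C i. \<Sum>x\<in>B'. if x + c i * b \<in> A then 1 else 0)"
    proof (rule sum_mono)
      fix b assume b: "b \<in> C i"
      have "card (A \<inter> B) \<le> card {x \<in> B'. x + c i * b \<in> A}"
        using sub[OF i _ b] fin(2) by (intro card_inj_on_le[of "\<lambda>a. a - c i * b"]) (auto simp: inj_on_def)
      then show "(\<Sum>a\<in>A \<inter> B. 1::real) \<le> (\<Sum>x\<in>B'. if x + c i * b \<in> A then 1 else 0)"
        using fin(2) by (simp add: sum.If_cases Int_def)
    qed
    also have "\<dots> = (\<Sum>x\<in>B'. \<Sum>b\<in>C i. if x + c i * b \<in> A then 1 else 0)" by (rule sum.swap)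
    also have "\<dots> = (\<Sum>x\<in>B'. real (card {b \<in> C i. x + c i * b \<in> A}))"
      using finC by (simp add: sum.If_cases Int_def)
    also have "\<dots> = (\<Sum>x\<in>B'. f i x) * card (C i)"
      using cC[OF i] by (simp add: f_def sum_divide_distrib[symmetric])
    finally have "real (card (A \<inter> B)) \<le> (\<Sum>x\<in>B'. f i x)" using cC[OF i] by simp
    moreover have "(1 - \<eta>) * \<alpha> * card B' \<le> \<alpha> * card B"
    proof -
      have "\<eta> * (100 * 1) \<le> \<eta> * (100 * real k)" using \<eta> k by (intro mult_left_mono) auto
      then have "\<eta> \<le> 1" using \<eta> by linarith
      then have "(1 - \<eta>) * card B' \<le> (1 - \<eta>) * ((1 + \<eta>) * card B)"
        using B'(2) by (intro mult_left_mono) auto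
      also have "\<dots> = (1 - \<eta>\<^sup>2) * card B" by (simp add: algebra_simps power2_eq_square)
      also have "\<dots> \<le> 1 * real (card B)" by (intro mult_right_mono) auto
      finally show ?thesis using \<alpha> by (simp add: mult.left_commute mult.assoc)
    qed
    ultimately show ?thesis using dens by linarith
  qed
  have "\<exists>x\<in>B'. (\<Sum>i<k. f i x) \<ge> k * ((1 - \<eta>) * \<alpha>)"
  proof (rule ccontr)
    assume "\<not> ?thesis"
    then have "(\<Sum>x\<in>B'. \<Sum>i<k. f i x) < (\<Sum>x\<in>B'. k * ((1 - \<eta>) * \<alpha>))"
      using fin(2) B'(1) by (intro sum_strict_mono) (auto simp: not_le)
    moreover have "(\<Sum>x\<in>B'. \<Sum>i<k. f i x) = (\<Sum>i<k. \<Sum>x\<in>B'. f i x)" by (rule sum.swap)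
    moreover have "\<dots> \<ge> (\<Sum>i<k. (1 - \<eta>) * \<alpha> * card B')" using avg by (intro sum_mono) auto
    ultimately show False by (simp add: mult_ac)
  qed
  then obtain x where x: "(\<Sum>i<k. f i x) \<ge> k * ((1 - \<eta>) * \<alpha>)" by blast
  have "card {b \<in> C i. x + c i * b \<in> A} \<ge> 97 / 100 * \<alpha> * card (C i)" if i: "i < k" for i
  proof -
    have "(\<Sum>j<k. f j x) = f i x + (\<Sum>j\<in>{..<k} - {i}. f j x)" using i by (simp add: sum.remove)
    also have "\<dots> \<le> f i x + (\<Sum>j\<in>{..<k} - {i}. (1 + \<eta>) * \<alpha>)"
      using f_le by (intro add_left_mono sum_mono) auto
    also have "(\<Sum>j\<in>{..<k} - {i}. (1 + \<eta>) * \<alpha>) = (real k - 1) * ((1 + \<eta>) * \<alpha>)"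
      using i by (simp add: of_nat_diff)
    finally have "f i x \<ge> k * ((1 - \<eta>) * \<alpha>) - (real k - 1) * ((1 + \<eta>) * \<alpha>)" using x by linarith
    also have "k * ((1 - \<eta>) * \<alpha>) - (real k - 1) * ((1 + \<eta>) * \<alpha>) = \<alpha> * (1 - 2 * (\<eta> * k) + \<eta>)"
      by (simp add: algebra_simps)
    finally have "f i x \<ge> \<alpha> * (1 - 2 * (\<eta> * k) + \<eta>)" .
    moreover have "\<alpha> * (97 / 100) \<le> \<alpha> * (1 - 2 * (\<eta> * k) + \<eta>)"
      using \<alpha> \<eta> by (intro mult_left_mono) auto
    ultimately have "f i x \<ge> 97 / 100 * \<alpha>" by linarith
    then show ?thesis using cC[OF i] by (simp add: f_def le_divide_eq)
  qed
  then show ?thesis by blast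
qed

text \<open>y stands for the sum of the variables from the fifth on, which are held fixed.\<close>

definition quads :: "int set \<Rightarrow> int set \<Rightarrow> int set \<Rightarrow> int set \<Rightarrow> int \<Rightarrow> (int \<times> int \<times> int \<times> int) set" where
  "quads E0 E1 E2 E3 y = {(e0, e1, e2, e3). e0 \<in> E0 \<and> e1 \<in> E1 \<and> e2 \<in> E2 \<and> e3 \<in> E3 \<and> e0 + e1 + e2 + e3 + y = 0}"

text \<open>The set in the first alternative is the set of popular sums of \<open>E0 + E1\<close>, that in the second
  is the negative of its complement.\<close>
lemma popular_sums_trichotomy:
  fixes E0 E1 E2 E3 B :: "int set"
  assumes fin: "finite E0" "finite E1" "finite E2" "finite E3" "finite B" and B: "B \<noteq> {}"
    and E01: "\<And>x y. x \<in> E0 \<Longrightarrow> y \<in> E1 \<Longrightarrow> x + y \<in> B"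
    and sym: "\<And>x. - x \<in> B \<longleftrightarrow> x \<in> B"
    and E23: "\<And>x z. x \<in> E2 \<Longrightarrow> z \<in> E3 \<Longrightarrow> x + z + y \<in> B"
  shows "(\<exists>S\<subseteq>B. 2 * card S \<le> card B \<and> cnt E0 E1 S 0 \<ge> 99 / 100 * card E0 * card E1) \<or>
    (\<exists>S\<subseteq>B. 2 * card S \<le> card B \<and> cnt E2 ((\<lambda>z. z + y) ` E3) S 0 \<ge> 99 / 100 * card E2 * card E3) \<or>
    real (card B) * card (quads E0 E1 E2 E3 y) \<ge> 1 / 10000 * (card E0 * card E1 * card E2 * card E3)"
proof -
  define r where "r s = (\<Sum>x\<in>E0. \<Sum>z\<in>E1. if s = x + z then 1 else (0::real))" for s
  \<comment> \<open>1/100 of the average multiplicity over B, so unpopular sums account for at most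
    1/100 of all pairs.\<close>
  define \<tau> where "\<tau> = 1 / 100 * card E0 * card E1 / card B"
  define S where "S = {s \<in> B. r s \<ge> \<tau>}"
  have cB: "card B > 0" using fin B by (simp add: card_gt_0_iff)
  have r0: "r s \<ge> 0" for s unfolding r_def by (intro sum_nonneg) auto
  have \<tau>0: "\<tau> \<ge> 0" by (simp add: \<tau>_def)
  show ?thesis
  proof (cases "2 * card S \<le> card B")
    case True
    have "(\<Sum>x\<in>E0. \<Sum>z\<in>E1. 1 - (if x + z \<in> S then 1 else 0))
        = (\<Sum>x\<in>E0. \<Sum>z\<in>E1. \<Sum>s\<in>B - S. if s = x + z then 1 else (0::real))"
      using E01 fin by (intro sum.cong refl) (auto simp: S_def)
    also have "\<dots> = (\<Sum>x\<in>E0. \<Sum>s\<in>B - S. \<Sum>z\<in>E1. if s = x + z then 1 else 0)"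
      by (rule sum.cong[OF refl], rule sum.swap)
    also have "\<dots> = (\<Sum>s\<in>B - S. r s)" unfolding r_def by (rule sum.swap)
    also have "\<dots> \<le> (\<Sum>s\<in>B - S. \<tau>)" by (rule sum_mono) (auto simp: S_def)
    also have "\<dots> \<le> (\<Sum>s\<in>B. \<tau>)" using fin \<tau>0 by (intro sum_mono2) auto
    also have "\<dots> = 1 / 100 * card E0 * card E1" using cB by (simp add: \<tau>_def)
    finally have "card E0 * card E1 - cnt E0 E1 S 0 \<le> 1 / 100 * card E0 * card E1"
      by (simp add: cnt_def sum_subtractf)
    then have "cnt E0 E1 S 0 \<ge> 99 / 100 * card E0 * card E1" by simp
    then show ?thesis using True by (intro disjI1 exI[of _ S]) (auto simp: S_def)
  next
    case False
    define S' where "S' = uminus ` (B - S)"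
    have "card S' = card (B - S)" unfolding S'_def by (rule card_image) simp
    also have "\<dots> = card B - card S" using fin by (intro card_Diff_subset) (auto simp: S_def intro: finite_subset)
    finally have S'half: "2 * card S' \<le> card B" using False by linarith
    have S'B: "S' \<subseteq> B" unfolding S'_def using sym by auto
    define F where "F = (\<lambda>z. z + y) ` E3"
    have cF: "card F = card E3" unfolding F_def by (rule card_image) (auto simp: inj_on_def)
    have finF: "finite F" using fin by (simp add: F_def)
    \<comment> \<open>Counts pairs whose negated sum is popular. If they are few, nearly all sums
      fall into S'; otherwise each of them has at least \<tau> completions to a quadruple.\<close>
    define Z where "Z = (\<Sum>x\<in>E2. \<Sum>z\<in>F. if - (x + z) \<in> S then 1 else (0::real))"
    have cntS': "cnt E2 F S' 0 = card E2 * card F - Z"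
    proof -
      have "cnt E2 F S' 0 = (\<Sum>x\<in>E2. \<Sum>z\<in>F. 1 - (if - (x + z) \<in> S then 1 else 0))"
        unfolding cnt_def
      proof (intro sum.cong refl)
        fix x z assume "x \<in> E2" "z \<in> F"
        then have "x + z \<in> B" using E23 by (auto simp: F_def add.assoc[symmetric])
        then have "- (x + z) \<in> B" using sym by blast
        then have "x + z \<in> S' \<longleftrightarrow> - (x + z) \<notin> S"
          unfolding S'_def by (metis (no_types, opaque_lifting) DiffD2 DiffI add.inverse_inverse image_iff)
        then show "(if x + z + 0 \<in> S' then 1 else 0) = 1 - (if - (x + z) \<in> S then 1 else (0::real))" by simp
      qed
      then show ?thesis by (simp add: sum_subtractf Z_def)
    qed
    show ?thesis
    proof (cases "Z \<le> 1 / 100 * card E2 * card E3")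
      case True
      then have "cnt E2 F S' 0 \<ge> 99 / 100 * card E2 * card E3" unfolding cntS' cF by simp
      then show ?thesis using S'B S'half unfolding F_def by blast
    next
      case False
      let ?Q = "quads E0 E1 E2 E3 y"
      have Q: "?Q = (SIGMA e0:E0. SIGMA e1:E1. SIGMA e2:E2. {e3 \<in> E3. e0 + e1 + e2 + e3 + y = 0})"
        by (auto simp: quads_def)
      have "real (card ?Q) = (\<Sum>x\<in>E0. \<Sum>w\<in>E1. \<Sum>e\<in>E2. real (card {e3 \<in> E3. x + w + e + e3 + y = 0}))"
        unfolding Q using fin by (simp add: card_SigmaI)
      also have "\<dots> = (\<Sum>x\<in>E0. \<Sum>w\<in>E1. \<Sum>e\<in>E2. \<Sum>z\<in>E3. if - (e + (z + y)) = x + w then 1 else 0)"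
      proof (intro sum.cong refl)
        fix x w e
        have "{e3 \<in> E3. x + w + e + e3 + y = 0} = {e3 \<in> E3. - (e + (e3 + y)) = x + w}" by auto
        then show "real (card {e3 \<in> E3. x + w + e + e3 + y = 0}) = (\<Sum>z\<in>E3. if - (e + (z + y)) = x + w then 1 else 0)"
          using fin by (simp add: sum.If_cases Int_def)
      qed
      also have "\<dots> = (\<Sum>x\<in>E0. \<Sum>e\<in>E2. \<Sum>z\<in>E3. \<Sum>w\<in>E1. if - (e + (z + y)) = x + w then 1 else 0)"
      proof (rule sum.cong[OF refl])
        fix x
        have "(\<Sum>w\<in>E1. \<Sum>e\<in>E2. \<Sum>z\<in>E3. if - (e + (z + y)) = x + w then 1 else (0::real))
            = (\<Sum>e\<in>E2. \<Sum>w\<in>E1. \<Sum>z\<in>E3. if - (e + (z + y)) = x + w then 1 else 0)" by (rule sum.swap)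
        also have "\<dots> = (\<Sum>e\<in>E2. \<Sum>z\<in>E3. \<Sum>w\<in>E1. if - (e + (z + y)) = x + w then 1 else 0)"
          by (rule sum.cong[OF refl], rule sum.swap)
        finally show "(\<Sum>w\<in>E1. \<Sum>e\<in>E2. \<Sum>z\<in>E3. if - (e + (z + y)) = x + w then 1 else (0::real))
            = (\<Sum>e\<in>E2. \<Sum>z\<in>E3. \<Sum>w\<in>E1. if - (e + (z + y)) = x + w then 1 else 0)" .
      qed
      also have "\<dots> = (\<Sum>e\<in>E2. \<Sum>x\<in>E0. \<Sum>z\<in>E3. \<Sum>w\<in>E1. if - (e + (z + y)) = x + w then 1 else 0)"
        by (rule sum.swap)
      also have "\<dots> = (\<Sum>e\<in>E2. \<Sum>z\<in>E3. r (- (e + (z + y))))"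
        unfolding r_def by (rule sum.cong[OF refl], rule sum.swap)
      also have "\<dots> = (\<Sum>e\<in>E2. \<Sum>z\<in>F. r (- (e + z)))"
      proof -
        have "inj_on (\<lambda>z. z + y) E3" by (auto simp: inj_on_def)
        then show ?thesis unfolding F_def by (simp only: sum.reindex o_def)
      qed
      also have "\<dots> \<ge> (\<Sum>e\<in>E2. \<Sum>z\<in>F. \<tau> * (if - (e + z) \<in> S then 1 else 0))"
        using r0 by (intro sum_mono) (auto simp: S_def)
      also have "(\<Sum>e\<in>E2. \<Sum>z\<in>F. \<tau> * (if - (e + z) \<in> S then 1 else 0)) = \<tau> * Z"
        unfolding Z_def by (simp only: sum_distrib_left)
      finally have "\<tau> * Z \<le> card ?Q" .
      moreover have "\<tau> * (1 / 100 * card E2 * card E3) \<le> \<tau> * Z"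
        using False \<tau>0 by (intro mult_left_mono) auto
      ultimately have "\<tau> * (1 / 100 * card E2 * card E3) \<le> card ?Q" by linarith
      then have "card B * (\<tau> * (1 / 100 * card E2 * card E3)) \<le> real (card B) * card ?Q"
        by (intro mult_left_mono) auto
      moreover have "card B * (\<tau> * (1 / 100 * card E2 * card E3)) = 1 / 10000 * (card E0 * card E1 * card E2 * card E3)"
        using cB by (simp add: \<tau>_def)
      ultimately show ?thesis by (intro disjI2) linarith
    qed
  qed
qed

text \<open>Under x_i = x + c_i b_i the left-hand side of the equation becomes P times the sum of
  the b_i, since the a_i sum to 0 and every a_i c_i equals P. Nonzero c_i make the substitution
  injective.\<close>

lemma card_int_solutions_ge_sum_quads:
  fixes c :: "nat \<Rightarrow> int" and E :: "nat \<Rightarrow> int set" and P x :: int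
  assumes k: "k \<ge> 4" and inv: "(\<Sum>i<k. a i) = 0"
    and c: "\<And>i. i < k \<Longrightarrow> a i * c i = P" "\<And>i. i < k \<Longrightarrow> c i \<noteq> 0"
    and E: "\<And>i e. i < k \<Longrightarrow> e \<in> E i \<Longrightarrow> x + c i * e \<in> A" "\<And>i. i < k \<Longrightarrow> finite (E i)"
    and A: "finite A"
  shows "(\<Sum>g\<in>PiE {4..<k} E. card (quads (E 0) (E 1) (E 2) (E 3) (\<Sum>i\<in>{4..<k}. g i))) \<le> card (int_solutions k a A)"
proof -
  let ?Q = "\<lambda>g. quads (E 0) (E 1) (E 2) (E 3) (\<Sum>i\<in>{4..<k}. g i)"
  let ?X = "SIGMA g:PiE {4..<k} E. ?Q g"
  define b :: "(nat \<Rightarrow> int) \<times> int \<times> int \<times> int \<times> int \<Rightarrow> nat \<Rightarrow> int" where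
    "b = (\<lambda>(g, e0, e1, e2, e3) i. if i = 0 then e0 else if i = 1 then e1 else if i = 2 then e2
      else if i = 3 then e3 else g i)"
  define \<Psi> where "\<Psi> p = (\<lambda>i\<in>{..<k}. x + c i * b p i)" for p
  have finP: "finite (PiE {4..<k} E)" using E(2) by (intro finite_PiE) auto
  have fQ: "finite (?Q g)" for g
  proof (rule finite_subset)
    show "?Q g \<subseteq> E 0 \<times> E 1 \<times> E 2 \<times> E 3" by (auto simp: quads_def)
    show "finite (E 0 \<times> E 1 \<times> E 2 \<times> E 3)" using E(2) k by (intro finite_cartesian_product) auto
  qed
  have finI: "finite (int_solutions k a A)"
  proof (rule finite_subset)
    show "int_solutions k a A \<subseteq> {..<k} \<rightarrow>\<^sub>E A" by (auto simp: int_solutions_def)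
    show "finite ({..<k} \<rightarrow>\<^sub>E A)" using A by (intro finite_PiE) auto
  qed
  have "card ?X \<le> card (int_solutions k a A)"
  proof (rule card_inj_on_le[OF _ _ finI])
    show "inj_on \<Psi> ?X"
    proof (rule inj_onI)
      fix p p' assume p: "p \<in> ?X" "p' \<in> ?X" and eq: "\<Psi> p = \<Psi> p'"
      have beq: "b p i = b p' i" if "i < k" for i
      proof -
        have "x + c i * b p i = x + c i * b p' i" using fun_cong[OF eq, of i] that by (simp add: \<Psi>_def)
        then show ?thesis using c(2)[OF that] by simp
      qed
      obtain g e0 e1 e2 e3 where pe: "p = (g, e0, e1, e2, e3)" by (metis surj_pair)
      obtain g' e0' e1' e2' e3' where pe': "p' = (g', e0', e1', e2', e3')" by (metis surj_pair)
      have "e0 = e0'" "e1 = e1'" "e2 = e2'" "e3 = e3'"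
        using beq[of 0] beq[of 1] beq[of 2] beq[of 3] k unfolding pe pe' by (simp_all add: b_def)
      moreover have "g = g'"
      proof (rule PiE_ext)
        show "g \<in> PiE {4..<k} E" "g' \<in> PiE {4..<k} E" using p unfolding pe pe' by simp_all
        show "g i = g' i" if "i \<in> {4..<k}" for i
          using beq[of i] that unfolding pe pe' by (simp add: b_def)
      qed
      ultimately show "p = p'" by (simp add: pe pe')
    qed
    show "\<Psi> ` ?X \<subseteq> int_solutions k a A"
    proof
      fix z assume "z \<in> \<Psi> ` ?X"
      then obtain p where p: "p \<in> ?X" "z = \<Psi> p" by blast
      obtain g e0 e1 e2 e3 where pe: "p = (g, e0, e1, e2, e3)" by (metis surj_pair)
      have g: "g \<in> PiE {4..<k} E" and q: "(e0, e1, e2, e3) \<in> ?Q g" using p(1) unfolding pe by simp_all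
      have bE: "b p i \<in> E i" if "i < k" for i
      proof (cases "i < 4")
        case True
        then consider "i = 0" | "i = 1" | "i = 2" | "i = 3" by linarith
        then show ?thesis using q unfolding pe by cases (simp_all add: b_def quads_def)
      next
        case False
        then show ?thesis using PiE_mem[OF g, of i] that unfolding pe by (simp add: b_def)
      qed
      have "z \<in> {..<k} \<rightarrow>\<^sub>E A"
        unfolding p(2) \<Psi>_def restrict_PiE_iff using E(1) bE by blast
      moreover have "(\<Sum>i<k. a i * z i) = 0"
      proof -
        have "(\<Sum>i<k. a i * z i) = (\<Sum>i<k. a i * x + P * b p i)"
        proof (rule sum.cong[OF refl])
          fix i assume "i \<in> {..<k}"
          then have "z i = x + c i * b p i" "a i * c i = P" using c(1) by (simp_all add: p(2) \<Psi>_def)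
          then show "a i * z i = a i * x + P * b p i"
            by (simp add: distrib_left mult.assoc[symmetric])
        qed
        also have "\<dots> = (\<Sum>i<k. a i) * x + P * (\<Sum>i<k. b p i)"
          by (simp add: sum.distrib sum_distrib_left sum_distrib_right)
        also have "(\<Sum>i<k. b p i) = (\<Sum>i<4. b p i) + (\<Sum>i\<in>{4..<k}. b p i)"
          using k by (simp add: lessThan_atLeast0 sum.atLeastLessThan_concat)
        also have "(\<Sum>i<4. b p i) = e0 + e1 + e2 + e3"
          unfolding pe by (simp add: b_def eval_nat_numeral)
        also have "(\<Sum>i\<in>{4..<k}. b p i) = (\<Sum>i\<in>{4..<k}. g i)"
          unfolding pe by (rule sum.cong[OF refl]) (simp add: b_def)
        finally show ?thesis using q inv by (simp add: quads_def)
      qed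
      ultimately show "z \<in> int_solutions k a A" by (simp add: int_solutions_def)
    qed
  qed
  moreover have "card ?X = (\<Sum>g\<in>PiE {4..<k} E. card (?Q g))"
    using finP fQ by (intro card_SigmaI) auto
  ultimately show ?thesis by simp
qed

section \<open>The density increment step\<close>

text \<open>l is the number of smoothing rounds, m the sample size for accuracy 1/(400 l), and m0
  the spectral bound for a set of relative density 1/(2 K^m). With K held fixed they serve every
  step of the iteration.\<close>

definition sampling_params :: "real \<Rightarrow> nat \<Rightarrow> nat \<Rightarrow> nat \<Rightarrow> bool" where
  "sampling_params K l m m0 \<longleftrightarrow> l \<ge> 1 \<and> 200 * K \<le> 4 ^ l \<and>
    real m \<ge> 4 * (400 * real l)\<^sup>2 * ln (1600 * K * l) \<and> real m0 \<ge> 16 * ln (8 * K ^ m)"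

text \<open>S has at most 505/1000 of the size of the Bohr set of radius \<delta>1, where E has
  density at least 97/100 \<alpha>; so the gain is at least 95/100 * 97/100 / (505/1000) > 18/10, of
  which only 1 + \<eta> is recorded. The radii keep S - F - y and F plus the almost periods within
  regularity margins, which yields the doubling constant K.\<close>

lemma half_set_increment:
  fixes \<Theta> :: "real set" and \<alpha> \<alpha>0 \<eta> \<delta>1 \<delta>2 \<delta>3 h w K D \<delta>' :: real and l m m0 :: nat
  defines "D \<equiv> 2 * real (card \<Theta>) + 1"
  assumes N: "N \<ge> 1" and finT: "finite \<Theta>" and \<eta>: "0 < \<eta>" "\<eta> \<le> 1 / 100"
    and \<delta>: "0 < \<delta>1" "0 < \<delta>2" "0 < \<delta>3" "\<delta>3 \<le> 2"
    and reg: "bohr_reg N \<Theta> \<eta> \<delta>1" "bohr_reg N \<Theta> \<eta> \<delta>2" "bohr_reg N \<Theta> 1 \<delta>3"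
    and \<delta>32: "\<delta>3 \<le> \<eta> * \<delta>2 / (22 * D)" and h: "0 \<le> h" "0 \<le> w" "h + (w + \<delta>2) \<le> \<eta> * \<delta>1 / (22 * D)"
    and \<alpha>: "0 < \<alpha>0" "\<alpha>0 \<le> \<alpha>" "\<alpha> \<le> 1" and K: "K = 3 / \<alpha>0"
    and E: "E \<subseteq> bohr N \<Theta> \<delta>1" "card E \<ge> 97 / 100 * \<alpha> * card (bohr N \<Theta> \<delta>1)"
    and F: "F \<subseteq> bohr N \<Theta> \<delta>2" "card F \<ge> 97 / 100 * \<alpha> * card (bohr N \<Theta> \<delta>2)"
    and y: "y \<in> bohr N \<Theta> w"
    and S: "S \<subseteq> bohr N \<Theta> (\<delta>1 + h)" "2 * card S \<le> card (bohr N \<Theta> (\<delta>1 + h))"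
    and big: "cnt E ((\<lambda>z. z + y) ` F) S 0 \<ge> 99 / 100 * card E * card F"
    and params: "sampling_params K l m m0"
    and \<delta>': "0 < \<delta>'" "\<delta>' \<le> \<delta>3 / (1548800 * D\<^sup>2 * K * (m0 + 1))"
  shows "\<exists>\<Lambda>. finite \<Lambda> \<and> card \<Lambda> \<le> m0 \<and> (\<forall>r. 0 < r \<longrightarrow> r \<le> \<delta>' \<longrightarrow>
    (\<exists>u. (1 + \<eta>) * \<alpha> * card (bohr N (\<Theta> \<union> \<Lambda>) r) \<le> real (card {x \<in> bohr N (\<Theta> \<union> \<Lambda>) r. u + x \<in> E})))"
proof -
  let ?B1 = "bohr N \<Theta> \<delta>1" and ?B2 = "bohr N \<Theta> \<delta>2"
  let ?B1' = "bohr N \<Theta> (\<delta>1 + \<eta> * \<delta>1 / (22 * D))" and ?B2' = "bohr N \<Theta> (\<delta>2 + \<eta> * \<delta>2 / (22 * D))"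
  define F' where "F' = (\<lambda>z. z + y) ` F"
  have D: "D \<ge> 1" by (simp add: D_def)
  have \<alpha>p: "\<alpha> > 0" using \<alpha> by linarith
  have r1: "card ?B1' \<le> (1 + \<eta>) * card ?B1" and r2: "card ?B2' \<le> (1 + \<eta>) * card ?B2"
    using reg unfolding bohr_reg_def D_def by simp_all
  have b1: "card ?B1 > 0" and b2: "card ?B2 > 0" using \<delta> by (auto simp: card_bohr_pos)
  have fin: "finite E" "finite F" "finite S" using E F S finite_subset finite_bohr by blast+
  have cF': "card F' = card F" unfolding F'_def by (rule card_image) (auto simp: inj_on_def)
  have finF': "finite F'" using fin by (simp add: F'_def)
  have "0 < 97 / 100 * \<alpha> * card ?B1" "0 < 97 / 100 * \<alpha> * card ?B2" using \<alpha>p b1 b2 by auto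
  then have cE: "card E > 0" and cF: "card F > 0" using E(2) F(2) by linarith+
  have ne: "E \<noteq> {}" "F' \<noteq> {}" using cE cF unfolding F'_def by auto
  have K1: "K \<ge> 1" using \<alpha> unfolding K by (simp add: le_divide_eq)
  \<comment> \<open>2 / (97/100) \<le> 3 turns the lower bound on a density into the constant K =
    3/\<alpha>0.\<close>
  have bound: "2 * x \<le> K * z" if "97 / 100 * \<alpha> * x \<le> z" "0 \<le> x" for x z :: real
  proof -
    have "3 * (\<alpha>0 * (97 / 100 * x)) \<le> 3 * z"
    proof -
      have "\<alpha>0 * (97 / 100 * x) \<le> \<alpha> * (97 / 100 * x)" using \<alpha> that(2) by (intro mult_right_mono) auto
      then show ?thesis using that(1) by (simp add: mult_ac)
    qed
    then have "(2 * x) * \<alpha>0 \<le> 3 * z"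
    proof -
      have "(2 * x) * \<alpha>0 \<le> 3 * (\<alpha>0 * (97 / 100 * x))" using \<alpha>(1) that(2) by simp
      then show ?thesis using \<open>3 * (\<alpha>0 * (97 / 100 * x)) \<le> 3 * z\<close> by linarith
    qed
    then show ?thesis using \<alpha>(1) unfolding K by (simp add: le_divide_eq)
  qed
  have "(\<lambda>(x, z). x + z) ` (F' \<times> bohr N \<Theta> \<delta>3) \<subseteq> (\<lambda>z. z + y) ` ?B2'"
  proof
    fix v assume "v \<in> (\<lambda>(x, z). x + z) ` (F' \<times> bohr N \<Theta> \<delta>3)"
    then obtain f z where fz: "f \<in> F" "z \<in> bohr N \<Theta> \<delta>3" "v = f + y + z" by (auto simp: F'_def)
    have "f + z \<in> bohr N \<Theta> (\<delta>2 + \<delta>3)" using fz F by (intro bohr_add) auto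
    then have "f + z \<in> ?B2'" using bohr_mono[of "\<delta>2 + \<delta>3" _ \<Theta> \<Theta> N] \<delta>32 by (auto simp: subset_iff)
    then show "v \<in> (\<lambda>z. z + y) ` ?B2'" using fz(3) by (intro image_eqI[of _ _ "f + z"]) auto
  qed
  then have "card ((\<lambda>(x, z). x + z) ` (F' \<times> bohr N \<Theta> \<delta>3)) \<le> card ?B2'"
    by (meson card_image_le card_mono finite_bohr finite_imageI le_trans)
  then have "real (card ((\<lambda>(x, z). x + z) ` (F' \<times> bohr N \<Theta> \<delta>3))) \<le> (1 + \<eta>) * card ?B2" using r2 by linarith
  also have "\<dots> \<le> 2 * real (card ?B2)" using \<eta> by (intro mult_right_mono) auto
  also have "\<dots> \<le> K * card F'" unfolding cF' by (rule bound[OF F(2)]) simp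
  finally have FV: "card ((\<lambda>(x, z). x + z) ` (F' \<times> bohr N \<Theta> \<delta>3)) \<le> K * card F'" .
  have "(\<lambda>(x, z). x - z) ` (S \<times> F') \<subseteq> ?B1'"
  proof
    fix v assume "v \<in> (\<lambda>(x, z). x - z) ` (S \<times> F')"
    then obtain s f where sf: "s \<in> S" "f \<in> F" "v = s - (y + f)" by (auto simp: F'_def)
    have "y + f \<in> bohr N \<Theta> (w + \<delta>2)" using sf F y by (intro bohr_add) auto
    then have "v \<in> bohr N \<Theta> ((\<delta>1 + h) + (w + \<delta>2))" unfolding sf(3) using sf S by (intro bohr_diff) auto
    then show "v \<in> ?B1'" using bohr_mono[of "(\<delta>1 + h) + (w + \<delta>2)" _ \<Theta> \<Theta> N] h(3) by (auto simp: subset_iff)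
  qed
  then have "card ((\<lambda>(x, z). x - z) ` (S \<times> F')) \<le> card ?B1'" by (intro card_mono) auto
  then have "real (card ((\<lambda>(x, z). x - z) ` (S \<times> F'))) \<le> (1 + \<eta>) * card ?B1" using r1 by linarith
  also have "\<dots> \<le> 2 * real (card ?B1)" using \<eta> by (intro mult_right_mono) auto
  also have "\<dots> \<le> K * card E" by (rule bound[OF E(2)]) simp
  finally have SF: "card ((\<lambda>(x, z). x - z) ` (S \<times> F')) \<le> K * card E" .
  have big': "cnt E F' S 0 \<ge> 99 / 100 * card E * card F'" using big unfolding F'_def[symmetric] cF'[symmetric] .
  have params': "l \<ge> 1" "200 * K \<le> 4 ^ l" "real m \<ge> 4 * (400 * real l)\<^sup>2 * ln (1600 * K * l)"
    "real m0 \<ge> 16 * ln (8 * K ^ m)" using params by (auto simp: sampling_params_def)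
  obtain \<Lambda> where \<Lambda>: "finite \<Lambda>" "card \<Lambda> \<le> m0" and
    inc: "\<And>r. 0 < r \<Longrightarrow> r \<le> \<delta>' \<Longrightarrow> \<exists>u. 95 / 100 * card E * card (bohr N (\<Theta> \<union> \<Lambda>) r)
      \<le> card S * real (card {x \<in> bohr N (\<Theta> \<union> \<Lambda>) r. u + x \<in> E})"
    using bohr_density_increment[OF N finT \<delta>(3,4) reg(3) fin(1) finF' fin(3) ne K1 FV SF big'
        params' \<delta>'(1) \<delta>'(2)[unfolded D_def]] by blast
  have "\<exists>u. (1 + \<eta>) * \<alpha> * card (bohr N (\<Theta> \<union> \<Lambda>) r) \<le> real (card {x \<in> bohr N (\<Theta> \<union> \<Lambda>) r. u + x \<in> E})"
    if r: "0 < r" "r \<le> \<delta>'" for r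
  proof -
    let ?B = "bohr N (\<Theta> \<union> \<Lambda>) r"
    obtain u where u: "95 / 100 * card E * card ?B \<le> card S * real (card {x \<in> ?B. u + x \<in> E})"
      using inc[OF r] by blast
    let ?X = "real (card {x \<in> ?B. u + x \<in> E})"
    have "card (bohr N \<Theta> (\<delta>1 + h)) \<le> card ?B1'"
      using h \<delta> by (intro card_mono bohr_mono) auto
    then have "2 * real (card S) \<le> (1 + \<eta>) * card ?B1" using S(2) r1 by linarith
    also have "\<dots> \<le> 101 / 100 * card ?B1" using \<eta> by (intro mult_right_mono) auto
    finally have "real (card S) \<le> 505 / 1000 * card ?B1" by simp
    then have "card S * ?X \<le> 505 / 1000 * card ?B1 * ?X" by (intro mult_right_mono) auto
    moreover have "95 / 100 * (97 / 100 * \<alpha> * card ?B1) * card ?B \<le> 95 / 100 * card E * card ?B"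
      using E(2) by (intro mult_right_mono mult_left_mono) auto
    ultimately have "(95 / 100 * (97 / 100 * \<alpha>) * card ?B) * card ?B1 \<le> (505 / 1000 * ?X) * card ?B1"
      using u by (simp add: mult_ac)
    then have "95 / 100 * (97 / 100 * \<alpha>) * card ?B \<le> 505 / 1000 * ?X"
      using b1 by (simp only: mult_le_cancel_right)
    moreover have "(1 + \<eta>) * (\<alpha> * card ?B) \<le> 101 / 100 * (\<alpha> * card ?B)"
      using \<eta> \<alpha>p by (intro mult_right_mono) auto
    moreover have "0 \<le> \<alpha> * card ?B" using \<alpha>p by simp
    ultimately have "(1 + \<eta>) * \<alpha> * card ?B \<le> ?X" unfolding mult.assoc by linarith
    then show ?thesis by blast
  qed
  then show ?thesis using \<Lambda> by blast
qed

text \<open>Pure arithmetic: (8/10) / 10000 / (101/100) exceeds 1/20^4. One factor b1 cancels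
  against b, the other is weakened to b2.\<close>

lemma quads_lower:
  fixes \<alpha> b1 b2 b q e0 e1 e2 e3 :: real
  assumes \<alpha>: "\<alpha> > 0" and b: "0 < b2" "b2 \<le> b1" "0 \<le> b" "b \<le> 101 / 100 * b1" "0 \<le> q"
    and e: "97 / 100 * \<alpha> * b1 \<le> e0" "97 / 100 * \<alpha> * b2 \<le> e1" "97 / 100 * \<alpha> * b1 \<le> e2" "97 / 100 * \<alpha> * b2 \<le> e3"
    and q: "1 / 10000 * (e0 * e1 * e2 * e3) \<le> b * q"
  shows "(\<alpha> / 20) ^ 4 * b2 ^ 3 \<le> q"
proof -
  define t where "t = 97 / 100 * \<alpha>"
  have t: "t > 0" using \<alpha> by (simp add: t_def)
  have b1: "b1 > 0" using b by linarith
  have e2: "t * b2 \<le> e2" using e(3) b t unfolding t_def[symmetric] by (meson mult_left_mono order_trans less_imp_le)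
  have pos: "0 \<le> t * b1" "0 \<le> t * b2" using t b b1 by auto
  have nn: "0 \<le> e0" "0 \<le> e1" "0 \<le> e2" "0 \<le> e3" using e pos unfolding t_def[symmetric] by linarith+
  have "(t * b1) * (t * b2) * (t * b2) * (t * b2) \<le> e0 * e1 * e2 * e3"
    using e e2 pos nn unfolding t_def[symmetric] using t b b1 by (intro mult_mono mult_nonneg_nonneg) (auto intro: less_imp_le)
  then have "1 / 10000 * ((t * b1) * (t * b2) * (t * b2) * (t * b2)) \<le> b * q" using q by linarith
  also have "\<dots> \<le> 101 / 100 * b1 * q" using b by (intro mult_right_mono) auto
  finally have "(1 / 10000 * (t ^ 4 * b2 ^ 3)) * b1 \<le> (101 / 100 * q) * b1"
    by (simp add: power2_eq_square power3_eq_cube power4_eq_xxxx mult_ac)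
  then have main: "1 / 10000 * (t ^ 4 * b2 ^ 3) \<le> 101 / 100 * q" using b1 by simp
  have W: "0 \<le> \<alpha> ^ 4 * b2 ^ 3" using \<alpha> b by simp
  have "8 / 10 * (\<alpha> ^ 4 * b2 ^ 3) \<le> (97 / 100) ^ 4 * (\<alpha> ^ 4 * b2 ^ 3)"
    using W by (intro mult_right_mono) (simp_all add: power4_eq_xxxx)
  also have "\<dots> = t ^ 4 * b2 ^ 3" by (simp only: t_def power_mult_distrib mult.assoc)
  finally have X: "8 / 10 * (\<alpha> ^ 4 * b2 ^ 3) \<le> t ^ 4 * b2 ^ 3" .
  have Y: "(\<alpha> / 20) ^ 4 * b2 ^ 3 = (\<alpha> ^ 4 * b2 ^ 3) / 160000" by (simp add: power_divide)
  have "y \<le> q" if "8 / 10 * w \<le> x" "y = w / 160000" "0 \<le> w" "1 / 10000 * x \<le> 101 / 100 * q" for w x y :: real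
    using that by linarith
  from this[OF X Y W main] show ?thesis .
qed

text \<open>Three nested radii carry the step: at \<delta>1 the dilates by the c_i, of size at most
  Q, fit into the margin at \<delta>; at \<delta>2 sums of k elements fit into half the margin at
  \<delta>1; at \<delta>3 almost periods fit into the margin at \<delta>2. \<open>low\<close> is a
  lower bound for every radius that can result.\<close>

theorem density_step:
  fixes \<Theta> :: "real set" and \<alpha> \<alpha>0 \<eta> \<delta> K D Q low :: real and l m m0 k :: nat and a :: "nat \<Rightarrow> int"
  defines "D \<equiv> 2 * real (card \<Theta>) + 1" and "\<eta> \<equiv> 1 / (100 * real k)"
  defines "low \<equiv> \<delta> / (10 ^ 18 * real k ^ 4 * Q * D ^ 5 * K * (real m0 + 1))"
  assumes k: "k \<ge> 4" and a: "\<And>i. i < k \<Longrightarrow> a i \<noteq> 0" and inv: "(\<Sum>i<k. a i) = 0"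
    and Q: "Q \<ge> 1" "\<And>i. i < k \<Longrightarrow> \<bar>real_of_int (\<Prod>j\<in>{..<k} - {i}. a j)\<bar> \<le> Q"
    and N: "N \<ge> 1" and finT: "finite \<Theta>" and \<delta>: "0 < \<delta>" "\<delta> \<le> 2" and reg: "bohr_reg N \<Theta> \<eta> \<delta>"
    and A: "finite A" and \<alpha>: "0 < \<alpha>0" "\<alpha>0 \<le> \<alpha>" "\<alpha> \<le> 1" and K: "K = 3 / \<alpha>0"
    and dens: "\<alpha> * card (bohr N \<Theta> \<delta>) \<le> card (A \<inter> bohr N \<Theta> \<delta>)"
    and params: "sampling_params K l m m0"
  shows "card (int_solutions k a A) \<ge> (\<alpha> / 20) ^ k * card (bohr N \<Theta> low) ^ (k - 1) \<or>
    (\<exists>c u \<Lambda> r. c \<noteq> 0 \<and> finite \<Lambda> \<and> card \<Lambda> \<le> m0 \<and> low \<le> r \<and> r \<le> 2 \<and> bohr_reg N (\<Theta> \<union> \<Lambda>) \<eta> r \<and>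
      (1 + \<eta>) * \<alpha> * card (bohr N (\<Theta> \<union> \<Lambda>) r) \<le> card ({z. u + c * z \<in> A} \<inter> bohr N (\<Theta> \<union> \<Lambda>) r))"
    (is "?many \<or> ?inc")
proof (rule disjCI)
  assume noinc: "\<not> ?inc"
  \<comment> \<open>The relative width of the regularity margin.\<close>
  define c where "c = \<eta> / (22 * D)"
  define cf where "cf i = (\<Prod>j\<in>{..<k} - {i}. a j)" for i
  have D: "D \<ge> 1" by (simp add: D_def)
  have k1: "real k \<ge> 4" using k by simp
  have \<eta>: "0 < \<eta>" "\<eta> \<le> 1 / 100" "\<eta> \<le> 1" using k1 by (auto simp: \<eta>_def field_simps)
  have \<eta>k: "\<eta> * (100 * real k) \<le> 1" using k1 by (simp add: \<eta>_def)
  have c: "0 < c" "c \<le> 1"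
  proof -
    show "0 < c" using \<eta> D by (simp add: c_def)
    have "\<eta> \<le> 22 * D" using \<eta> D by linarith
    then show "c \<le> 1" using D by (simp add: c_def divide_le_eq)
  qed
  have c_eq: "c = 1 / (2200 * k * D)" by (simp add: c_def \<eta>_def)
  have \<alpha>p: "\<alpha> > 0" using \<alpha> by linarith
  have K1: "K \<ge> 1" using \<alpha> unfolding K by (simp add: le_divide_eq)
  have "c * \<delta> / Q > 0" using c \<delta> Q by simp
  then obtain \<delta>1 where \<delta>1: "c * \<delta> / Q / 2 \<le> \<delta>1" "\<delta>1 \<le> c * \<delta> / Q" "bohr_reg N \<Theta> \<eta> \<delta>1"
    using exists_bohr_reg[OF finT _ N \<eta>(1,3)] by metis
  have \<delta>1p: "\<delta>1 > 0" by (rule less_le_trans[OF half_gt_zero[OF \<open>c * \<delta> / Q > 0\<close>] \<delta>1(1)])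
  have "c * \<delta>1 / (2 * k) > 0" using c \<delta>1p k1 by simp
  then obtain \<delta>2 where \<delta>2: "c * \<delta>1 / (2 * k) / 2 \<le> \<delta>2" "\<delta>2 \<le> c * \<delta>1 / (2 * k)" "bohr_reg N \<Theta> \<eta> \<delta>2"
    using exists_bohr_reg[OF finT _ N \<eta>(1,3)] by metis
  have \<delta>2p: "\<delta>2 > 0" by (rule less_le_trans[OF half_gt_zero[OF \<open>c * \<delta>1 / (2 * k) > 0\<close>] \<delta>2(1)])
  have "c * \<delta>2 > 0" using c \<delta>2p by simp
  then obtain \<delta>3 where \<delta>3: "c * \<delta>2 / 2 \<le> \<delta>3" "\<delta>3 \<le> c * \<delta>2" "bohr_reg N \<Theta> 1 \<delta>3"
    using exists_bohr_reg[OF finT _ N, of "c * \<delta>2" 1] by auto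
  have \<delta>3p: "\<delta>3 > 0" by (rule less_le_trans[OF half_gt_zero[OF \<open>c * \<delta>2 > 0\<close>] \<delta>3(1)])
  have Q\<delta>1: "Q * \<delta>1 \<le> c * \<delta>" using \<delta>1(2) Q by (simp add: field_simps)
  have \<delta>1\<delta>: "\<delta>1 \<le> \<delta>"
  proof -
    have "1 * \<delta>1 \<le> Q * \<delta>1" using Q \<delta>1p by (intro mult_right_mono) auto
    moreover have "c * \<delta> \<le> 1 * \<delta>" using c \<delta> by (intro mult_right_mono) auto
    ultimately show ?thesis using Q\<delta>1 by linarith
  qed
  have k\<delta>2: "k * \<delta>2 \<le> c * \<delta>1 / 2" using \<delta>2(2) k1 by (simp add: field_simps)
  have \<delta>2\<delta>1: "\<delta>2 \<le> \<delta>1"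
  proof -
    have "1 * \<delta>2 \<le> k * \<delta>2" using k1 \<delta>2p by (intro mult_right_mono) auto
    moreover have "c * \<delta>1 \<le> 1 * \<delta>1" using c \<delta>1p by (intro mult_right_mono) auto
    ultimately show ?thesis using k\<delta>2 \<delta>1p by linarith
  qed
  have \<delta>3\<delta>2: "\<delta>3 \<le> \<delta>2"
  proof -
    have "c * \<delta>2 \<le> 1 * \<delta>2" using c \<delta>2p by (intro mult_right_mono) auto
    then show ?thesis using \<delta>3(2) by linarith
  qed
  define \<delta>' where "\<delta>' = \<delta>3 / (1548800 * D\<^sup>2 * K * (m0 + 1))"
  have den: "0 < 1548800 * D\<^sup>2 * K * (m0 + 1)" "1 \<le> 1548800 * D\<^sup>2 * K * (m0 + 1)"
  proof -
    have "1 \<le> D\<^sup>2" using D by (simp add: one_le_power)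
    then have "1 * 1 * 1 \<le> (1548800 * D\<^sup>2) * K * (real m0 + 1)" using K1 by (intro mult_mono) auto
    then show "1 \<le> 1548800 * D\<^sup>2 * K * (m0 + 1)" by (simp add: mult.assoc add.commute)
    then show "0 < 1548800 * D\<^sup>2 * K * (m0 + 1)" by linarith
  qed
  have \<delta>'p: "\<delta>' > 0" unfolding \<delta>'_def using \<delta>3p den by simp
  have \<delta>'\<delta>3: "\<delta>' \<le> \<delta>3"
  proof -
    have "\<delta>3 * 1 \<le> \<delta>3 * (1548800 * D\<^sup>2 * K * (m0 + 1))" using den \<delta>3p by (intro mult_left_mono) auto
    then show ?thesis unfolding \<delta>'_def using den by (simp add: divide_le_eq)
  qed
  have low: "low \<le> \<delta>' / 2"
  proof -
    have "c * (c * (c * \<delta> / Q / 2) / (2 * k) / 2) / 2 \<le> \<delta>3"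
    proof -
      have "c * (c * \<delta> / Q / 2) / (2 * k) / 2 \<le> c * \<delta>1 / (2 * k) / 2"
        using \<delta>1(1) c k1 by (intro divide_right_mono mult_left_mono) auto
      then have "c * (c * (c * \<delta> / Q / 2) / (2 * k) / 2) / 2 \<le> c * \<delta>2 / 2"
        using \<delta>2(1) c by (intro divide_right_mono mult_left_mono) auto
      then show ?thesis using \<delta>3(1) by linarith
    qed
    then have "c * (c * (c * \<delta> / Q / 2) / (2 * k) / 2) / 2 / (1548800 * D\<^sup>2 * K * (m0 + 1)) / 2 \<le> \<delta>' / 2"
      unfolding \<delta>'_def using den by (intro divide_right_mono) auto
    \<comment> \<open>D^5 and k^4 in \<open>low\<close> collect three factors c, the quotient 2 k,
      and the D^2 of the annihilating radius; each choice of a regular radius loses a factor 2. The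
      numerical constant stays below 10^18.\<close>
    moreover have "c * (c * (c * \<delta> / Q / 2) / (2 * k) / 2) / 2 / (1548800 * D\<^sup>2 * K * (m0 + 1)) / 2
        = \<delta> / ((2200 ^ 3 * 16 * 1548800 * 2) * real k ^ 4 * Q * D ^ 5 * K * (real m0 + 1))"
      unfolding c_eq by (simp add: power2_eq_square power3_eq_cube power4_eq_xxxx eval_nat_numeral algebra_simps)
    moreover have "low \<le> \<delta> / ((2200 ^ 3 * 16 * 1548800 * 2) * real k ^ 4 * Q * D ^ 5 * K * (real m0 + 1))"
      unfolding low_def using k1 Q D K1 \<delta>
      by (intro divide_left_mono mult_right_mono mult_pos_pos) auto
    ultimately show ?thesis by linarith
  qed
  have low2: "low \<le> \<delta>2" using low \<delta>'\<delta>3 \<delta>3\<delta>2 \<delta>'p by linarith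
  let ?B1 = "bohr N \<Theta> \<delta>1" and ?B2 = "bohr N \<Theta> \<delta>2" and ?B = "bohr N \<Theta> \<delta>"
  \<comment> \<open>Each of the pairs (0, 1) and (2, 3) joins the large Bohr set with a much smaller
    one, so that its sums stay essentially in the large one.\<close>
  define C where "C i = (if i = 0 \<or> i = 2 then ?B1 else ?B2)" for i :: nat
  define rad where "rad i = (if i = 0 \<or> i = 2 then \<delta>1 else \<delta>2)" for i :: nat
  have C: "C i = bohr N \<Theta> (rad i)" for i by (simp add: C_def rad_def)
  have rad: "0 < rad i" "rad i \<le> \<delta>1" "low \<le> rad i" "bohr_reg N \<Theta> \<eta> (rad i)" for i
    using \<delta>1p \<delta>2p \<delta>2\<delta>1 low2 \<delta>1(3) \<delta>2(3) by (auto simp: rad_def)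
  have cf0: "cf i \<noteq> 0" if "i < k" for i using a by (auto simp: cf_def)
  have acf: "a i * cf i = (\<Prod>j<k. a j)" if "i < k" for i
    using that unfolding cf_def by (simp add: prod.remove)
  have "\<exists>x. \<forall>i<k. card {b \<in> C i. x + cf i * b \<in> A} \<ge> 97 / 100 * \<alpha> * card (C i)"
  proof (rule choose_translate)
    show "finite (bohr N \<Theta> (\<delta> + c * \<delta>))" "bohr N \<Theta> (\<delta> + c * \<delta>) \<noteq> {}"
      using c \<delta> zero_in_bohr[of "\<delta> + c * \<delta>" N \<Theta>] by auto
    show "finite (C i) \<and> C i \<noteq> {}" for i
      using zero_in_bohr[of "rad i" N \<Theta>] rad(1)[of i] unfolding C by auto
    show "card (bohr N \<Theta> (\<delta> + c * \<delta>)) \<le> (1 + \<eta>) * card ?B"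
      using reg unfolding bohr_reg_def c_def D_def by simp
    show "\<alpha> * card ?B \<le> card (A \<inter> ?B)" by (rule dens)
    show "z - cf i * b \<in> bohr N \<Theta> (\<delta> + c * \<delta>)" if i: "i < k" and z: "z \<in> A \<inter> ?B" and b: "b \<in> C i" for i z b
    proof -
      have "cf i * b \<in> bohr N \<Theta> (\<bar>real_of_int (cf i)\<bar> * rad i)" using b unfolding C by (rule bohr_scale)
      moreover have "\<bar>real_of_int (cf i)\<bar> * rad i \<le> Q * \<delta>1"
        using Q(2)[OF i] Q(1) rad[of i] unfolding cf_def by (intro mult_mono) auto
      then have "\<bar>real_of_int (cf i)\<bar> * rad i \<le> c * \<delta>" using Q\<delta>1 by linarith
      ultimately have "cf i * b \<in> bohr N \<Theta> (c * \<delta>)" using bohr_mono by blast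
      then show ?thesis using z by (intro bohr_diff) auto
    qed
    show "card {b \<in> C i. x + cf i * b \<in> A} \<le> (1 + \<eta>) * \<alpha> * card (C i)" if i: "i < k" for i x
    proof (rule ccontr)
      \<comment> \<open>A denser translate here is already an increment, with no new
        frequencies.\<close>
      assume "\<not> ?thesis"
      moreover have "{b \<in> C i. x + cf i * b \<in> A} = {z. x + cf i * z \<in> A} \<inter> bohr N (\<Theta> \<union> {}) (rad i)"
        unfolding C by auto
      ultimately have "(1 + \<eta>) * \<alpha> * card (bohr N (\<Theta> \<union> {}) (rad i))
          \<le> card ({z. x + cf i * z \<in> A} \<inter> bohr N (\<Theta> \<union> {}) (rad i))"
        unfolding C by simp
      moreover have "rad i \<le> 2" using rad(2)[of i] \<delta>1\<delta> \<delta> by linarith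
      moreover have "bohr_reg N (\<Theta> \<union> {}) \<eta> (rad i)" using rad(4) by simp
      ultimately have ?inc using cf0[OF i] rad(3)[of i] by (intro exI[of _ "cf i"] exI[of _ x] exI[of _ "{}"] exI[of _ "rad i"]) simp
      then show False using noinc by blast
    qed
  qed (use A \<alpha>p \<eta> \<eta>k k in auto)
  then obtain x where x: "\<And>i. i < k \<Longrightarrow> card {b \<in> C i. x + cf i * b \<in> A} \<ge> 97 / 100 * \<alpha> * card (C i)" by blast
  define E where "E i = {b \<in> C i. x + cf i * b \<in> A}" for i
  have EC: "E i \<subseteq> C i" for i by (auto simp: E_def)
  have finE: "finite (E i)" for i using EC[of i] finite_bohr unfolding C by (rule finite_subset)
  have Edens: "card (E i) \<ge> 97 / 100 * \<alpha> * card (C i)" if "i < k" for i using x[OF that] by (simp add: E_def)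
  have C0: "C 0 = ?B1" "C 1 = ?B2" "C 2 = ?B1" "C 3 = ?B2" by (auto simp: C_def)
  \<comment> \<open>Half of the margin at \<delta>1. Sums of a pair, together with the k - 4 fixed
    variables of total radius w, land in radius \<delta>1 + h; the other half is left for
    subtracting elements of radius w + \<delta>2.\<close>
  define h where "h = c * \<delta>1 / 2"
  define w where "w = real (k - 4) * \<delta>2"
  have h0: "0 \<le> h" "0 \<le> w" using c \<delta>1p \<delta>2p by (auto simp: h_def w_def)
  have w\<delta>2: "w + \<delta>2 \<le> h"
  proof -
    have "w + \<delta>2 = (real k - 3) * \<delta>2" using k by (simp add: w_def of_nat_diff algebra_simps)
    also have "\<dots> \<le> k * \<delta>2" using \<delta>2p by (intro mult_right_mono) auto
    finally show ?thesis using k\<delta>2 by (simp add: h_def)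
  qed
  have noinc': False if F: "F \<subseteq> ?B2" "card F \<ge> 97 / 100 * \<alpha> * card ?B2" and i: "i = 0 \<or> i = 2"
    and y: "y \<in> bohr N \<Theta> w" and S: "S \<subseteq> bohr N \<Theta> (\<delta>1 + h)" "2 * card S \<le> card (bohr N \<Theta> (\<delta>1 + h))"
    and big: "cnt (E i) ((\<lambda>z. z + y) ` F) S 0 \<ge> 99 / 100 * card (E i) * card F" for F i y S
  proof -
    have ik: "i < k" using i k by auto
    have Ei: "E i \<subseteq> ?B1" "card (E i) \<ge> 97 / 100 * \<alpha> * card ?B1"
      using EC[of i] Edens[OF ik] i C0 by auto
    have c1: "\<delta>3 \<le> \<eta> * \<delta>2 / (22 * (2 * real (card \<Theta>) + 1))" using \<delta>3(2) by (simp add: c_def D_def)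
    have c2: "h + (w + \<delta>2) \<le> \<eta> * \<delta>1 / (22 * (2 * real (card \<Theta>) + 1))"
    proof -
      have e: "\<eta> * \<delta>1 / (22 * (2 * real (card \<Theta>) + 1)) = c * \<delta>1" by (simp add: c_def D_def)
      show ?thesis unfolding e using w\<delta>2 by (simp add: h_def)
    qed
    have c3: "\<delta>' \<le> \<delta>3 / (1548800 * (2 * real (card \<Theta>) + 1)\<^sup>2 * K * (m0 + 1))" by (simp add: \<delta>'_def D_def)
    have \<delta>3le: "\<delta>3 \<le> 2" using \<delta>3\<delta>2 \<delta>2\<delta>1 \<delta>1\<delta> \<delta> by linarith
    obtain \<Lambda> where \<Lambda>: "finite \<Lambda>" "card \<Lambda> \<le> m0" and
      inc: "\<And>r. 0 < r \<Longrightarrow> r \<le> \<delta>' \<Longrightarrow> \<exists>u. (1 + \<eta>) * \<alpha> * card (bohr N (\<Theta> \<union> \<Lambda>) r)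
        \<le> real (card {x \<in> bohr N (\<Theta> \<union> \<Lambda>) r. u + x \<in> E i})"
      using half_set_increment[OF N finT \<eta>(1,2) \<delta>1p \<delta>2p \<delta>3p \<delta>3le \<delta>1(3) \<delta>2(3) \<delta>3(3) c1 h0 c2 \<alpha> K Ei F y S big
          params \<delta>'p c3] by blast
    have "finite (\<Theta> \<union> \<Lambda>)" using finT \<Lambda> by simp
    then obtain r where r: "\<delta>' / 2 \<le> r" "r \<le> \<delta>'" "bohr_reg N (\<Theta> \<union> \<Lambda>) \<eta> r"
      using exists_bohr_reg[OF _ \<delta>'p N \<eta>(1,3)] by metis
    have "0 < r" using r(1) \<delta>'p by linarith
    then obtain u where u: "(1 + \<eta>) * \<alpha> * card (bohr N (\<Theta> \<union> \<Lambda>) r)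
        \<le> real (card {x \<in> bohr N (\<Theta> \<union> \<Lambda>) r. u + x \<in> E i})" using inc r(2) by blast
    \<comment> \<open>Membership of u + v in E i puts x + c_i (u + v) in A, so an increment for E i
      is one for A under an affine map of slope c_i.\<close>
    have "{v \<in> bohr N (\<Theta> \<union> \<Lambda>) r. u + v \<in> E i} \<subseteq> {z. (x + cf i * u) + cf i * z \<in> A} \<inter> bohr N (\<Theta> \<union> \<Lambda>) r"
      by (auto simp: E_def algebra_simps)
    then have "card {v \<in> bohr N (\<Theta> \<union> \<Lambda>) r. u + v \<in> E i}
        \<le> card ({z. (x + cf i * u) + cf i * z \<in> A} \<inter> bohr N (\<Theta> \<union> \<Lambda>) r)" by (intro card_mono) auto
    then have "(1 + \<eta>) * \<alpha> * card (bohr N (\<Theta> \<union> \<Lambda>) r)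
        \<le> card ({z. (x + cf i * u) + cf i * z \<in> A} \<inter> bohr N (\<Theta> \<union> \<Lambda>) r)" using u by linarith
    moreover have "r \<le> 2" using r(2) \<delta>'\<delta>3 \<delta>3le by linarith
    moreover have "low \<le> r" using low r(1) by linarith
    ultimately have ?inc using cf0[OF ik] \<Lambda> r(3) by blast
    then show False using noinc by blast
  qed
  have quads: "(\<alpha> / 20) ^ 4 * card ?B2 ^ 3 \<le> card (quads (E 0) (E 1) (E 2) (E 3) (\<Sum>i\<in>{4..<k}. g i))"
    if g: "g \<in> PiE {4..<k} E" for g
  proof -
    define y where "y = (\<Sum>i\<in>{4..<k}. g i)"
    let ?Bh = "bohr N \<Theta> (\<delta>1 + h)"
    have "y \<in> bohr N \<Theta> (real (card {4..<k}) * \<delta>2)"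
      unfolding y_def
    proof (rule bohr_sum)
      fix i assume i: "i \<in> {4..<k}"
      then have "g i \<in> C i" using PiE_mem[OF g] EC by blast
      then show "g i \<in> bohr N \<Theta> \<delta>2" using i by (simp add: C_def)
    qed simp
    then have y: "y \<in> bohr N \<Theta> w" by (simp add: w_def)
    have Ed: "97 / 100 * \<alpha> * card ?B1 \<le> card (E 0)" "97 / 100 * \<alpha> * card ?B2 \<le> card (E 1)"
      "97 / 100 * \<alpha> * card ?B1 \<le> card (E 2)" "97 / 100 * \<alpha> * card ?B2 \<le> card (E 3)"
      using Edens[of 0] Edens[of 1] Edens[of 2] Edens[of 3] k unfolding C0 by simp_all
    have sub: "E 0 \<subseteq> ?B1" "E 1 \<subseteq> ?B2" "E 2 \<subseteq> ?B1" "E 3 \<subseteq> ?B2"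
      using EC[of 0] EC[of 1] EC[of 2] EC[of 3] unfolding C0 by simp_all
    have "(\<exists>S\<subseteq>?Bh. 2 * card S \<le> card ?Bh \<and> cnt (E 0) (E 1) S 0 \<ge> 99 / 100 * card (E 0) * card (E 1)) \<or>
      (\<exists>S\<subseteq>?Bh. 2 * card S \<le> card ?Bh \<and> cnt (E 2) ((\<lambda>z. z + y) ` E 3) S 0 \<ge> 99 / 100 * card (E 2) * card (E 3)) \<or>
      real (card ?Bh) * card (quads (E 0) (E 1) (E 2) (E 3) y) \<ge> 1 / 10000 * (card (E 0) * card (E 1) * card (E 2) * card (E 3))"
    proof (rule popular_sums_trichotomy)
      show "?Bh \<noteq> {}" using zero_in_bohr[of "\<delta>1 + h" N \<Theta>] \<delta>1p h0 by auto
      show "u + v \<in> ?Bh" if "u \<in> E 0" "v \<in> E 1" for u v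
      proof -
        have "u + v \<in> bohr N \<Theta> (\<delta>1 + \<delta>2)" using that sub by (intro bohr_add) auto
        then show ?thesis using bohr_mono[of "\<delta>1 + \<delta>2" "\<delta>1 + h" \<Theta> \<Theta> N] w\<delta>2 h0 by auto
      qed
      show "u + v + y \<in> ?Bh" if "u \<in> E 2" "v \<in> E 3" for u v
      proof -
        have "u + (v + y) \<in> bohr N \<Theta> (\<delta>1 + (\<delta>2 + w))" using that sub y by (intro bohr_add) auto
        then show ?thesis using bohr_mono[of "\<delta>1 + (\<delta>2 + w)" "\<delta>1 + h" \<Theta> \<Theta> N] w\<delta>2 by (auto simp: add.assoc)
      qed
    qed (auto simp: finE)
    \<comment> \<open>The fixed variables are attached to the second pair only, hence the shift 0
      here.\<close>
    moreover have False if "S \<subseteq> ?Bh" "2 * card S \<le> card ?Bh" "cnt (E 0) (E 1) S 0 \<ge> 99 / 100 * card (E 0) * card (E 1)" for S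
      by (rule noinc'[of "E 1" 0 0 S]) (use that sub Ed zero_in_bohr h0 in auto)
    moreover have False if "S \<subseteq> ?Bh" "2 * card S \<le> card ?Bh"
      "cnt (E 2) ((\<lambda>z. z + y) ` E 3) S 0 \<ge> 99 / 100 * card (E 2) * card (E 3)" for S
      by (rule noinc'[of "E 3" 2 y S]) (use that sub Ed y in auto)
    ultimately have q: "1 / 10000 * (card (E 0) * card (E 1) * card (E 2) * card (E 3))
        \<le> real (card ?Bh) * card (quads (E 0) (E 1) (E 2) (E 3) y)" by blast
    have "card ?Bh \<le> card (bohr N \<Theta> (\<delta>1 + c * \<delta>1))"
      using c \<delta>1p by (intro card_mono bohr_mono) (auto simp: h_def)
    also have "real \<dots> \<le> (1 + \<eta>) * card ?B1"
      using \<delta>1(3) unfolding bohr_reg_def c_def D_def by simp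
    also have "\<dots> \<le> 101 / 100 * card ?B1" using \<eta> by (intro mult_right_mono) auto
    finally have Bh: "card ?Bh \<le> 101 / 100 * card ?B1" by simp
    have B21: "card ?B2 \<le> card ?B1" using \<delta>2\<delta>1 by (intro card_mono bohr_mono) auto
    have "(\<alpha> / 20) ^ 4 * real (card ?B2) ^ 3 \<le> card (quads (E 0) (E 1) (E 2) (E 3) y)"
      by (rule quads_lower[OF \<alpha>p _ _ _ Bh _ Ed]) (use q B21 \<delta>2p in \<open>auto simp: card_bohr_pos\<close>)
    then show ?thesis by (simp add: y_def)
  qed
  have cB2: "real (card ?B2) > 0" using \<delta>2p by (simp add: card_bohr_pos)
  \<comment> \<open>Each of the k - 4 fixed variables ranges over a set giving one factor
    \<open>card ?B2\<close>, and the quadruples give three: k - 1 in all.\<close>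
  have "(\<alpha> / 20) ^ k * card ?B2 ^ (k - 1) = (\<alpha> / 20 * card ?B2) ^ (k - 4) * ((\<alpha> / 20) ^ 4 * card ?B2 ^ 3)"
  proof -
    have e: "k = (k - 4) + 4" "k - 1 = (k - 4) + 3" using k by auto
    have "(\<alpha> / 20) ^ ((k - 4) + 4) * real (card ?B2) ^ ((k - 4) + 3)
        = (\<alpha> / 20 * card ?B2) ^ (k - 4) * ((\<alpha> / 20) ^ 4 * real (card ?B2) ^ 3)"
      unfolding power_add power_mult_distrib by (simp add: mult_ac)
    then show ?thesis using e by (metis of_nat_power)
  qed
  also have "\<dots> \<le> real (card (PiE {4..<k} E)) * ((\<alpha> / 20) ^ 4 * card ?B2 ^ 3)"
  proof (rule mult_right_mono)
    have "(\<alpha> / 20 * card ?B2) ^ (k - 4) = (\<Prod>i\<in>{4..<k}. \<alpha> / 20 * card ?B2)" by simp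
    also have "\<dots> \<le> (\<Prod>i\<in>{4..<k}. real (card (E i)))"
    proof (intro prod_mono conjI)
      fix i assume i: "i \<in> {4..<k}"
      then have "97 / 100 * \<alpha> * card ?B2 \<le> card (E i)" using Edens[of i] by (simp add: C_def)
      moreover have "\<alpha> / 20 * card ?B2 \<le> 97 / 100 * \<alpha> * card ?B2"
        using \<alpha>p by (intro mult_right_mono) auto
      ultimately show "\<alpha> / 20 * card ?B2 \<le> real (card (E i))" by linarith
    qed (use \<alpha>p in auto)
    also have "\<dots> = real (card (PiE {4..<k} E))" by (simp add: card_PiE)
    finally show "(\<alpha> / 20 * card ?B2) ^ (k - 4) \<le> real (card (PiE {4..<k} E))" .
  qed (use \<alpha>p in auto)
  also have "\<dots> = (\<Sum>g\<in>PiE {4..<k} E. (\<alpha> / 20) ^ 4 * card ?B2 ^ 3)" by simp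
  also have "\<dots> \<le> (\<Sum>g\<in>PiE {4..<k} E. real (card (quads (E 0) (E 1) (E 2) (E 3) (\<Sum>i\<in>{4..<k}. g i))))"
    by (rule sum_mono) (rule quads)
  also have "\<dots> \<le> card (int_solutions k a A)"
  proof -
    have "(\<Sum>g\<in>PiE {4..<k} E. card (quads (E 0) (E 1) (E 2) (E 3) (\<Sum>i\<in>{4..<k}. g i))) \<le> card (int_solutions k a A)"
      by (rule card_int_solutions_ge_sum_quads[OF k inv acf cf0 _ finE A, where x = x]) (auto simp: E_def)
    then show ?thesis by (metis of_nat_le_iff of_nat_sum)
  qed
  finally have "(\<alpha> / 20) ^ k * card ?B2 ^ (k - 1) \<le> card (int_solutions k a A)" .
  moreover have "(\<alpha> / 20) ^ k * card (bohr N \<Theta> low) ^ (k - 1) \<le> (\<alpha> / 20) ^ k * card ?B2 ^ (k - 1)"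
  proof -
    have "card (bohr N \<Theta> low) \<le> card ?B2" using low2 by (intro card_mono bohr_mono) auto
    then have "card (bohr N \<Theta> low) ^ (k - 1) \<le> card ?B2 ^ (k - 1)" by (intro power_mono) auto
    then have "real (card (bohr N \<Theta> low) ^ (k - 1)) \<le> real (card ?B2 ^ (k - 1))" by (simp only: of_nat_le_iff)
    then show ?thesis using \<alpha>p by (intro mult_left_mono) auto
  qed
  ultimately show ?many by linarith
qed

section \<open>Iteration\<close>

text \<open>The translation contributes u times the sum of the a_i, which is 0, and the dilation
  factors out of the equation.\<close>

lemma card_int_solutions_affine_le:
  assumes inv: "(\<Sum>i<k. a i) = 0" and A: "finite A" and c: "c \<noteq> 0"
  shows "card (int_solutions k a {z. u + c * z \<in> A}) \<le> card (int_solutions k a A)"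
proof (rule card_inj_on_le[of "\<lambda>x. \<lambda>i\<in>{..<k}. u + c * x i"])
  show "finite (int_solutions k a A)"
    by (rule finite_subset[of _ "{..<k} \<rightarrow>\<^sub>E A"]) (auto simp: int_solutions_def A intro!: finite_PiE)
  show "inj_on (\<lambda>x. \<lambda>i\<in>{..<k}. u + c * x i) (int_solutions k a {z. u + c * z \<in> A})"
  proof (rule inj_onI)
    fix x y assume x: "x \<in> int_solutions k a {z. u + c * z \<in> A}" and y: "y \<in> int_solutions k a {z. u + c * z \<in> A}"
      and eq: "(\<lambda>i\<in>{..<k}. u + c * x i) = (\<lambda>i\<in>{..<k}. u + c * y i)"
    show "x = y"
    proof (rule PiE_ext)
      show "x \<in> {..<k} \<rightarrow>\<^sub>E {z. u + c * z \<in> A}" "y \<in> {..<k} \<rightarrow>\<^sub>E {z. u + c * z \<in> A}"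
        using x y by (simp_all add: int_solutions_def)
      show "x i = y i" if "i \<in> {..<k}" for i using fun_cong[OF eq, of i] that c by simp
    qed
  qed
  show "(\<lambda>x. \<lambda>i\<in>{..<k}. u + c * x i) ` int_solutions k a {z. u + c * z \<in> A} \<subseteq> int_solutions k a A"
  proof
    fix y assume "y \<in> (\<lambda>x. \<lambda>i\<in>{..<k}. u + c * x i) ` int_solutions k a {z. u + c * z \<in> A}"
    then obtain x where x: "x \<in> {..<k} \<rightarrow>\<^sub>E {z. u + c * z \<in> A}" "(\<Sum>i<k. a i * x i) = 0"
      and y: "y = (\<lambda>i\<in>{..<k}. u + c * x i)" by (auto simp: int_solutions_def)
    have "y \<in> {..<k} \<rightarrow>\<^sub>E A" unfolding y restrict_PiE_iff using PiE_mem[OF x(1)] by blast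
    moreover have "(\<Sum>i<k. a i * y i) = (\<Sum>i<k. a i) * u + c * (\<Sum>i<k. a i * x i)"
      by (simp add: y sum_distrib_left sum_distrib_right sum.distrib distrib_left mult_ac)
    ultimately show "y \<in> int_solutions k a A" using inv x(2) by (simp add: int_solutions_def)
  qed
qed

lemma finite_affine_preimage:
  fixes A :: "int set"
  assumes "finite A" "c \<noteq> 0"
  shows "finite {z. u + c * z \<in> A}"
proof -
  have "inj (\<lambda>z. u + c * z)" using assms(2) by (auto simp: inj_def)
  from finite_vimageI[OF assms(1) this] show ?thesis by (simp add: vimage_def)
qed

lemma card_bohr_lower_real:
  assumes "finite \<Theta>" "N \<ge> 1" "0 < \<rho>" "\<rho> \<le> 2" "2 * card \<Theta> + 1 \<le> d"
  shows "real N / (20 / \<rho>) ^ d \<le> card (bohr N \<Theta> \<rho>)"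
proof -
  \<comment> \<open>As 2/\<rho> \<ge> 1, rounding up gives n \<le> 4/\<rho>, whence 5 n \<le>
    20/\<rho>.\<close>
  define n where "n = nat \<lceil>2 / \<rho>\<rceil>"
  have r: "2 / \<rho> \<ge> 1" using assms by (simp add: le_divide_eq)
  have n: "2 / \<rho> \<le> real n" "real n \<le> 2 / \<rho> + 1" unfolding n_def using r by linarith+
  then have n1: "n \<ge> 1" using r by linarith
  have "real N \<le> real ((5 * n) ^ (2 * card \<Theta> + 1) * card (bohr N \<Theta> (2 / real n)))"
    using card_bohr_lower[OF assms(1,2) n1] by (simp only: of_nat_le_iff)
  also have "\<dots> = (5 * real n) ^ (2 * card \<Theta> + 1) * card (bohr N \<Theta> (2 / real n))" by simp
  also have "\<dots> \<le> (20 / \<rho>) ^ d * card (bohr N \<Theta> \<rho>)"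
  proof (rule mult_mono)
    have "5 * real n \<le> 10 * (2 / \<rho>)" using n r by linarith
    then have "(5 * real n) ^ (2 * card \<Theta> + 1) \<le> (20 / \<rho>) ^ (2 * card \<Theta> + 1)"
      by (intro power_mono) auto
    also have "\<dots> \<le> (20 / \<rho>) ^ d" using r assms(5) by (intro power_increasing) auto
    finally show "(5 * real n) ^ (2 * card \<Theta> + 1) \<le> (20 / \<rho>) ^ d" .
    have "2 / real n \<le> \<rho>" using n(1) n1 assms(3) by (simp add: field_simps)
    then show "real (card (bohr N \<Theta> (2 / real n))) \<le> card (bohr N \<Theta> \<rho>)"
      by (intro of_nat_mono card_mono bohr_mono) auto
  qed (use assms in auto)
  finally show ?thesis using assms by (simp add: divide_le_eq mult.commute)
qed

lemma bohr_density_le_1: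
  fixes \<alpha> \<delta> :: real
  assumes "\<delta> \<ge> 0" "\<alpha> * card (bohr N \<Theta> \<delta>) \<le> card (A \<inter> bohr N \<Theta> \<delta>)"
  shows "\<alpha> \<le> 1"
proof -
  have "card (A \<inter> bohr N \<Theta> \<delta>) \<le> card (bohr N \<Theta> \<delta>)" by (intro card_mono) auto
  then have "\<alpha> * card (bohr N \<Theta> \<delta>) \<le> 1 * real (card (bohr N \<Theta> \<delta>))" using assms(2) by simp
  moreover have "real (card (bohr N \<Theta> \<delta>)) > 0" using card_bohr_pos[OF assms(1)] by simp
  ultimately show ?thesis by (simp only: mult_le_cancel_right)
qed

text \<open>n counts the steps still available. The last three assumptions are budgets for density,
  rank and radius that one step preserves: \<alpha> gains a factor 1 + \<eta>, the rank grows by at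
  most m0, and the radius shrinks at most by q, which is \<open>low\<close> divided by \<delta> with
  the current rank replaced by its final bound d.\<close>

theorem density_iteration:
  fixes \<Theta> :: "real set" and \<alpha> \<alpha>0 \<eta> \<delta> K Q q \<omega> :: real and l m m0 k d n :: nat and a :: "nat \<Rightarrow> int"
  defines "\<eta> \<equiv> 1 / (100 * real k)"
  defines "q \<equiv> 1 / (10 ^ 18 * real k ^ 4 * Q * real d ^ 5 * K * (real m0 + 1))"
  assumes k: "k \<ge> 4" and a: "\<And>i. i < k \<Longrightarrow> a i \<noteq> 0" and inv: "(\<Sum>i<k. a i) = 0"
    and Q: "Q \<ge> 1" "\<And>i. i < k \<Longrightarrow> \<bar>real_of_int (\<Prod>j\<in>{..<k} - {i}. a j)\<bar> \<le> Q"
    and N: "N \<ge> 1" and \<alpha>0: "0 < \<alpha>0" and K: "K = 3 / \<alpha>0" and params: "sampling_params K l m m0" and \<omega>: "0 < \<omega>"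
    and "finite \<Theta>" "0 < \<delta>" "\<delta> \<le> 2" "bohr_reg N \<Theta> \<eta> \<delta>" "finite A" "\<alpha>0 \<le> \<alpha>"
    and "\<alpha> * card (bohr N \<Theta> \<delta>) \<le> card (A \<inter> bohr N \<Theta> \<delta>)"
    and "1 < \<alpha> * (1 + \<eta>) ^ n" "2 * (card \<Theta> + n * m0) + 1 \<le> d" "\<omega> \<le> q ^ n * \<delta>"
  shows "card (int_solutions k a A) \<ge> (\<alpha>0 / 20) ^ k * (real N / (20 / (q * \<omega>)) ^ d) ^ (k - 1)"
  using assms(13-)
proof (induction n arbitrary: A \<Theta> \<delta> \<alpha>)
  case 0
  \<comment> \<open>With no step left the density budget reads 1 < \<alpha>, so this case cannot
    occur.\<close>
  have "\<alpha> \<le> 1" by (rule bohr_density_le_1[OF less_imp_le[OF 0(2)] 0(7)])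
  then show ?case using 0 by simp
next
  case (Suc n)
  note fin\<Theta> = Suc.prems(1) and \<delta> = Suc.prems(2,3) and reg = Suc.prems(4) and finA = Suc.prems(5)
    and \<alpha> = Suc.prems(6) and dens = Suc.prems(7) and big = Suc.prems(8) and rank = Suc.prems(9) and rad = Suc.prems(10)
  have \<alpha>1: "\<alpha> \<le> 1" by (rule bohr_density_le_1[OF less_imp_le[OF \<delta>(1)] dens])
  have K1: "K \<ge> 1" using \<alpha>0 \<alpha> \<alpha>1 unfolding K by (simp add: le_divide_eq)
  have k1: "real k \<ge> 1" using k by simp
  define D where "D = 2 * real (card \<Theta>) + 1"
  have D: "D \<ge> 1" "D \<le> real d"
  proof -
    show "D \<ge> 1" by (simp add: D_def)
    have "2 * card \<Theta> + 1 \<le> d" using rank by simp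
    then have "real (2 * card \<Theta> + 1) \<le> real d" by (simp only: of_nat_le_iff)
    then show "D \<le> real d" by (simp add: D_def)
  qed
  have q1: "1 \<le> 10 ^ 18 * real k ^ 4 * Q * real d ^ 5 * K * (real m0 + 1)"
  proof -
    have "1 * 1 * 1 * 1 * 1 * 1 \<le> 10 ^ 18 * real k ^ 4 * Q * real d ^ 5 * K * (real m0 + 1)"
      using k1 Q K1 D by (intro mult_mono one_le_power mult_nonneg_nonneg) auto
    then show ?thesis by simp
  qed
  moreover have "0 < 1 / x \<and> 1 / x \<le> 1" if "1 \<le> x" for x :: real using that by simp
  ultimately have q: "0 < q" "q \<le> 1" unfolding q_def by blast+
  define low where "low = \<delta> / (10 ^ 18 * real k ^ 4 * Q * D ^ 5 * K * (real m0 + 1))"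
  have low: "q * \<delta> \<le> low"
  proof -
    have "\<delta> / (10 ^ 18 * real k ^ 4 * Q * real d ^ 5 * K * (real m0 + 1)) \<le> low"
      unfolding low_def using k1 Q K1 D \<delta>
      by (intro divide_left_mono mult_right_mono mult_left_mono power_mono mult_pos_pos) auto
    then show ?thesis by (simp add: q_def)
  qed
  have \<omega>\<delta>: "\<omega> \<le> \<delta>"
  proof -
    have "q ^ Suc n * \<delta> \<le> 1 * \<delta>" using q \<delta> by (intro mult_right_mono power_le_one) auto
    then show ?thesis using rad by linarith
  qed
  have "card (int_solutions k a A) \<ge> (\<alpha> / 20) ^ k * card (bohr N \<Theta> low) ^ (k - 1) \<or>
    (\<exists>c u \<Lambda> r. c \<noteq> 0 \<and> finite \<Lambda> \<and> card \<Lambda> \<le> m0 \<and> low \<le> r \<and> r \<le> 2 \<and> bohr_reg N (\<Theta> \<union> \<Lambda>) \<eta> r \<and>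
      (1 + \<eta>) * \<alpha> * card (bohr N (\<Theta> \<union> \<Lambda>) r) \<le> card ({z. u + c * z \<in> A} \<inter> bohr N (\<Theta> \<union> \<Lambda>) r))"
    unfolding low_def D_def \<eta>_def
    by (rule density_step[OF k a inv Q N fin\<Theta> \<delta> reg[unfolded \<eta>_def] finA \<alpha>0 \<alpha> \<alpha>1 K dens params])
  then show ?case
  proof (elim disjE exE conjE)
    assume many: "(\<alpha> / 20) ^ k * card (bohr N \<Theta> low) ^ (k - 1) \<le> card (int_solutions k a A)"
    have "q * \<omega> \<le> q * \<delta>" using \<omega>\<delta> q by (intro mult_left_mono) auto
    moreover have "q * \<delta> \<le> 1 * \<delta>" using q \<delta> by (intro mult_right_mono) auto
    ultimately have q\<omega>: "q * \<omega> \<le> low" "q * \<omega> \<le> 2" using low \<delta> by linarith+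
    have q\<omega>0: "0 < q * \<omega>" using q \<omega> by simp
    have "real N / (20 / (q * \<omega>)) ^ d \<le> card (bohr N \<Theta> (q * \<omega>))"
      using q\<omega> q\<omega>0 rank by (intro card_bohr_lower_real fin\<Theta> N) auto
    also have "\<dots> \<le> card (bohr N \<Theta> low)" using q\<omega> q\<omega>0 by (intro of_nat_mono card_mono bohr_mono) auto
    finally have "(real N / (20 / (q * \<omega>)) ^ d) ^ (k - 1) \<le> real (card (bohr N \<Theta> low)) ^ (k - 1)"
      using q\<omega> q\<omega>0 by (intro power_mono) auto
    moreover have "(\<alpha>0 / 20) ^ k \<le> (\<alpha> / 20) ^ k" using \<alpha> \<alpha>0 by (intro power_mono) auto
    ultimately have "(\<alpha>0 / 20) ^ k * (real N / (20 / (q * \<omega>)) ^ d) ^ (k - 1)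
        \<le> (\<alpha> / 20) ^ k * real (card (bohr N \<Theta> low)) ^ (k - 1)"
      using \<alpha> \<alpha>0 q\<omega>0 by (intro mult_mono) auto
    then show ?thesis using many by simp
  next
    fix c u \<Lambda> r
    assume c: "c \<noteq> 0" and \<Lambda>: "finite \<Lambda>" "card \<Lambda> \<le> m0" and r: "low \<le> r" "r \<le> 2" "bohr_reg N (\<Theta> \<union> \<Lambda>) \<eta> r"
      and inc: "(1 + \<eta>) * \<alpha> * card (bohr N (\<Theta> \<union> \<Lambda>) r) \<le> card ({z. u + c * z \<in> A} \<inter> bohr N (\<Theta> \<union> \<Lambda>) r)"
    have qr: "q * \<delta> \<le> r" using low r by linarith
    have "0 < q * \<delta>" using q \<delta> by simp
    then have r0: "0 < r" using qr by linarith
    have \<eta>0: "\<eta> \<ge> 0" by (simp add: \<eta>_def)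
    have "1 * \<alpha> \<le> (1 + \<eta>) * \<alpha>" using \<eta>0 \<alpha> \<alpha>0 by (intro mult_right_mono) auto
    then have \<alpha>': "\<alpha>0 \<le> (1 + \<eta>) * \<alpha>" using \<alpha> by linarith
    have "card (\<Theta> \<union> \<Lambda>) \<le> card \<Theta> + m0" using card_Un_le[of \<Theta> \<Lambda>] \<Lambda> by linarith
    then have rank': "2 * (card (\<Theta> \<union> \<Lambda>) + n * m0) + 1 \<le> d" using rank by simp
    have "q ^ Suc n * \<delta> = q ^ n * (q * \<delta>)" by simp
    also have "\<dots> \<le> q ^ n * r" using qr q by (intro mult_left_mono) auto
    finally have rad': "\<omega> \<le> q ^ n * r" using rad by linarith
    have "(\<alpha>0 / 20) ^ k * (real N / (20 / (q * \<omega>)) ^ d) ^ (k - 1) \<le> card (int_solutions k a {z. u + c * z \<in> A})"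
    proof (rule Suc.IH)
      show "finite (\<Theta> \<union> \<Lambda>)" using fin\<Theta> \<Lambda> by simp
      show "1 < (1 + \<eta>) * \<alpha> * (1 + \<eta>) ^ n" using big by (simp add: mult_ac)
    qed (use r0 r inc \<alpha>' rank' rad' finite_affine_preimage[OF finA c] in auto)
    also have "\<dots> \<le> card (int_solutions k a A)"
      using card_int_solutions_affine_le[OF inv finA c, of u] by (simp only: of_nat_le_iff)
    finally show ?thesis .
  qed
qed

text \<open>The orders are l ~ L, m ~ l^2 L ~ L^3 and m0 ~ m L ~ L^4. Absolute constants and lower
  powers of L are absorbed because L \<ge> ln 2 \<ge> 2/3 and e = 2/\<alpha> \<ge> 2. The argument
  15/\<alpha> is 3/\<alpha>0 for the starting density \<alpha>0 = \<alpha>/5.\<close>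

lemma sampling_params_bounds:
  fixes \<alpha> L :: real
  defines "L \<equiv> ln (2 / \<alpha>)"
  assumes \<alpha>: "0 < \<alpha>" "\<alpha> \<le> 1"
  shows "\<exists>l m m0. sampling_params (15 / \<alpha>) l m m0 \<and> real m0 \<le> 3 * 10 ^ 11 * L ^ 4"
proof -
  define e where "e = exp L"
  have e: "e = 2 / \<alpha>" using \<alpha> by (simp add: e_def L_def)
  have e2: "e \<ge> 2" using \<alpha> unfolding e by (simp add: le_divide_eq)
  have "ln 2 \<le> L" unfolding L_def using \<alpha> by (subst ln_le_cancel_iff) (auto simp: le_divide_eq)
  then have L: "L \<ge> 2 / 3" using ln2_ge_two_thirds by linarith
  have Le: "L \<le> e" unfolding e_def using exp_ge_add_one_self[of L] by linarith
  have epow: "e ^ j = exp (real j * L)" for j by (simp add: e_def exp_of_nat_mult)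
  have epos: "e > 0" using e2 by linarith
  have K: "15 / \<alpha> = 15 / 2 * e" by (simp add: e)
  have p2: "2 ^ j \<le> e ^ j" for j using e2 by (intro power_mono) auto
  \<comment> \<open>The coefficients 13, 20, 5 and 3 of L below come from 1500 \<le> 2^12, 180000
    \<le> 2^18, 15/2 \<le> 2^4 and 8 \<le> 2^3.\<close>
  have absorb: "c * e ^ i \<le> e ^ (i + j)" if "c \<le> 2 ^ j" for c :: real and i j
  proof -
    have "c * e ^ i \<le> e ^ j * e ^ i" using that p2[of j] epos by (intro mult_right_mono) auto
    then show ?thesis by (simp add: power_add mult.commute)
  qed
  define l where "l = nat \<lceil>13 * L\<rceil>"
  have l: "13 * L \<le> l" "l \<le> 15 * L" "l \<ge> 1" unfolding l_def using L by linarith+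
  define m where "m = nat \<lceil>4 * (400 * real l)\<^sup>2 * (20 * L)\<rceil>"
  have mlow: "4 * (400 * real l)\<^sup>2 * (20 * L) \<le> m" unfolding m_def by linarith
  have L3: "8 / 27 \<le> L ^ 3" "16 / 81 \<le> L ^ 4"
    using power_mono[OF L, of 3] power_mono[OF L, of 4] by (simp_all add: power_divide)
  have mup: "m \<le> 3 * 10 ^ 9 * L ^ 3"
  proof -
    have "0 \<le> 4 * (400 * real l)\<^sup>2 * (20 * L)" using L by simp
    then have "m \<le> 4 * (400 * real l)\<^sup>2 * (20 * L) + 1" unfolding m_def by linarith
    also have "4 * (400 * real l)\<^sup>2 * (20 * L) \<le> 4 * (400 * (15 * L))\<^sup>2 * (20 * L)"
      using l L by (intro mult_right_mono mult_left_mono power_mono) auto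
    also have "\<dots> = 2880000000 * L ^ 3" by (simp add: power2_eq_square power3_eq_cube)
    finally show ?thesis using L3(1) by simp
  qed
  define m0 where "m0 = nat \<lceil>16 * (3 * L + m * (5 * L))\<rceil>"
  have m0low: "16 * (3 * L + m * (5 * L)) \<le> m0" unfolding m0_def by linarith
  have "0 \<le> 16 * (3 * L + m * (5 * L))" using L by simp
  then have "m0 \<le> 16 * (3 * L + m * (5 * L)) + 1" unfolding m0_def by linarith
  also have "\<dots> = 48 * L + 80 * (m * L) + 1" by simp
  also have "\<dots> \<le> 48 * (8 * L ^ 4) + 80 * (3 * 10 ^ 9 * L ^ 4) + 16 * L ^ 4"
  proof (intro add_mono mult_left_mono)
    have "m * L \<le> 3 * 10 ^ 9 * L ^ 3 * L" using mup L by (intro mult_right_mono) auto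
    then show "m * L \<le> 3 * 10 ^ 9 * L ^ 4" by (simp add: power4_eq_xxxx power3_eq_cube)
    have "1 * L \<le> (8 * L ^ 3) * L" using L3(1) L by (intro mult_right_mono) auto
    then show "L \<le> 8 * L ^ 4" by (simp add: power4_eq_xxxx power3_eq_cube mult_ac)
    show "1 \<le> 16 * L ^ 4" using L3(2) by simp
  qed auto
  also have "\<dots> \<le> 3 * 10 ^ 11 * L ^ 4" using L3(2) by simp
  finally have m0up: "m0 \<le> 3 * 10 ^ 11 * L ^ 4" .
  have "sampling_params (15 / \<alpha>) l m m0"
    unfolding sampling_params_def K
  proof (intro conjI)
    show "l \<ge> 1" by (rule l(3))
    have "1500 * e ^ 1 \<le> e ^ (1 + 12)" by (rule absorb) simp
    also have "\<dots> = exp (13 * L)" by (simp add: epow)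
    also have "\<dots> \<le> exp (real l)" using l(1) by simp
    also have "\<dots> = exp 1 ^ l" by (simp add: exp_of_nat_mult[symmetric])
    also have "\<dots> \<le> 4 ^ l" using exp_le by (intro power_mono) auto
    finally show "200 * (15 / 2 * e) \<le> 4 ^ l" by simp
    have "1600 * (15 / 2 * e) * l \<le> 1600 * (15 / 2 * e) * (15 * e)"
      using l(2) Le epos by (intro mult_left_mono) auto
    also have "\<dots> = 180000 * e ^ 2" by (simp add: power2_eq_square)
    also have "\<dots> \<le> e ^ (2 + 18)" by (rule absorb) simp
    also have "\<dots> = exp (20 * L)" by (simp add: epow)
    finally have "ln (1600 * (15 / 2 * e) * l) \<le> ln (exp (20 * L))"
      using epos l(3) by (subst ln_le_cancel_iff) auto
    then have "ln (1600 * (15 / 2 * e) * l) \<le> 20 * L" by simp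
    then have "4 * (400 * real l)\<^sup>2 * ln (1600 * (15 / 2 * e) * l) \<le> 4 * (400 * real l)\<^sup>2 * (20 * L)"
      by (intro mult_left_mono) auto
    then show "4 * (400 * real l)\<^sup>2 * ln (1600 * (15 / 2 * e) * real l) \<le> m" using mlow by linarith
    have "15 / 2 * e ^ 1 \<le> e ^ (1 + 4)" by (rule absorb) simp
    then have "15 / 2 * e \<le> exp (5 * L)" by (simp add: epow)
    then have "(15 / 2 * e) ^ m \<le> exp (5 * L) ^ m" using epos by (intro power_mono) auto
    moreover have "8 * e ^ 0 \<le> e ^ (0 + 3)" by (rule absorb) simp
    then have "8 \<le> exp (3 * L)" by (simp add: epow)
    ultimately have "8 * (15 / 2 * e) ^ m \<le> exp (3 * L) * exp (5 * L) ^ m"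
      using epos by (intro mult_mono) auto
    also have "\<dots> = exp (3 * L + m * (5 * L))" by (simp add: exp_add exp_of_nat_mult)
    finally have "ln (8 * (15 / 2 * e) ^ m) \<le> ln (exp (3 * L + m * (5 * L)))"
      using epos by (subst ln_le_cancel_iff) auto
    then have "16 * ln (8 * (15 / 2 * e) ^ m) \<le> 16 * (3 * L + m * (5 * L))" by simp
    then show "16 * ln (8 * (15 / 2 * e) ^ m) \<le> m0" using m0low by linarith
  qed
  then show ?thesis using m0up by blast
qed

section \<open>Return to natural numbers and the final constants\<close>

lemma card_int_solutions_le_card_solutions:
  assumes "finite A"
  shows "card (int_solutions k a (int ` A)) \<le> card (solutions k a A)"
proof (rule card_inj_on_le[of "\<lambda>x. \<lambda>i\<in>{..<k}. nat (x i)"])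
  show "finite (solutions k a A)"
    by (rule finite_subset[of _ "{..<k} \<rightarrow>\<^sub>E A"]) (auto simp: solutions_def assms intro!: finite_PiE)
  have nn: "x i \<ge> 0" "nat (x i) \<in> A" if "x \<in> int_solutions k a (int ` A)" "i < k" for x i
  proof -
    have "x \<in> {..<k} \<rightarrow>\<^sub>E int ` A" using that(1) unfolding int_solutions_def by blast
    then have "x i \<in> int ` A" by (rule PiE_mem) (simp add: that(2))
    then show "x i \<ge> 0" "nat (x i) \<in> A" by auto
  qed
  show "inj_on (\<lambda>x. \<lambda>i\<in>{..<k}. nat (x i)) (int_solutions k a (int ` A))"
  proof (rule inj_onI)
    fix x y assume x: "x \<in> int_solutions k a (int ` A)" and y: "y \<in> int_solutions k a (int ` A)"
      and eq: "(\<lambda>i\<in>{..<k}. nat (x i)) = (\<lambda>i\<in>{..<k}. nat (y i))"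
    show "x = y"
    proof (rule PiE_ext)
      show "x \<in> {..<k} \<rightarrow>\<^sub>E int ` A" "y \<in> {..<k} \<rightarrow>\<^sub>E int ` A" using x y by (simp_all add: int_solutions_def)
      show "x i = y i" if "i \<in> {..<k}" for i
        using fun_cong[OF eq, of i] that nn(1)[OF x, of i] nn(1)[OF y, of i] by simp
    qed
  qed
  show "(\<lambda>x. \<lambda>i\<in>{..<k}. nat (x i)) ` int_solutions k a (int ` A) \<subseteq> solutions k a A"
  proof
    fix y assume "y \<in> (\<lambda>x. \<lambda>i\<in>{..<k}. nat (x i)) ` int_solutions k a (int ` A)"
    then obtain x where x: "x \<in> int_solutions k a (int ` A)" and y: "y = (\<lambda>i\<in>{..<k}. nat (x i))" by blast
    have "y \<in> {..<k} \<rightarrow>\<^sub>E A" unfolding y restrict_PiE_iff using nn(2)[OF x] by blast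
    moreover have "(\<Sum>i<k. a i * int (y i)) = (\<Sum>i<k. a i * x i)"
      using nn(1)[OF x] by (intro sum.cong refl) (simp add: y)
    ultimately show "y \<in> solutions k a A" using x by (simp add: int_solutions_def solutions_def)
  qed
qed

text \<open>Without frequencies, \<open>bohr N {} \<delta>\<close> for \<delta> between 1 and 2 is
  an interval of at most 5 N integers that contains A, so the iteration starts at density \<alpha>0
  = \<alpha>/5. The loss per variable is the exponential of d times ln (20/(q \<omega>)), of orders
  L^5 and L^2.\<close>

lemma card_int_solutions_lower:
  fixes a :: "nat \<Rightarrow> int" and Q \<alpha> L :: real
  defines "L \<equiv> ln (2 / \<alpha>)"
  assumes k: "k \<ge> 4" and a: "\<And>i. i < k \<Longrightarrow> a i \<noteq> 0" and inv: "(\<Sum>i<k. a i) = 0"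
    and Q: "Q \<ge> 1" "\<And>i. i < k \<Longrightarrow> \<bar>real_of_int (\<Prod>j\<in>{..<k} - {i}. a j)\<bar> \<le> Q"
    and A: "A \<subseteq> {1..int N}" "A \<noteq> {}" "\<alpha> = real (card A) / real N"
    and G: "G = 10 ^ 18 * real k ^ 4 * Q * (5 * 10 ^ 14 * real k) ^ 5 * (15 / 2) * (4 * 10 ^ 11)"
    and c1: "c1 = (10 + 804 * real k * (30 + 2 * ln G)) * (5 * 10 ^ 14 * real k)"
  shows "card (int_solutions k a A) \<ge> exp (- (448 * real k + real (k - 1) * c1) * L ^ 7) * real N ^ (k - 1)"
proof -
  define \<eta> where "\<eta> = 1 / (100 * real k)"
  have k4: "real k \<ge> 4" using k by simp
  have \<eta>: "0 < \<eta>" "\<eta> \<le> 1" using k4 by (auto simp: \<eta>_def)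
  have finA: "finite A" using A(1) finite_subset by blast
  have cA: "card A > 0" using A(2) finA by (simp add: card_gt_0_iff)
  have "card A \<le> card {1..int N}" using A(1) by (intro card_mono) auto
  then have cAN: "card A \<le> N" by simp
  have N: "N \<ge> 1" using cA cAN by linarith
  have \<alpha>: "0 < \<alpha>" "\<alpha> \<le> 1" using cA cAN N unfolding A(3) by auto
  define e where "e = exp L"
  have e: "e = 2 / \<alpha>" using \<alpha> by (simp add: e_def L_def)
  have \<alpha>e: "\<alpha> = 2 / e" using \<alpha> by (simp add: e)
  have e2: "e \<ge> 2" using \<alpha> unfolding e by (simp add: le_divide_eq)
  have epos: "e > 0" using e2 by linarith
  have "ln 2 \<le> L" unfolding L_def using \<alpha> by (subst ln_le_cancel_iff) (auto simp: le_divide_eq)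
  then have L: "L \<ge> 2 / 3" using ln2_ge_two_thirds by linarith
  have Le: "L \<le> e" unfolding e_def using exp_ge_add_one_self[of L] by linarith
  have epow: "e ^ j = exp (real j * L)" for j by (simp add: e_def exp_of_nat_mult)
  have p2: "2 ^ j \<le> e ^ j" for j using e2 by (intro power_mono) auto
  obtain l m m0 where params: "sampling_params (15 / \<alpha>) l m m0" and m0: "real m0 \<le> 3 * 10 ^ 11 * L ^ 4"
    using sampling_params_bounds[OF \<alpha>] unfolding L_def by blast
  define \<alpha>0 where "\<alpha>0 = \<alpha> / 5"
  define K where "K = 15 / \<alpha>"
  have \<alpha>0: "0 < \<alpha>0" using \<alpha> by (simp add: \<alpha>0_def)
  have K: "K = 3 / \<alpha>0" by (simp add: K_def \<alpha>0_def)
  have Ke: "K = 15 / 2 * e" by (simp add: K_def e)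
  \<comment> \<open>(1 + \<eta>)^n \<ge> exp (n \<eta>/2) \<ge> exp (4 L) = (2/\<alpha>)^4 once n
    \<ge> 800 k L, since \<eta> = 1/(100 k); this exceeds 1/\<alpha>0.\<close>
  define n where "n = nat \<lceil>800 * k * L\<rceil>"
  have kL: "800 * k * L \<ge> 0" using L by simp
  have n: "800 * k * L \<le> n" "n \<le> 800 * k * L + 1" unfolding n_def using kL by linarith+
  have kL1: "1 \<le> k * L"
  proof -
    have "4 * (2 / 3) \<le> k * L" using k4 L by (intro mult_mono) auto
    then show ?thesis by linarith
  qed
  have steps: "1 < \<alpha>0 * (1 + \<eta>) ^ n"
  proof -
    have "exp (\<eta> / 2) \<le> 1 + \<eta>"
    proof -
      have "exp (\<eta> / 2) \<le> 1 + \<eta> / 2 + (\<eta> / 2)\<^sup>2" using \<eta> by (intro exp_le_quadratic) auto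
      moreover have "(\<eta> / 2)\<^sup>2 \<le> \<eta> / 2" using \<eta> by (simp add: power2_eq_square mult_le_one)
      ultimately show ?thesis by linarith
    qed
    then have "exp (\<eta> / 2) ^ n \<le> (1 + \<eta>) ^ n" by (intro power_mono) auto
    then have "exp (n * (\<eta> / 2)) \<le> (1 + \<eta>) ^ n" by (simp only: exp_of_nat_mult)
    moreover have "4 * L \<le> n * (\<eta> / 2)"
    proof -
      have "800 * k * L * (\<eta> / 2) \<le> n * (\<eta> / 2)" using n \<eta> by (intro mult_right_mono) auto
      then show ?thesis using k4 by (simp add: \<eta>_def)
    qed
    then have "exp (4 * L) \<le> exp (n * (\<eta> / 2))" by simp
    then have "e ^ 4 \<le> exp (n * (\<eta> / 2))" by (simp add: epow)
    ultimately have "e ^ 4 \<le> (1 + \<eta>) ^ n" by linarith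
    moreover have "8 * e \<le> e ^ 4"
    proof -
      have "2 ^ 3 * e \<le> e ^ 3 * e" using p2[of 3] epos by (intro mult_right_mono) auto
      then show ?thesis by (simp add: power3_eq_cube power4_eq_xxxx)
    qed
    ultimately have "\<alpha>0 * (8 * e) \<le> \<alpha>0 * (1 + \<eta>) ^ n" using \<alpha>0 by (intro mult_left_mono) auto
    moreover have "\<alpha>0 * (8 * e) = 16 / 5" using epos by (simp add: \<alpha>0_def \<alpha>e)
    ultimately show ?thesis by linarith
  qed
  define d where "d = 2 * n * m0 + 1"
  have L4: "16 / 81 \<le> L ^ 4" "32 / 243 \<le> L ^ 5" "64 / 729 \<le> L ^ 6"
    using power_mono[OF L, of 4] power_mono[OF L, of 5] power_mono[OF L, of 6] by (simp_all add: power_divide)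
  have d_le: "real d \<le> 5 * 10 ^ 14 * real k * L ^ 5"
  proof -
    have "n \<le> 802 * (k * L)" using n(2) kL1 by linarith
    then have "real n * m0 \<le> (802 * (k * L)) * (3 * 10 ^ 11 * L ^ 4)"
      using m0 L by (intro mult_mono) auto
    also have "\<dots> = 2406 * 10 ^ 11 * (k * L ^ 5)" by (simp add: eval_nat_numeral)
    finally have "real d \<le> 2 * (2406 * 10 ^ 11 * (k * L ^ 5)) + 1" by (simp add: d_def mult.commute)
    moreover have "1 \<le> 8 * (k * L ^ 5)"
    proof -
      have "4 * (32 / 243) \<le> k * L ^ 5" using k4 L4 by (intro mult_mono) auto
      then show ?thesis by linarith
    qed
    ultimately show ?thesis by simp
  qed
  define G' where "G' = 10 ^ 18 * real k ^ 4 * Q * real d ^ 5 * K * (real m0 + 1)"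
  define q where "q = 1 / G'"
  have G1: "1 \<le> G"
  proof -
    have "1 * 1 * 1 * 1 * 1 * 1 \<le> 10 ^ 18 * real k ^ 4 * Q * (5 * 10 ^ 14 * real k) ^ 5 * (15 / 2) * (4 * 10 ^ 11)"
      using k4 Q by (intro mult_mono one_le_power mult_nonneg_nonneg) auto
    then show ?thesis unfolding G by simp
  qed
  \<comment> \<open>The exponent is 25 + 1 + 4: d^5 with L^5 \<le> e^5, the factor K, and m0 + 1
    with L^4 \<le> e^4. G collects what depends only on k and Q.\<close>
  have G': "0 < G'" "G' \<le> G * e ^ 30"
  proof -
    have d1: "real d \<ge> 1" by (simp add: d_def)
    have "L ^ 5 \<le> e ^ 5" using Le L by (intro power_mono) auto
    then have "5 * 10 ^ 14 * real k * L ^ 5 \<le> 5 * 10 ^ 14 * real k * e ^ 5" by (intro mult_left_mono) auto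
    then have "real d ^ 5 \<le> (5 * 10 ^ 14 * real k * e ^ 5) ^ 5" using d_le by (intro power_mono) auto
    then have de: "real d ^ 5 \<le> (5 * 10 ^ 14 * real k) ^ 5 * e ^ 25"
      by (simp only: power_mult_distrib power_mult[symmetric]) simp
    have me: "real m0 + 1 \<le> 4 * 10 ^ 11 * e ^ 4"
    proof -
      have "L ^ 4 \<le> e ^ 4" using Le L by (intro power_mono) auto
      moreover have "1 \<le> e ^ 4" using e2 by (intro one_le_power) auto
      ultimately show ?thesis using m0 by simp
    qed
    have "G' \<le> 10 ^ 18 * real k ^ 4 * Q * ((5 * 10 ^ 14 * real k) ^ 5 * e ^ 25) * (15 / 2 * e) * (4 * 10 ^ 11 * e ^ 4)"
      unfolding G'_def Ke using de me k4 Q epos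
      by (intro mult_mono order_refl mult_nonneg_nonneg) auto
    also have "\<dots> = G * (e ^ 25 * e ^ 1 * e ^ 4)" unfolding G by (simp add: mult_ac)
    also have "\<dots> = G * e ^ 30" by (simp only: power_add[symmetric]) simp
    finally show "G' \<le> G * e ^ 30" .
    show "0 < G'" unfolding G'_def Ke using k4 Q epos d1
      by (intro mult_pos_pos zero_less_power) auto
  qed
  \<comment> \<open>1 \<le> 2 L turns the constant ln G into 2 L ln G, so that ln G' is bounded by a
    multiple of L.\<close>
  define cq where "cq = 30 + 2 * ln G"
  have lnG: "ln G \<ge> 0" using G1 by simp
  have cq0: "cq \<ge> 0" using lnG by (simp add: cq_def)
  have G'exp: "G' \<le> exp (cq * L)"
  proof -
    have "ln G * 1 \<le> ln G * (2 * L)" using lnG L by (intro mult_left_mono) auto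
    then have "exp (ln G) \<le> exp (2 * ln G * L)" by simp
    then have "G \<le> exp (2 * ln G * L)" using G1 by simp
    then have "G * e ^ 30 \<le> exp (2 * ln G * L) * e ^ 30" using epos by (intro mult_right_mono) auto
    also have "\<dots> = exp (2 * ln G * L) * exp (30 * L)" by (simp add: epow)
    also have "\<dots> = exp (cq * L)" by (simp add: cq_def exp_add[symmetric] algebra_simps)
    finally show ?thesis using G'(2) by linarith
  qed
  obtain \<delta> where \<delta>: "1 \<le> \<delta>" "\<delta> \<le> 2" "bohr_reg N {} \<eta> \<delta>"
    using exists_bohr_reg[of "{}" 2 N \<eta>] N \<eta> by auto
  have dens: "\<alpha>0 * card (bohr N {} \<delta>) \<le> card (A \<inter> bohr N {} \<delta>)"
  proof -
    have "bohr N {} \<delta> \<subseteq> {- (2 * int N)..2 * int N}"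
    proof
      fix x assume "x \<in> bohr N {} \<delta>"
      then have "\<bar>real_of_int x\<bar> \<le> \<delta> * N" by (simp add: bohr_def)
      also have "\<dots> \<le> 2 * real N" using \<delta> by (intro mult_right_mono) auto
      finally show "x \<in> {- (2 * int N)..2 * int N}" by (simp add: abs_le_iff)
    qed
    then have "card (bohr N {} \<delta>) \<le> card {- (2 * int N)..2 * int N}" by (intro card_mono) auto
    also have "\<dots> \<le> 5 * N" using N by simp
    finally have "real (card (bohr N {} \<delta>)) \<le> 5 * real N" by simp
    then have "\<alpha>0 * card (bohr N {} \<delta>) \<le> \<alpha>0 * (5 * real N)" using \<alpha>0 by (intro mult_left_mono) auto
    also have "\<dots> = card A" using N by (simp add: \<alpha>0_def A(3))
    also have "A = A \<inter> bohr N {} \<delta>"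
    proof -
      have "x \<in> bohr N {} \<delta>" if "x \<in> A" for x
      proof -
        have "1 \<le> x" "x \<le> int N" using that A(1) by auto
        then have "\<bar>real_of_int x\<bar> \<le> 1 * real N" by simp
        also have "\<dots> \<le> \<delta> * N" using \<delta> by (intro mult_right_mono) auto
        finally show ?thesis by (simp add: bohr_def)
      qed
      then show ?thesis by blast
    qed
    finally show ?thesis .
  qed
  have q: "0 < q" using G' by (simp add: q_def)
  \<comment> \<open>Bounds the radius after n steps from below, as the starting radius is at least
    1.\<close>
  define \<omega> where "\<omega> = q ^ n"
  have \<omega>: "0 < \<omega>" "\<omega> \<le> q ^ n * \<delta>"
    using q \<delta> mult_left_mono[of 1 \<delta> "q ^ n"] by (auto simp: \<omega>_def)
  have "(\<alpha>0 / 20) ^ k * (real N / (20 / (q * \<omega>)) ^ d) ^ (k - 1) \<le> card (int_solutions k a A)"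
    unfolding q_def G'_def
    by (rule density_iteration[where \<Theta> = "{}" and \<delta> = \<delta> and \<alpha> = \<alpha>0 and n = n, OF k a inv Q N \<alpha>0 K params[folded K_def]])
      (use \<omega> \<delta> finA dens steps in \<open>auto simp: d_def q_def G'_def \<eta>_def\<close>)
  moreover have "exp (- (448 * real k) * L ^ 7) \<le> (\<alpha>0 / 20) ^ k"
  proof -
    have "2 ^ 6 * e \<le> e ^ 6 * e" using p2[of 6] epos by (intro mult_right_mono) auto
    then have "50 * e \<le> e ^ 6 * e" using epos by simp
    also have "\<dots> = exp (7 * L)" using epow[of 7] by (simp add: eval_nat_numeral mult_ac)
    finally have "1 / exp (7 * L) \<le> 1 / (50 * e)" using epos by (intro divide_left_mono) auto
    then have "exp (- (7 * L)) \<le> \<alpha>0 / 20" by (simp add: exp_minus inverse_eq_divide \<alpha>0_def \<alpha>e)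
    then have "exp (- (7 * L)) ^ k \<le> (\<alpha>0 / 20) ^ k" by (intro power_mono) auto
    moreover have "exp (- (448 * real k) * L ^ 7) \<le> exp (- (7 * L)) ^ k"
    proof -
      have "1 * L \<le> (64 * L ^ 6) * L" using L4(3) L by (intro mult_right_mono) auto
      then have "L \<le> 64 * L ^ 7" by (simp add: eval_nat_numeral mult_ac)
      then have "7 * k * L \<le> 7 * k * (64 * L ^ 7)" by (intro mult_left_mono) auto
      then show ?thesis by (simp add: exp_of_nat_mult[symmetric] mult_ac)
    qed
    ultimately show ?thesis by linarith
  qed
  moreover have "exp (- (real (k - 1) * c1) * L ^ 7) * real N ^ (k - 1) \<le> (real N / (20 / (q * \<omega>)) ^ d) ^ (k - 1)"
  proof -
    \<comment> \<open>n factors from the steps and one more for the passage to \<open>low\<close>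
      when the iteration stops.\<close>
    have "20 / (q * \<omega>) = 20 * G' ^ (n + 1)" by (simp add: \<omega>_def q_def power_divide)
    also have "\<dots> \<le> exp (5 * L) * exp (cq * L) ^ (n + 1)"
    proof (rule mult_mono)
      have "20 \<le> e ^ 5" using p2[of 5] by simp
      then show "20 \<le> exp (5 * L)" by (simp add: epow)
      show "G' ^ (n + 1) \<le> exp (cq * L) ^ (n + 1)" using G'exp G' by (intro power_mono) auto
    qed (use G' in auto)
    also have "\<dots> = exp (5 * L + (n + 1) * (cq * L))" by (simp add: exp_add exp_of_nat_mult[symmetric] algebra_simps)
    also have "\<dots> \<le> exp ((10 + 804 * k * cq) * L\<^sup>2)"
    proof -
      have "5 * L * 1 \<le> 5 * L * (2 * L)" using L by (intro mult_left_mono) auto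
      then have "5 * L \<le> 10 * L\<^sup>2" by (simp add: power2_eq_square)
      moreover have "(n + 1) * (cq * L) \<le> (804 * (k * L)) * (cq * L)"
        using n(2) kL1 cq0 L by (intro mult_right_mono) auto
      then have "(n + 1) * (cq * L) \<le> 804 * k * cq * L\<^sup>2" by (simp add: power2_eq_square mult_ac)
      ultimately show ?thesis by (simp add: algebra_simps)
    qed
    finally have base: "20 / (q * \<omega>) \<le> exp ((10 + 804 * k * cq) * L\<^sup>2)" .
    have "(20 / (q * \<omega>)) ^ d \<le> exp ((10 + 804 * k * cq) * L\<^sup>2) ^ d"
      using base q \<omega> by (intro power_mono) auto
    also have "\<dots> = exp (d * ((10 + 804 * k * cq) * L\<^sup>2))" by (simp only: exp_of_nat_mult)
    also have "\<dots> \<le> exp (c1 * L ^ 7)"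
    proof -
      have "d * ((10 + 804 * k * cq) * L\<^sup>2) \<le> (5 * 10 ^ 14 * real k * L ^ 5) * ((10 + 804 * k * cq) * L\<^sup>2)"
        using d_le cq0 by (intro mult_right_mono) auto
      also have "\<dots> = c1 * L ^ 7" unfolding c1 cq_def by (simp add: eval_nat_numeral mult_ac)
      finally show ?thesis by simp
    qed
    finally have "(20 / (q * \<omega>)) ^ d \<le> exp (c1 * L ^ 7)" .
    moreover have "0 < (20 / (q * \<omega>)) ^ d" using q \<omega> by simp
    ultimately have "real N / exp (c1 * L ^ 7) \<le> real N / (20 / (q * \<omega>)) ^ d" by (intro divide_left_mono) auto
    then have "(real N / exp (c1 * L ^ 7)) ^ (k - 1) \<le> (real N / (20 / (q * \<omega>)) ^ d) ^ (k - 1)"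
      by (intro power_mono) auto
    moreover have "(real N / exp (c1 * L ^ 7)) ^ (k - 1) = exp (- (real (k - 1) * c1) * L ^ 7) * real N ^ (k - 1)"
    proof -
      have "exp (- (real (k - 1) * c1) * L ^ 7) = exp (- (real (k - 1) * (c1 * L ^ 7)))"
        by (simp add: mult.assoc)
      also have "\<dots> = 1 / exp (c1 * L ^ 7) ^ (k - 1)"
        by (simp only: exp_minus exp_of_nat_mult inverse_eq_divide)
      finally show ?thesis by (simp add: power_divide)
    qed
    ultimately show ?thesis by simp
  qed
  ultimately have "exp (- (448 * real k) * L ^ 7) * (exp (- (real (k - 1) * c1) * L ^ 7) * real N ^ (k - 1)) \<le> card (int_solutions k a A)"
    by (meson exp_ge_zero mult_mono' mult_nonneg_nonneg of_nat_0_le_iff order_trans zero_le_power)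
  moreover have "- (448 * real k + real (k - 1) * c1) * L ^ 7 = - (448 * real k) * L ^ 7 + - (real (k - 1) * c1) * L ^ 7"
    by (simp add: algebra_simps)
  ultimately show ?thesis by (simp only: exp_add mult.assoc)
qed

theorem theorem3:
  fixes k :: nat and a :: "nat \<Rightarrow> int"
  assumes "k \<ge> 4"
    and "\<forall>i<k. a i \<noteq> 0"
    and "invariant_eq k a"
  shows "\<exists>C>0. \<forall>(N::nat) (A::nat set) (\<alpha>::real).
           A \<subseteq> {1..N} \<longrightarrow> A \<noteq> {} \<longrightarrow> \<alpha> = real (card A) / real N \<longrightarrow>
           real (card (solutions k a A)) \<ge> exp (- C * (ln (2 / \<alpha>)) ^ 7) * real N ^ (k - 1)"
proof -
  \<comment> \<open>One bound for all the dilation factors c_i; the added 1 secures Q \<ge> 1. The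
    constant C is built from k and the coefficients alone.\<close>
  define Q where "Q = 1 + (\<Sum>i<k. \<bar>real_of_int (\<Prod>j\<in>{..<k} - {i}. a j)\<bar>)"
  define G where "G = 10 ^ 18 * real k ^ 4 * Q * (5 * 10 ^ 14 * real k) ^ 5 * (15 / 2) * (4 * 10 ^ 11)"
  define c1 where "c1 = (10 + 804 * real k * (30 + 2 * ln G)) * (5 * 10 ^ 14 * real k)"
  define C where "C = 448 * real k + real (k - 1) * c1"
  have Q: "Q \<ge> 1" unfolding Q_def by (simp add: sum_nonneg)
  have Qi: "\<bar>real_of_int (\<Prod>j\<in>{..<k} - {i}. a j)\<bar> \<le> Q" if "i < k" for i
    using member_le_sum[of i "{..<k}" "\<lambda>i. \<bar>real_of_int (\<Prod>j\<in>{..<k} - {i}. a j)\<bar>"] that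
    by (simp add: Q_def)
  have k1: "real k \<ge> 1" using assms(1) by simp
  have "1 * 1 * 1 * 1 * 1 * 1 \<le> 10 ^ 18 * real k ^ 4 * Q * (5 * 10 ^ 14 * real k) ^ 5 * (15 / 2) * (4 * 10 ^ 11)"
    using k1 Q by (intro mult_mono one_le_power mult_nonneg_nonneg) auto
  then have "ln G \<ge> 0" unfolding G_def by simp
  then have "c1 \<ge> 0" by (simp add: c1_def)
  then have "C > 0" using k1 by (simp add: C_def add_pos_nonneg)
  moreover have "exp (- C * (ln (2 / \<alpha>)) ^ 7) * real N ^ (k - 1) \<le> card (solutions k a A)"
    if A: "A \<subseteq> {1..N}" "A \<noteq> {}" "\<alpha> = real (card A) / real N" for N A \<alpha>
  proof -
    have cint: "card (int ` A) = card A" by (rule card_image) simp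
    have fin: "finite A" using A(1) finite_subset by blast
    have "exp (- C * (ln (2 / \<alpha>)) ^ 7) * real N ^ (k - 1) \<le> card (int_solutions k a (int ` A))"
      unfolding C_def
    proof (rule card_int_solutions_lower[OF assms(1) _ _ Q Qi _ _ _ G_def c1_def])
      show "a i \<noteq> 0" if "i < k" for i using assms(2) that by blast
      show "(\<Sum>i<k. a i) = 0" using assms(3) by (simp add: invariant_eq_def)
      show "int ` A \<subseteq> {1..int N}" using A(1) by auto
    qed (use A cint in auto)
    also have "\<dots> \<le> card (solutions k a A)"
      using card_int_solutions_le_card_solutions[OF fin, of k a] by (simp only: of_nat_le_iff)
    finally show ?thesis .
  qed
  ultimately show ?thesis by blast
qed

end
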